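(* Let $\mathrm A:\mathcal S\to\mathcal S'$ be a continuous, symmetric, $\boldsymbol p$-conditionally positive-definite operator. Then, for any given biorthogonal system $(\boldsymbol p,\boldsymbol\phi)$, the bilinear form $$\langle f,g\rangle_{\mathcal H'}=\langle(\mathrm A_{\boldsymbol\phi}+\mathrm R_{\boldsymbol p})f,g\rangle$$ is a valid inner product on $\mathcal S$. By completion, it specifies the Hilbert space $\mathcal H'=\overline{(\mathcal S,\|\cdot\|_{\mathcal H'})}=\mathcal H_{\mathrm A}\oplus\mathcal N_{\boldsymbol\phi}$, where $\mathcal H_{\mathrm A}=\{f\in\mathcal H':\boldsymbol p(f)=\boldsymbol 0\}=\overline{(\mathcal S_{\boldsymbol p},\|\cdot\|_{\mathcal H'})}$ is the Hilbert space that is the orthogonal complement of $\mathcal N_{\boldsymbol\phi}$ in $\mathcal H'$. The predual of $\mathcal H'$ is the Hilbert space $\mathcal H=\mathcal H_{\mathrm A}'\oplus\mathcal N_{\boldsymbol p}$ associated with the inner product $\langle f,g\rangle_{\mathcal H}=\langle(\mathrm A^{-1}+\mathrm R_{\boldsymbol\phi})f,g\rangle$, where $\mathrm A^{-1}$ is the unique operator such that $\mathrm A^{-1}|_{\mathcal H_{\mathrm A}'}=\mathrm A_{\boldsymbol\phi}^{-1}=\mathrm J_{\mathcal H_{\mathrm A}'}:\mathcal H_{\mathrm A}'\to\mathcal H_{\mathrm A}$ (the inverse of the Riesz map $\mathrm J_{\mathcal H_{\mathrm A}}$) and $\mathrm A^{-1}|_{\mathcal N_{\boldsymbol p}}=0$,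 so that its null space is precisely $\mathcal N_{\boldsymbol p}$.
   Context: All vector spaces are real. $(\mathcal S,\mathcal S')$ is a dual pair of complete nuclear spaces, which are reflexive ($\mathcal S''=\mathcal S$), with $\mathcal S$ canonically, continuously and densely embedded in $\mathcal S'$. $\langle\cdot,\cdot\rangle$ denotes the duality product, used with either order of arguments and extended by continuity to dual pairs of Hilbert spaces $\mathcal H'\times\mathcal H$ lying between $\mathcal S$ and $\mathcal S'$. Completion of $\mathcal S$ in a norm $\|\cdot\|$ is denoted $\overline{(\mathcal S,\|\cdot\|)}$. $\boldsymbol p=(p_1,\dots,p_{N_0})$ is a linearly independent family in $\mathcal S'$, $\mathcal N_{\boldsymbol p}=\mathrm{span}\{p_n\}$, $\boldsymbol p(f)=(\langle p_1,f\rangle,\dots,\langle p_{N_0},f\rangle)$, and $\mathcal S_{\boldsymbol p}=\{\varphi\in\mathcal S:\boldsymbol p(\varphi)=\boldsymbol 0\}$. A continuous operator $\mathrm A:\mathcal S\to\mathcal S'$ is symmetric if $\langle\mathrm A\varphi_1,\varphi_2\rangle=\langle\mathrm A\varphi_2,\varphi_1\rangle$ for all $\varphi_1,\varphi_2\in\mathcal S$, and $\boldsymbol p$-conditionally positive-definite if $\langle\mathrm A\varphi,\varphi\rangle>0$ for all $\varphi\in\mathcal S_{\boldsymbol p}\setminus\{0\}$. A biorthogonal system $(\boldsymbol p,\boldsymbol\phi)$ consists of $\boldsymbol p$ and $\boldsymbol\phi=(\phi_1,\dots,\phi_{N_0})$ with $\langle p_n,\phi_m\rangle=\delta_{m-n}$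 (Kronecker delta). It is universal if all $\phi_n\in\mathcal S$. Non-universal systems, with $\phi_n$ in the Hilbert space $\mathcal H'$ (which as a set does not depend on the choice of system), are also allowed, with the operators below being understood in the sense of their continuous extensions. $\mathcal N_{\boldsymbol\phi}=\mathrm{span}\{\phi_n\}$. The finite-rank operators are $\mathrm R_{\boldsymbol p}f=\sum_{n}p_n\langle p_n,f\rangle$ and $\mathrm R_{\boldsymbol\phi}f=\sum_n\phi_n\langle\phi_n,f\rangle$. The corrected operator is $$\mathrm A_{\boldsymbol\phi}=(\mathrm{Id}-\mathrm R_{\boldsymbol p}\mathrm R_{\boldsymbol\phi})\,\mathrm A\,(\mathrm{Id}-\mathrm R_{\boldsymbol\phi}\mathrm R_{\boldsymbol p}):\mathcal S\to\mathcal S'.$$ For a dual pair of Hilbert spaces $(\mathcal X,\mathcal X')$, the Riesz map $\mathrm J_{\mathcal X}:\mathcal X\to\mathcal X'$ is the linear isometric isomorphism with $\langle\mathrm J_{\mathcal X}f,g\rangle=\langle f,g\rangle_{\mathcal X}$ for all $f,g\in\mathcal X$, and $\mathrm J_{\mathcal X'}=\mathrm J_{\mathcal X}^{-1}$. In the direct sum $\mathcal H'=\mathcal H_{\mathrm A}\oplus\mathcal N_{\boldsymbol\phi}$, the dual of $\mathcal N_{\boldsymbol\phi}$ is $\mathcal N_{\boldsymbol p}$. *)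

theory Defs
  imports "HOL-Analysis.Analysis"
begin

section \<open>Locally convex spaces and the strong dual\<close>

text \<open>Real locally convex Hausdorff spaces.  The class of uniform topological groups fixes the
  uniformity to be the translation-invariant one, so that \<^const>\<open>complete\<close> has its usual meaning
  (convergence of all Cauchy filters).\<close>

class locally_convex_space = real_vector + uniform_topological_group_add + t2_space +
  assumes tendsto_scaleR_prod:
      "filterlim (\<lambda>(c, x). c *\<^sub>R x) (nhds (c *\<^sub>R x)) (nhds c \<times>\<^sub>F nhds x)"
    and locally_convex:
      "open U \<Longrightarrow> 0 \<in> U \<Longrightarrow>
        \<exists>W. open W \<and> 0 \<in> W \<and> W \<subseteq> U \<and>
          (\<forall>x\<in>W. \<forall>y\<in>W. \<forall>s\<ge>0. \<forall>t\<ge>0. s + t = 1 \<longrightarrow> s *\<^sub>R x + t *\<^sub>R y \<in> W)"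

text \<open>Von Neumann boundedness.\<close>

definition vn_bounded :: "'a::locally_convex_space set \<Rightarrow> bool" where
  "vn_bounded B \<longleftrightarrow>
    (\<forall>U. open U \<longrightarrow> 0 \<in> U \<longrightarrow> (\<exists>r>0. \<forall>t. \<bar>t\<bar> \<le> r \<longrightarrow> (\<forall>x\<in>B. t *\<^sub>R x \<in> U)))"

typedef (overloaded) 'a dual =
  "{u :: 'a::locally_convex_space \<Rightarrow> real. linear u \<and> continuous_on UNIV u}"
  morphisms dual_apply Dual
  by (rule exI[of _ "\<lambda>_. 0"]) (auto simp: linear_iff)

setup_lifting type_definition_dual

lemma linear_dual_apply: "linear (dual_apply u)"
  and continuous_dual_apply: "continuous_on UNIV (dual_apply u)"
  using dual_apply[of u] by auto

lemma dual_apply_simps: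
  "dual_apply u (x + y) = dual_apply u x + dual_apply u y"
  "dual_apply u (c *\<^sub>R x) = c * dual_apply u x"
  "dual_apply u 0 = 0"
  using linear_dual_apply[of u] by (auto simp: linear_add linear_cmul linear_0)

instantiation dual :: (locally_convex_space) real_vector
begin

lift_definition zero_dual :: "'a dual" is "\<lambda>_. 0" by (auto simp: linear_iff)
lift_definition plus_dual :: "'a dual \<Rightarrow> 'a dual \<Rightarrow> 'a dual" is "\<lambda>u v x. u x + v x"
  by (auto intro!: continuous_intros linear_compose_add)
lift_definition uminus_dual :: "'a dual \<Rightarrow> 'a dual" is "\<lambda>u x. - u x"
  by (auto intro!: continuous_intros linear_compose_neg)
lift_definition minus_dual :: "'a dual \<Rightarrow> 'a dual \<Rightarrow> 'a dual" is "\<lambda>u v x. u x - v x"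
  by (auto intro!: continuous_intros linear_compose_sub)
lift_definition scaleR_dual :: "real \<Rightarrow> 'a dual \<Rightarrow> 'a dual" is "\<lambda>c u x. c * u x"
  by (auto intro!: continuous_intros simp: linear_iff algebra_simps)

instance
  by (standard; transfer; auto simp: algebra_simps)

end

lemmas dual_apply_rep = zero_dual.rep_eq plus_dual.rep_eq uminus_dual.rep_eq
  minus_dual.rep_eq scaleR_dual.rep_eq

text \<open>The strong dual topology: uniform convergence on bounded sets.\<close>

instantiation dual :: (locally_convex_space) uniformity
begin

definition uniformity_dual :: "('a dual \<times> 'a dual) filter" where
  "uniformity_dual =
    (INF (B, e)\<in>{(B, e). vn_bounded B \<and> 0 < e}.
      principal {(u, v). \<forall>x\<in>B. \<bar>dual_apply u x - dual_apply v x\<bar> < e})"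

instance ..

end

instantiation dual :: (locally_convex_space) "open"
begin

definition open_dual :: "'a dual set \<Rightarrow> bool" where
  "open_dual U \<longleftrightarrow> (\<forall>u\<in>U. \<forall>\<^sub>F (u', v) in uniformity. u' = u \<longrightarrow> v \<in> U)"

instance ..

end

lemma vn_bounded_empty: "vn_bounded {}"
  unfolding vn_bounded_def by (auto intro: exI[of _ 1])

lemma vn_bounded_Un: "vn_bounded B \<Longrightarrow> vn_bounded C \<Longrightarrow> vn_bounded (B \<union> C)"
  unfolding vn_bounded_def
proof safe
  fix U :: "'a set"
  assume *: "\<forall>U. open U \<longrightarrow> 0 \<in> U \<longrightarrow> (\<exists>r>0. \<forall>t. \<bar>t\<bar> \<le> r \<longrightarrow> (\<forall>x\<in>B. t *\<^sub>R x \<in> U))"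
    "\<forall>U. open U \<longrightarrow> 0 \<in> U \<longrightarrow> (\<exists>r>0. \<forall>t. \<bar>t\<bar> \<le> r \<longrightarrow> (\<forall>x\<in>C. t *\<^sub>R x \<in> U))"
    and U: "open U" "0 \<in> U"
  from * U obtain r s where "r > 0" "\<forall>t. \<bar>t\<bar> \<le> r \<longrightarrow> (\<forall>x\<in>B. t *\<^sub>R x \<in> U)"
    "s > 0" "\<forall>t. \<bar>t\<bar> \<le> s \<longrightarrow> (\<forall>x\<in>C. t *\<^sub>R x \<in> U)" by meson
  then show "\<exists>r>0. \<forall>t. \<bar>t\<bar> \<le> r \<longrightarrow> (\<forall>x\<in>B \<union> C. t *\<^sub>R x \<in> U)"
    by (intro exI[of _ "min r s"]) auto
qed

lemma vn_bounded_singleton: "vn_bounded {x}"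
  unfolding vn_bounded_def
proof safe
  fix U :: "'a set" assume U: "open U" "0 \<in> U"
  have "((\<lambda>c. (c, x)) \<longlongrightarrow> (0, x)) (nhds (0::real))"
    by (intro tendsto_Pair tendsto_const filterlim_ident)
  then have "filterlim (\<lambda>c. (c, x)) (nhds 0 \<times>\<^sub>F nhds x) (nhds (0::real))"
    by (simp add: nhds_prod)
  from filterlim_compose[OF tendsto_scaleR_prod this]
  have "((\<lambda>c. c *\<^sub>R x) \<longlongrightarrow> 0) (nhds 0)" by simp
  then have "\<forall>\<^sub>F c in nhds 0. c *\<^sub>R x \<in> U"
    using U by (rule topological_tendstoD)
  then obtain d where "d > 0" "\<forall>c. dist c 0 < d \<longrightarrow> c *\<^sub>R x \<in> U"
    unfolding eventually_nhds_metric by blast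
  then show "\<exists>r>0. \<forall>t. \<bar>t\<bar> \<le> r \<longrightarrow> (\<forall>y\<in>{x}. t *\<^sub>R y \<in> U)"
    by (intro exI[of _ "d / 2"]) (auto simp: dist_real_def)
qed

lemma dual_apply_bounded:
  assumes "vn_bounded B"
  obtains M where "M > 0" "\<And>x. x \<in> B \<Longrightarrow> \<bar>dual_apply u x\<bar> < M"
proof -
  let ?U = "dual_apply u -` {-1<..<1}"
  have "open ?U"
    using continuous_dual_apply[of u] by (intro open_vimage) auto
  moreover have "0 \<in> ?U" by (simp add: dual_apply_simps)
  ultimately obtain r where r: "r > 0" "\<And>x. x \<in> B \<Longrightarrow> r *\<^sub>R x \<in> ?U"
    using assms unfolding vn_bounded_def by (metis abs_of_pos order_refl)
  show thesis
  proof (rule that[of "1 / r"])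
    fix x assume "x \<in> B"
    from r(2)[OF this] have "\<bar>r * dual_apply u x\<bar> < 1" by (auto simp: dual_apply_simps)
    with r(1) show "\<bar>dual_apply u x\<bar> < 1 / r" by (simp add: abs_mult field_simps)
  qed (use r in auto)
qed

lemma eventually_uniformity_dual:
  "eventually P (uniformity :: ('a::locally_convex_space dual \<times> 'a dual) filter) \<longleftrightarrow>
    (\<exists>B e. vn_bounded B \<and> 0 < e \<and>
      (\<forall>u v. (\<forall>x\<in>B. \<bar>dual_apply u x - dual_apply v x\<bar> < e) \<longrightarrow> P (u, v)))"
proof -
  let ?S = "{(B, e). vn_bounded (B::'a set) \<and> (0::real) < e}"
  let ?E = "\<lambda>(B, e). {(u, v). \<forall>x\<in>B. \<bar>dual_apply u x - dual_apply v x\<bar> < e}"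
  have "eventually P (INF b\<in>?S. principal (?E b)) \<longleftrightarrow> (\<exists>b\<in>?S. eventually P (principal (?E b)))"
  proof (rule eventually_INF_base)
    show "?S \<noteq> {}" using vn_bounded_empty by (auto intro: exI[of _ 1])
  next
    fix b c assume "b \<in> ?S" "c \<in> ?S"
    then show "\<exists>d\<in>?S. principal (?E d) \<le> inf (principal (?E b)) (principal (?E c))"
      by (intro bexI[of _ "(fst b \<union> fst c, min (snd b) (snd c))"]) (auto simp: vn_bounded_Un)
  qed
  then show ?thesis
    unfolding uniformity_dual_def by (auto simp: case_prod_unfold eventually_principal)
qed

lemma eventually_nhds_dual_aux:
  assumes "vn_bounded B" "0 < e"
  shows "\<forall>\<^sub>F (u, v) in (uniformity :: ('a::locally_convex_space dual \<times> 'a dual) filter).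
    \<forall>x\<in>B. \<bar>dual_apply u x - dual_apply v x\<bar> < e"
  unfolding eventually_uniformity_dual using assms by auto

lemma abs_half_triangle:
  fixes a :: real
  shows "\<bar>a - b\<bar> < e / 2 \<Longrightarrow> \<bar>b - c\<bar> < e / 2 \<Longrightarrow> \<bar>a - c\<bar> < e"
    and "\<bar>a - a'\<bar> < e / 2 \<Longrightarrow> \<bar>b - b'\<bar> < e / 2 \<Longrightarrow> \<bar>a + b - (a' + b')\<bar> < e"
  by (smt (verit) field_sum_of_halves)+

instance dual :: (locally_convex_space) open_uniformity
  by (standard; rule open_dual_def)

instance dual :: (locally_convex_space) uniform_space
proof
  fix E :: "'a dual \<times> 'a dual \<Rightarrow> bool" and u
  assume "eventually E uniformity"
  then show "E (u, u)" unfolding eventually_uniformity_dual by auto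
next
  fix E :: "'a dual \<times> 'a dual \<Rightarrow> bool"
  assume "eventually E uniformity"
  then obtain B e where "vn_bounded B" "0 < e"
    "\<And>u v. (\<forall>x\<in>B. \<bar>dual_apply u x - dual_apply v x\<bar> < e) \<Longrightarrow> E (u, v)"
    unfolding eventually_uniformity_dual by auto
  then show "\<forall>\<^sub>F (u, v) in uniformity. E (v, u)"
    unfolding eventually_uniformity_dual
    by (intro exI[of _ B] exI[of _ e]) (auto simp: abs_minus_commute)
next
  fix E :: "'a dual \<times> 'a dual \<Rightarrow> bool"
  assume "eventually E uniformity"
  then obtain B e where Be: "vn_bounded B" "0 < e"
    "\<And>u v. (\<forall>x\<in>B. \<bar>dual_apply u x - dual_apply v x\<bar> < e) \<Longrightarrow> E (u, v)"
    unfolding eventually_uniformity_dual by auto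
  let ?D = "\<lambda>(u, v). \<forall>x\<in>B. \<bar>dual_apply u x - dual_apply v x\<bar> < e / 2"
  have "E (u, w)" if "?D (u, v)" "?D (v, w)" for u v w
    using that by (intro Be(3)) (unfold case_prod_conv, blast intro: abs_half_triangle(1))
  moreover have "eventually ?D uniformity"
    by (rule eventually_nhds_dual_aux) (use Be in auto)
  ultimately show "\<exists>D. eventually D uniformity \<and> (\<forall>x y z. D (x, y) \<longrightarrow> D (y, z) \<longrightarrow> E (x, z))"
    by blast
qed

lemma filterlim_uniformity_dual_iff:
  "filterlim h (uniformity :: ('a::locally_convex_space dual \<times> 'a dual) filter) F \<longleftrightarrow>
    (\<forall>B e. vn_bounded B \<longrightarrow> 0 < e \<longrightarrow>
      (\<forall>\<^sub>F z in F. \<forall>x\<in>B. \<bar>dual_apply (fst (h z)) x - dual_apply (snd (h z)) x\<bar> < e))"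
  (is "?L \<longleftrightarrow> ?R")
proof
  assume ?L
  then show ?R
    unfolding filterlim_iff using eventually_nhds_dual_aux by (fastforce simp: case_prod_unfold)
next
  assume R: ?R
  show ?L
    unfolding filterlim_iff
  proof safe
    fix P :: "'a dual \<times> 'a dual \<Rightarrow> bool"
    assume "eventually P uniformity"
    then obtain B e where Be: "vn_bounded B" "0 < e"
      "\<And>u v. (\<forall>x\<in>B. \<bar>dual_apply u x - dual_apply v x\<bar> < e) \<Longrightarrow> P (u, v)"
      unfolding eventually_uniformity_dual by auto
    from R Be(1,2)
    have "\<forall>\<^sub>F z in F. \<forall>x\<in>B. \<bar>dual_apply (fst (h z)) x - dual_apply (snd (h z)) x\<bar> < e" by blast
    then show "\<forall>\<^sub>F z in F. P (h z)"
      by eventually_elim (metis Be(3) surjective_pairing)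
  qed
qed

lemma tendsto_dual_iff:
  fixes f :: "'b \<Rightarrow> 'a::locally_convex_space dual"
  shows "(f \<longlongrightarrow> u) F \<longleftrightarrow> (\<forall>B e. vn_bounded B \<longrightarrow> 0 < e \<longrightarrow>
    (\<forall>\<^sub>F z in F. \<forall>x\<in>B. \<bar>dual_apply (f z) x - dual_apply u x\<bar> < e))"
proof -
  have "(f \<longlongrightarrow> u) F \<longleftrightarrow> filterlim (\<lambda>z. (u, f z)) uniformity F"
    unfolding filterlim_iff eventually_nhds_uniformity
  proof safe
    fix P :: "'a dual \<times> 'a dual \<Rightarrow> bool"
    assume *: "\<forall>P. (\<forall>\<^sub>F (x', y) in uniformity. x' = u \<longrightarrow> P y) \<longrightarrow> (\<forall>\<^sub>F x in F. P (f x))"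
      and "eventually P uniformity"
    then have "\<forall>\<^sub>F (x', y) in uniformity. x' = u \<longrightarrow> P (u, y)"
      by (auto elim!: eventually_mono)
    with * show "\<forall>\<^sub>F z in F. P (u, f z)" by auto
  next
    fix P :: "'a dual \<Rightarrow> bool"
    assume *: "\<forall>P. eventually P uniformity \<longrightarrow> (\<forall>\<^sub>F z in F. P (u, f z))"
      and P: "\<forall>\<^sub>F (x', y) in uniformity. x' = u \<longrightarrow> P y"
    from *[rule_format, OF P] show "\<forall>\<^sub>F z in F. P (f z)" by simp
  qed
  then show ?thesis
    unfolding filterlim_uniformity_dual_iff by (simp add: abs_minus_commute)
qed

lemma eventually_dual_ball:
  fixes u :: "'a::locally_convex_space dual"
  assumes "vn_bounded B" "0 < e"
  shows "\<forall>\<^sub>F v in nhds u. \<forall>x\<in>B. \<bar>dual_apply v x - dual_apply u x\<bar> < e"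
  using assms tendsto_dual_iff[of "\<lambda>v. v" u "nhds u"] by (simp add: filterlim_ident)

instance dual :: (locally_convex_space) uniform_topological_group_add
proof
  fix a b :: "'a dual"
  show "((\<lambda>x. fst x + snd x) \<longlongrightarrow> a + b) (nhds a \<times>\<^sub>F nhds b)"
    unfolding tendsto_dual_iff
  proof safe
    fix B :: "'a set" and e :: real assume *: "vn_bounded B" "0 < e"
    have "\<forall>\<^sub>F v in nhds a. \<forall>x\<in>B. \<bar>dual_apply v x - dual_apply a x\<bar> < e / 2"
      "\<forall>\<^sub>F v in nhds b. \<forall>x\<in>B. \<bar>dual_apply v x - dual_apply b x\<bar> < e / 2"
      using * eventually_dual_ball[of B "e / 2"] by simp_all
    from eventually_prodI[OF this]
    show "\<forall>\<^sub>F z in nhds a \<times>\<^sub>F nhds b.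
      \<forall>x\<in>B. \<bar>dual_apply (fst z + snd z) x - dual_apply (a + b) x\<bar> < e"
      by eventually_elim (unfold dual_apply_rep, blast intro: abs_half_triangle(2))
  qed
next
  fix a :: "'a dual"
  show "(uminus \<longlongrightarrow> - a) (nhds a)"
    unfolding tendsto_dual_iff
  proof safe
    fix B :: "'a set" and e :: real assume *: "vn_bounded B" "0 < e"
    from eventually_dual_ball[OF this, of a]
    show "\<forall>\<^sub>F z in nhds a. \<forall>x\<in>B. \<bar>dual_apply (- z) x - dual_apply (- a) x\<bar> < e"
      by eventually_elim (fastforce simp: dual_apply_rep)
  qed
next
  let ?U = "uniformity :: ('a dual \<times> 'a dual) filter"
  show "filterlim (\<lambda>((a::'a dual, b), (c, d)). (a + c, b + d)) ?U (?U \<times>\<^sub>F ?U)"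
    unfolding filterlim_uniformity_dual_iff
  proof safe
    fix B :: "'a set" and e :: real assume *: "vn_bounded B" "0 < e"
    have "\<forall>\<^sub>F (u, v) in ?U. \<forall>x\<in>B. \<bar>dual_apply u x - dual_apply v x\<bar> < e / 2"
      using * eventually_nhds_dual_aux[of B "e / 2"] by simp
    from eventually_prodI[OF this this]
    show "\<forall>\<^sub>F z in ?U \<times>\<^sub>F ?U. \<forall>x\<in>B.
      \<bar>dual_apply (fst (case z of (p, q) \<Rightarrow> (case p of (a, b) \<Rightarrow> \<lambda>(c, d). (a + c, b + d)) q)) x -
       dual_apply (snd (case z of (p, q) \<Rightarrow> (case p of (a, b) \<Rightarrow> \<lambda>(c, d). (a + c, b + d)) q)) x\<bar> < e"
      by eventually_elim
        (unfold case_prod_unfold fst_conv snd_conv dual_apply_rep, blast intro: abs_half_triangle(2))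
  qed
next
  let ?U = "uniformity :: ('a dual \<times> 'a dual) filter"
  show "filterlim (\<lambda>(a::'a dual, b). (- a, - b)) ?U ?U"
    unfolding filterlim_uniformity_dual_iff
  proof safe
    fix B :: "'a set" and e :: real assume *: "vn_bounded B" "0 < e"
    from eventually_nhds_dual_aux[OF *]
    show "\<forall>\<^sub>F z in ?U. \<forall>x\<in>B. \<bar>dual_apply (fst (case z of (a, b) \<Rightarrow> (- a, - b))) x -
       dual_apply (snd (case z of (a, b) \<Rightarrow> (- a, - b))) x\<bar> < e"
      by eventually_elim (fastforce simp: dual_apply_rep case_prod_unfold)
  qed
qed

instance dual :: (locally_convex_space) locally_convex_space
proof
  fix u v :: "'a dual" assume "u \<noteq> v"
  then obtain x where x: "dual_apply u x \<noteq> dual_apply v x"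
    by (metis dual_apply_inject ext)
  let ?e = "\<bar>dual_apply u x - dual_apply v x\<bar> / 2"
  have e: "?e > 0" using x by simp
  from eventually_dual_ball[OF vn_bounded_singleton e, of x u]
  obtain U where U: "open U" "u \<in> U" "\<forall>w\<in>U. \<bar>dual_apply w x - dual_apply u x\<bar> < ?e"
    unfolding eventually_nhds by auto
  from eventually_dual_ball[OF vn_bounded_singleton e, of x v]
  obtain V where V: "open V" "v \<in> V" "\<forall>w\<in>V. \<bar>dual_apply w x - dual_apply v x\<bar> < ?e"
    unfolding eventually_nhds by auto
  have "U \<inter> V = {}"
  proof (rule ccontr)
    assume "U \<inter> V \<noteq> {}"
    then obtain w where "w \<in> U" "w \<in> V" by blast
    with U(3) V(3) have "\<bar>dual_apply w x - dual_apply u x\<bar> < ?e" "\<bar>dual_apply w x - dual_apply v x\<bar> < ?e"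
      by auto
    then show False by (smt (verit) field_sum_of_halves)
  qed
  with U V show "\<exists>U V. open U \<and> open V \<and> u \<in> U \<and> v \<in> V \<and> U \<inter> V = {}" by blast
next
  fix c :: real and u :: "'a dual"
  show "filterlim (\<lambda>(c, x). c *\<^sub>R x) (nhds (c *\<^sub>R u)) (nhds c \<times>\<^sub>F nhds u)"
    unfolding tendsto_dual_iff
  proof safe
    fix B :: "'a set" and e :: real assume *: "vn_bounded B" "0 < e"
    from dual_apply_bounded[OF *(1), of u]
    obtain M where M: "M > 0" "\<And>x. x \<in> B \<Longrightarrow> \<bar>dual_apply u x\<bar> < M" by blast
    let ?d = "e / (2 * (\<bar>c\<bar> + 1))" and ?d' = "min 1 (e / (2 * M))"
    have d: "?d > 0" "?d' > 0" using * M by auto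
    have "\<forall>\<^sub>F t in nhds c. dist t c < ?d'"
      using d(2) eventually_nhds_metric by blast
    from eventually_prodI[OF this eventually_dual_ball[OF *(1) d(1), of u]]
    show "\<forall>\<^sub>F z in nhds c \<times>\<^sub>F nhds u. \<forall>x\<in>B.
      \<bar>dual_apply (case z of (c, x) \<Rightarrow> c *\<^sub>R x) x - dual_apply (c *\<^sub>R u) x\<bar> < e"
    proof eventually_elim
      case (elim z)
      obtain t w where z: "z = (t, w)" by (cases z)
      have t: "\<bar>t - c\<bar> < 1" "\<bar>t - c\<bar> < e / (2 * M)" "\<bar>t\<bar> < \<bar>c\<bar> + 1"
        using elim z by (auto simp: dist_real_def)
      show ?case
      proof
        fix x assume x: "x \<in> B"
        have 1: "\<bar>dual_apply w x - dual_apply u x\<bar> < ?d" using elim x z by auto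
        have "\<bar>t\<bar> * \<bar>dual_apply w x - dual_apply u x\<bar> \<le> (\<bar>c\<bar> + 1) * ?d"
          using 1 t by (intro mult_mono) auto
        also have "\<dots> = e / 2" by (simp add: field_simps)
        finally have 2: "\<bar>t * (dual_apply w x - dual_apply u x)\<bar> \<le> e / 2" by (simp add: abs_mult)
        have "\<bar>t - c\<bar> * \<bar>dual_apply u x\<bar> \<le> \<bar>t - c\<bar> * M"
          using M(2)[OF x] by (intro mult_left_mono) auto
        also have "\<dots> < e / 2" using t(2) M(1) by (simp add: field_simps)
        finally have 3: "\<bar>(t - c) * dual_apply u x\<bar> < e / 2" by (simp add: abs_mult)
        have "t * dual_apply w x - c * dual_apply u x
          = t * (dual_apply w x - dual_apply u x) + (t - c) * dual_apply u x"
          by (simp add: algebra_simps)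
        with 2 3 show "\<bar>dual_apply (case z of (c, x) \<Rightarrow> c *\<^sub>R x) x - dual_apply (c *\<^sub>R u) x\<bar> < e"
          by (simp add: z dual_apply_rep)
      qed
    qed
  qed
next
  fix U :: "'a dual set" assume "open U" "0 \<in> U"
  then have "\<forall>\<^sub>F v in nhds 0. v \<in> U" by (rule eventually_nhds_in_open)
  then obtain B e where Be: "vn_bounded B" "0 < e"
    "\<And>v. (\<forall>x\<in>B. \<bar>dual_apply v x\<bar> < e) \<Longrightarrow> v \<in> U"
    unfolding eventually_nhds_uniformity eventually_uniformity_dual
    by (auto simp: dual_apply_rep)
  define W where "W = {v. \<exists>d<e. \<forall>x\<in>B. \<bar>dual_apply v x\<bar> \<le> d}"
  have "open W"
    unfolding open_dual_def eventually_uniformity_dual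
  proof
    fix v assume "v \<in> W"
    then obtain d where d: "d < e" "\<forall>x\<in>B. \<bar>dual_apply v x\<bar> \<le> d" by (auto simp: W_def)
    have "w \<in> W" if "\<forall>x\<in>B. \<bar>dual_apply v x - dual_apply w x\<bar> < (e - d) / 2" for w
      unfolding W_def
    proof (intro CollectI exI conjI ballI)
      show "(e + d) / 2 < e" using d by simp
      fix x assume "x \<in> B"
      with that d(2) have "\<bar>dual_apply v x - dual_apply w x\<bar> < (e - d) / 2" "\<bar>dual_apply v x\<bar> \<le> d"
        by auto
      then have "\<bar>dual_apply w x\<bar> \<le> d + (e - d) / 2" by linarith
      then show "\<bar>dual_apply w x\<bar> \<le> (e + d) / 2" by (simp add: field_simps)
    qed
    then show "\<exists>B e. vn_bounded B \<and> 0 < e \<and> (\<forall>u w. (\<forall>x\<in>B. \<bar>dual_apply u x - dual_apply w x\<bar> < e)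
        \<longrightarrow> (case (u, w) of (u', w) \<Rightarrow> u' = v \<longrightarrow> w \<in> W))"
      using Be d by (intro exI[of _ B] exI[of _ "(e - d) / 2"]) auto
  qed
  moreover have "0 \<in> W" using Be by (auto simp: W_def dual_apply_rep intro: exI[of _ 0])
  moreover have "W \<subseteq> U" by (fastforce simp: W_def intro: Be(3))
  moreover have "s *\<^sub>R v + t *\<^sub>R w \<in> W"
    if vw: "v \<in> W" "w \<in> W" and st: "s \<ge> 0" "t \<ge> 0" "s + t = 1" for v w s t
  proof -
    from vw obtain d d' where d: "d < e" "\<forall>x\<in>B. \<bar>dual_apply v x\<bar> \<le> d"
      "d' < e" "\<forall>x\<in>B. \<bar>dual_apply w x\<bar> \<le> d'" by (auto simp: W_def)
    have "\<bar>dual_apply (s *\<^sub>R v + t *\<^sub>R w) x\<bar> \<le> max d d'" if "x \<in> B" for x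
    proof -
      have "\<bar>dual_apply (s *\<^sub>R v + t *\<^sub>R w) x\<bar> \<le> s * \<bar>dual_apply v x\<bar> + t * \<bar>dual_apply w x\<bar>"
        using st by (simp add: dual_apply_rep abs_mult order_trans[OF abs_triangle_ineq])
      also have "\<dots> \<le> s * max d d' + t * max d d'"
        using st d that by (intro add_mono mult_left_mono) (auto simp: le_max_iff_disj)
      also have "\<dots> = max d d'" using st(3) by (simp flip: distrib_right)
      finally show ?thesis .
    qed
    then show ?thesis using d unfolding W_def by (intro CollectI exI[of _ "max d d'"]) auto
  qed
  ultimately show "\<exists>W. open W \<and> 0 \<in> W \<and> W \<subseteq> U \<and>
      (\<forall>x\<in>W. \<forall>y\<in>W. \<forall>s\<ge>0. \<forall>t\<ge>0. s + t = 1 \<longrightarrow> s *\<^sub>R x + t *\<^sub>R y \<in> W)"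
    by blast
qed

text \<open>Nuclearity: for every continuous seminorm q there is a continuous seminorm r dominating it
  such that the canonical map from the local Banach space of r to that of q is a nuclear operator.
  The vectors y of the nuclear representation are taken in the space itself rather than in the
  completion; this is no restriction, since every element of the completion is the sum of an
  absolutely convergent series of elements of the space.\<close>

definition continuous_seminorm :: "('a::locally_convex_space \<Rightarrow> real) \<Rightarrow> bool" where
  "continuous_seminorm q \<longleftrightarrow> continuous_on UNIV q \<and>
    (\<forall>x y. q (x + y) \<le> q x + q y) \<and> (\<forall>c x. q (c *\<^sub>R x) = \<bar>c\<bar> * q x)"

definition nuclear_space :: "'a::locally_convex_space itself \<Rightarrow> bool" where
  "nuclear_space _ \<longleftrightarrow>
    (\<forall>q :: 'a \<Rightarrow> real. continuous_seminorm q \<longrightarrow>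
      (\<exists>r (l :: nat \<Rightarrow> real) (w :: nat \<Rightarrow> 'a \<Rightarrow> real) (y :: nat \<Rightarrow> 'a).
        continuous_seminorm r \<and> (\<forall>x. q x \<le> r x) \<and> summable (\<lambda>k. \<bar>l k\<bar>) \<and>
        (\<forall>k. linear (w k) \<and> (\<forall>x. \<bar>w k x\<bar> \<le> r x)) \<and> (\<forall>k. q (y k) \<le> 1) \<and>
        (\<forall>x. (\<lambda>n. q (x - (\<Sum>k<n. (l k * w k x) *\<^sub>R y k))) \<longlonglongrightarrow> 0)))"

definition reflexive_space :: "'a::locally_convex_space itself \<Rightarrow> bool" where
  "reflexive_space _ \<longleftrightarrow>
    (\<exists>g. homeomorphism (UNIV :: 'a set) (UNIV :: 'a dual dual set)
       (\<lambda>x. Dual (\<lambda>u. dual_apply u x)) g)"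

definition nuclear_dual_pair :: "('s::locally_convex_space \<Rightarrow> 's dual) \<Rightarrow> bool" where
  "nuclear_dual_pair j \<longleftrightarrow>
    nuclear_space TYPE('s) \<and> complete (UNIV :: 's set) \<and> reflexive_space TYPE('s) \<and>
    nuclear_space TYPE('s dual) \<and> complete (UNIV :: 's dual set) \<and>
    linear j \<and> inj j \<and> continuous_on UNIV j \<and> closure (range j) = UNIV"

section \<open>Inner product and Hilbert spaces on subspaces of a vector space\<close>

text \<open>Several inner products are considered on one vector space, so they are explicit
  functions, relevant only on the carrier \<open>V\<close>.\<close>

definition linear_on :: "'v::real_vector set \<Rightarrow> ('v \<Rightarrow> 'w::real_vector) \<Rightarrow> bool" where
  "linear_on V f \<longleftrightarrow> (\<forall>x\<in>V. \<forall>y\<in>V. f (x + y) = f x + f y) \<and> (\<forall>c. \<forall>x\<in>V. f (c *\<^sub>R x) = c *\<^sub>R f x)"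

definition inner_product_on :: "'v::real_vector set \<Rightarrow> ('v \<Rightarrow> 'v \<Rightarrow> real) \<Rightarrow> bool" where
  "inner_product_on V ip \<longleftrightarrow> subspace V \<and>
    (\<forall>x\<in>V. \<forall>y\<in>V. ip x y = ip y x) \<and> (\<forall>y\<in>V. linear_on V (\<lambda>x. ip x y)) \<and>
    (\<forall>x\<in>V. x \<noteq> 0 \<longrightarrow> ip x x > 0)"

definition ip_norm :: "('v \<Rightarrow> 'v \<Rightarrow> real) \<Rightarrow> 'v \<Rightarrow> real" where
  "ip_norm ip x = sqrt (ip x x)"

definition ip_dist :: "'v::real_vector set \<Rightarrow> ('v \<Rightarrow> 'v \<Rightarrow> real) \<Rightarrow> 'v \<Rightarrow> 'v \<Rightarrow> real" where
  "ip_dist V ip x y = (if x \<in> V \<and> y \<in> V then ip_norm ip (x - y) else 0)"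

definition ip_closure :: "'v::real_vector set \<Rightarrow> ('v \<Rightarrow> 'v \<Rightarrow> real) \<Rightarrow> 'v set \<Rightarrow> 'v set" where
  "ip_closure V ip = (closure_of) (Metric_space.mtopology V (ip_dist V ip))"

definition hilbert_space_on :: "'v::real_vector set \<Rightarrow> ('v \<Rightarrow> 'v \<Rightarrow> real) \<Rightarrow> bool" where
  "hilbert_space_on V ip \<longleftrightarrow>
    inner_product_on V ip \<and> Metric_space.mcomplete V (ip_dist V ip)"

definition hilbert_completion ::
  "'w::real_vector set \<Rightarrow> ('w \<Rightarrow> 'w \<Rightarrow> real) \<Rightarrow> ('w \<Rightarrow> 'v::real_vector) \<Rightarrow>
    'v set \<Rightarrow> ('v \<Rightarrow> 'v \<Rightarrow> real) \<Rightarrow> bool" where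
  "hilbert_completion W b \<iota> V ip \<longleftrightarrow>
    hilbert_space_on V ip \<and> linear_on W \<iota> \<and> \<iota> ` W \<subseteq> V \<and>
    (\<forall>f\<in>W. \<forall>g\<in>W. ip (\<iota> f) (\<iota> g) = b f g) \<and> ip_closure V ip (\<iota> ` W) = V"

definition orthogonal_sum ::
  "'v::real_vector set \<Rightarrow> ('v \<Rightarrow> 'v \<Rightarrow> real) \<Rightarrow> 'v set \<Rightarrow> 'v set \<Rightarrow> bool" where
  "orthogonal_sum V ip U W \<longleftrightarrow> subspace U \<and> subspace W \<and>
    V = {u + w |u w. u \<in> U \<and> w \<in> W} \<and> U \<inter> W = {0} \<and> (\<forall>u\<in>U. \<forall>w\<in>W. ip u w = 0)"

definition bounded_functional_on ::
  "'v::real_vector set \<Rightarrow> ('v \<Rightarrow> 'v \<Rightarrow> real) \<Rightarrow> ('v \<Rightarrow> real) \<Rightarrow> bool" where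
  "bounded_functional_on V ip l \<longleftrightarrow>
    linear_on V l \<and> (\<exists>C. \<forall>x\<in>V. \<bar>l x\<bar> \<le> C * ip_norm ip x)"

text \<open>The Hilbert space \<open>(U, ipU)\<close> is the continuous dual of \<open>(V, ipV)\<close>, with the dual norm, under
  the duality product \<open>pr\<close>.\<close>

definition is_dual_of ::
  "'u::real_vector set \<Rightarrow> ('u \<Rightarrow> 'u \<Rightarrow> real) \<Rightarrow> 'v::real_vector set \<Rightarrow> ('v \<Rightarrow> 'v \<Rightarrow> real) \<Rightarrow>
    ('u \<Rightarrow> 'v \<Rightarrow> real) \<Rightarrow> bool" where
  "is_dual_of U ipU V ipV pr \<longleftrightarrow>
    hilbert_space_on U ipU \<and> hilbert_space_on V ipV \<and>
    (\<forall>x\<in>V. linear_on U (\<lambda>u. pr u x)) \<and>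
    (\<forall>u\<in>U. bounded_functional_on V ipV (pr u)) \<and>
    (\<forall>l. bounded_functional_on V ipV l \<longrightarrow> (\<exists>!u. u \<in> U \<and> (\<forall>x\<in>V. pr u x = l x))) \<and>
    (\<forall>u\<in>U. ip_norm ipU u = (SUP x\<in>{x\<in>V. ip_norm ipV x \<le> 1}. \<bar>pr u x\<bar>))"

definition is_riesz_map ::
  "'v::real_vector set \<Rightarrow> ('v \<Rightarrow> 'v \<Rightarrow> real) \<Rightarrow> 'u::real_vector set \<Rightarrow> ('u \<Rightarrow> 'u \<Rightarrow> real) \<Rightarrow>
    ('u \<Rightarrow> 'v \<Rightarrow> real) \<Rightarrow> ('v \<Rightarrow> 'u) \<Rightarrow> bool" where
  "is_riesz_map V ipV U ipU pr J \<longleftrightarrow>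
    linear_on V J \<and> bij_betw J V U \<and> (\<forall>f\<in>V. ip_norm ipU (J f) = ip_norm ipV f) \<and>
    (\<forall>f\<in>V. \<forall>g\<in>V. pr (J f) g = ipV f g)"

section \<open>The corrected operator and the native space\<close>

definition annihilated :: "(nat \<Rightarrow> 's::locally_convex_space dual) \<Rightarrow> nat \<Rightarrow> 's set" where
  "annihilated p N = {f. \<forall>n\<in>{1..N}. dual_apply (p n) f = 0}"

definition symmetric_operator :: "('s::locally_convex_space \<Rightarrow> 's dual) \<Rightarrow> bool" where
  "symmetric_operator A \<longleftrightarrow> (\<forall>f g. dual_apply (A f) g = dual_apply (A g) f)"

definition conditionally_pos_def ::
  "(nat \<Rightarrow> 's::locally_convex_space dual) \<Rightarrow> nat \<Rightarrow> ('s \<Rightarrow> 's dual) \<Rightarrow> bool" where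
  "conditionally_pos_def p N A \<longleftrightarrow> (\<forall>f \<in> annihilated p N - {0}. dual_apply (A f) f > 0)"

text \<open>In the next three definitions the duality product \<open>pr\<close> is either \<^const>\<open>dual_apply\<close> or
  its extension by continuity, defined further below.\<close>

definition biorthogonal :: "('u \<Rightarrow> 'v \<Rightarrow> real) \<Rightarrow> nat \<Rightarrow> (nat \<Rightarrow> 'u) \<Rightarrow> (nat \<Rightarrow> 'v) \<Rightarrow> bool" where
  "biorthogonal pr N p \<phi> \<longleftrightarrow>
    (\<forall>n\<in>{1..N}. \<forall>m\<in>{1..N}. pr (p n) (\<phi> m) = (if m = n then 1 else 0))"

definition R_p :: "('u \<Rightarrow> 'v \<Rightarrow> real) \<Rightarrow> nat \<Rightarrow> (nat \<Rightarrow> 'u::real_vector) \<Rightarrow> 'v \<Rightarrow> 'u" where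
  "R_p pr N p f = (\<Sum>n\<in>{1..N}. pr (p n) f *\<^sub>R p n)"

definition R_phi :: "('u \<Rightarrow> 'v \<Rightarrow> real) \<Rightarrow> nat \<Rightarrow> (nat \<Rightarrow> 'v::real_vector) \<Rightarrow> 'u \<Rightarrow> 'v" where
  "R_phi pr N \<phi> u = (\<Sum>n\<in>{1..N}. pr u (\<phi> n) *\<^sub>R \<phi> n)"

definition corrected ::
  "('s::locally_convex_space \<Rightarrow> 's dual) \<Rightarrow> nat \<Rightarrow> (nat \<Rightarrow> 's dual) \<Rightarrow> (nat \<Rightarrow> 's) \<Rightarrow> 's \<Rightarrow> 's dual" where
  "corrected A N p \<phi> =
    (\<lambda>u. u - R_p dual_apply N p (R_phi dual_apply N \<phi> u)) \<circ> A \<circ>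
    (\<lambda>f. f - R_phi dual_apply N \<phi> (R_p dual_apply N p f))"

definition corrected_form ::
  "('s::locally_convex_space \<Rightarrow> 's dual) \<Rightarrow> nat \<Rightarrow> (nat \<Rightarrow> 's dual) \<Rightarrow> (nat \<Rightarrow> 's) \<Rightarrow> 's \<Rightarrow> 's \<Rightarrow> real" where
  "corrected_form A N p \<phi> f g =
    dual_apply (corrected A N p \<phi> f + R_p dual_apply N p f) g"

text \<open>Extensions by continuity.  Here \<open>\<iota>\<close> embeds the test functions densely into a Hilbert
  space with inner product \<open>ip\<close>.  The pairing of \<open>u\<close> with \<open>x\<close> is the limit of the pairings of
  \<open>u\<close> with test functions \<open>f\<close> as \<open>\<iota> f\<close> tends to \<open>x\<close>.  For a system \<open>\<phi>\<close> in the Hilbert space,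
  the corrected operator at \<open>x\<close> is the limit of the corrected operators of the universal
  systems \<open>\<psi>\<close> at \<open>f\<close>, as \<open>\<iota> \<circ> \<psi>\<close> tends to \<open>\<phi>\<close> and \<open>\<iota> f\<close> tends to \<open>x\<close>.\<close>

definition approximating ::
  "('s \<Rightarrow> 'h::real_vector) \<Rightarrow> ('h \<Rightarrow> 'h \<Rightarrow> real) \<Rightarrow> 'h \<Rightarrow> 's filter" where
  "approximating \<iota> ip x = filtercomap (\<lambda>f. ip_norm ip (\<iota> f - x)) (nhds 0)"

definition approximating_systems ::
  "('s::locally_convex_space \<Rightarrow> 'h::real_vector) \<Rightarrow> ('h \<Rightarrow> 'h \<Rightarrow> real) \<Rightarrow> nat \<Rightarrow> (nat \<Rightarrow> 's dual) \<Rightarrow>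
    (nat \<Rightarrow> 'h) \<Rightarrow> (nat \<Rightarrow> 's) filter" where
  "approximating_systems \<iota> ip N p \<phi> =
    inf (principal {\<psi>. biorthogonal dual_apply N p \<psi>})
      (INF n\<in>{1..N}. filtercomap (\<lambda>\<psi>. \<psi> n) (approximating \<iota> ip (\<phi> n)))"

definition ext_pairing ::
  "('s::locally_convex_space \<Rightarrow> 'h::real_vector) \<Rightarrow> ('h \<Rightarrow> 'h \<Rightarrow> real) \<Rightarrow> 's dual \<Rightarrow> 'h \<Rightarrow> real" where
  "ext_pairing \<iota> ip u x = Lim (approximating \<iota> ip x) (dual_apply u)"

definition ext_corrected ::
  "('s::locally_convex_space \<Rightarrow> 'h::real_vector) \<Rightarrow> ('h \<Rightarrow> 'h \<Rightarrow> real) \<Rightarrow>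
    ('s \<Rightarrow> 's dual) \<Rightarrow> nat \<Rightarrow> (nat \<Rightarrow> 's dual) \<Rightarrow> (nat \<Rightarrow> 'h) \<Rightarrow> 'h \<Rightarrow> 's dual" where
  "ext_corrected \<iota> ip A N p \<phi> x =
    Dual (\<lambda>g. Lim (approximating_systems \<iota> ip N p \<phi> \<times>\<^sub>F approximating \<iota> ip x)
      (\<lambda>(\<psi>, f). dual_apply (corrected A N p \<psi> f) g))"

text \<open>The elements of the dual that are continuous for the Hilbert norm.  The Hilbert space itself
  is an abstract completion: for a general operator it need not embed into the dual, whereas its
  predual always does.\<close>

definition norm_continuous_dual ::
  "('s::locally_convex_space \<Rightarrow> 'h::real_vector) \<Rightarrow> ('h \<Rightarrow> 'h \<Rightarrow> real) \<Rightarrow> 's dual set" where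
  "norm_continuous_dual \<iota> ip = {u. \<exists>C. \<forall>f. \<bar>dual_apply u f\<bar> \<le> C * ip_norm ip (\<iota> f)}"

end

theory Submission
  imports Defs
begin

text \<open>
For a universal system \<open>\<eta>\<close> let \<open>P f = f - (\<Sum>n. \<langle>p n, f\<rangle> \<eta> n)\<close> be the projection of \<open>\<S>\<close> onto the functions
annihilated by \<open>p\<close>, along the span of \<open>\<eta>\<close>.  It is \<open>Id - R\<^sub>\<phi> R\<^sub>p\<close>, and \<open>Id - R\<^sub>p R\<^sub>\<phi>\<close> is its transpose, so the
corrected operator satisfies \<open>\<langle>A\<^sub>\<eta> f, g\<rangle> = \<langle>A (P f), P g\<rangle>\<close>.  Hence the corrected
form \<open>\<langle>(A\<^sub>\<eta> + R\<^sub>p) f, g\<rangle>\<close> is an inner product: by conditional positivity \<open>A\<close> is positive on the range of \<open>P\<close>, and the rank part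
\<open>\<Sum>n. \<langle>p n, f\<rangle> \<langle>p n, g\<rangle>\<close> is positive on the span of \<open>\<eta>\<close>.  Moreover the forms of all systems coincide on
the annihilated functions; hence \<open>\<langle>A\<^sub>\<eta> f, g\<rangle>\<close> is the form of any other system \<open>\<psi>\<close> at
\<open>P f\<close> and \<open>P g\<close> (\<open>dual_apply_corrected_eq_form\<close>), and one completion serves every system.

Topology enters at one point: the norm of the form is continuous on \<open>\<S>\<close>.  A continuous operator into
the strong dual is bounded on bounded sets, so the functionals \<open>\<langle>f, \<cdot>\<rangle>\<close> with \<open>f\<close> in the unit ball form a
bounded subset of \<open>\<S>'\<close>, and in a reflexive space such a set is equicontinuous
(\<open>form_continuous_if_bounded_on_bounded\<close>).  Consequently every functional that is bounded in norm lies in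
\<open>\<S>'\<close>.  These functionals are the predual \<open>H\<close>, and they also provide a completion of \<open>\<S>\<close> inside \<open>\<S>'\<close>
(\<open>completion_in_dual\<close>).

In a completion, the identity above survives the passage to the limit in both the test function and the
system, and \<open>\<langle>A\<^sub>\<phi> x, y\<rangle>\<close> becomes \<open>\<langle>P x, P y\<rangle>\<close> with \<open>P\<close> the projection along \<open>\<phi>\<close> (\<open>corrected_limit\<close>).  So
the new inner product is \<open>\<langle>P x, P y\<rangle> + (\<Sum>n. \<langle>p n, x\<rangle> \<langle>p n, y\<rangle>)\<close>: it has an equivalent norm, it splits
the space orthogonally into the kernel of \<open>p\<close> and the span of \<open>\<phi>\<close>, and it makes \<open>\<phi>\<close> orthonormal (locale
\<open>biorthogonal_splitting\<close>).

Finally let \<open>K\<close> represent the functionals in \<open>H\<close> by vectors, with respect to the new inner product.  Its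
inverse is \<open>A\<^sub>\<phi> + R\<^sub>p\<close>, it maps \<open>p n\<close> to \<open>\<phi> n\<close>, and on the functionals vanishing at \<open>\<phi>\<close> it inverts the
restriction of \<open>A\<^sub>\<phi>\<close> to the kernel of \<open>p\<close>.  With \<open>A\<inverse> = P \<circ> K\<close> one
has \<open>R\<^sub>\<phi> = (Id - P) \<circ> K\<close>, so that \<open>A\<inverse> + R\<^sub>\<phi> = K\<close> and the inner product of \<open>H\<close> is the one transported by
\<open>K\<close>.  All statements on duals and Riesz maps then follow from one fact on transported inner products
(locale \<open>riesz_pair\<close>), applied to the whole space and to the two summands.
\<close>

section \<open>Inner products on a subspace\<close>

locale ip_space =
  fixes V :: "'v::real_vector set" and ip :: "'v \<Rightarrow> 'v \<Rightarrow> real"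
  assumes inner_product: "inner_product_on V ip"
begin

abbreviation nrm :: "'v \<Rightarrow> real" where "nrm \<equiv> ip_norm ip"

lemma subspace: "subspace V"
  using inner_product by (auto simp: inner_product_on_def)

lemma in_V [simp]:
  "0 \<in> V" "x \<in> V \<Longrightarrow> y \<in> V \<Longrightarrow> x + y \<in> V" "x \<in> V \<Longrightarrow> y \<in> V \<Longrightarrow> x - y \<in> V"
  "x \<in> V \<Longrightarrow> c *\<^sub>R x \<in> V" "x \<in> V \<Longrightarrow> - x \<in> V"
  using subspace by (auto simp: subspace_0 subspace_add subspace_diff subspace_scale subspace_neg)

lemma sum_in_V [simp]: "(\<And>i. i \<in> I \<Longrightarrow> f i \<in> V) \<Longrightarrow> (\<Sum>i\<in>I. f i) \<in> V"
  using subspace by (rule subspace_sum)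

lemma ip_commute: "x \<in> V \<Longrightarrow> y \<in> V \<Longrightarrow> ip x y = ip y x"
  using inner_product by (auto simp: inner_product_on_def)

lemma ip_linear_left:
  "x \<in> V \<Longrightarrow> y \<in> V \<Longrightarrow> z \<in> V \<Longrightarrow> ip (x + y) z = ip x z + ip y z"
  "x \<in> V \<Longrightarrow> z \<in> V \<Longrightarrow> ip (c *\<^sub>R x) z = c * ip x z"
  using inner_product by (auto simp: inner_product_on_def linear_on_def)

lemma ip_linear_right:
  "x \<in> V \<Longrightarrow> y \<in> V \<Longrightarrow> z \<in> V \<Longrightarrow> ip z (x + y) = ip z x + ip z y"
  "x \<in> V \<Longrightarrow> z \<in> V \<Longrightarrow> ip z (c *\<^sub>R x) = c * ip z x"
  by (simp_all add: ip_commute[of z] ip_linear_left)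

lemma ip_zero [simp]: "x \<in> V \<Longrightarrow> ip 0 x = 0" "x \<in> V \<Longrightarrow> ip x 0 = 0"
  using ip_linear_left(2)[of 0 x 0] ip_linear_right(2)[of 0 x 0] by auto

lemma ip_diff:
  assumes "x \<in> V" "y \<in> V" "z \<in> V"
  shows "ip (x - y) z = ip x z - ip y z" "ip z (x - y) = ip z x - ip z y"
  using assms ip_linear_left(1)[of "x - y" y z] ip_linear_right(1)[of "x - y" y z] by auto

lemmas ip_simps = ip_linear_left ip_linear_right ip_diff

lemma ip_self_pos: "x \<in> V \<Longrightarrow> x \<noteq> 0 \<Longrightarrow> 0 < ip x x"
  using inner_product by (simp add: inner_product_on_def)

lemma ip_self_nonneg: "x \<in> V \<Longrightarrow> 0 \<le> ip x x"
  using ip_self_pos by (cases "x = 0") (auto simp: less_imp_le)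

lemma ip_self_eq_0 [simp]: "x \<in> V \<Longrightarrow> ip x x = 0 \<longleftrightarrow> x = 0"
  using ip_self_pos by fastforce

lemma nrm_nonneg [simp]: "x \<in> V \<Longrightarrow> 0 \<le> nrm x"
  by (simp add: ip_norm_def ip_self_nonneg)

lemma nrm_power2: "x \<in> V \<Longrightarrow> (nrm x)\<^sup>2 = ip x x"
  by (simp add: ip_norm_def ip_self_nonneg)

lemma nrm_eq_0 [simp]: "x \<in> V \<Longrightarrow> nrm x = 0 \<longleftrightarrow> x = 0"
  by (simp add: ip_norm_def)

lemma nrm_zero [simp]: "nrm 0 = 0"
  by simp

lemma nrm_scaleR:
  assumes "x \<in> V"
  shows "nrm (c *\<^sub>R x) = \<bar>c\<bar> * nrm x"
proof -
  have "ip (c *\<^sub>R x) (c *\<^sub>R x) = c\<^sup>2 * ip x x"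
    using assms by (simp add: ip_linear_left(2) ip_linear_right(2) power2_eq_square)
  then show ?thesis by (simp add: ip_norm_def real_sqrt_mult)
qed

lemma nrm_minus: "x \<in> V \<Longrightarrow> nrm (- x) = nrm x"
  using nrm_scaleR[of x "-1"] by simp

lemma nrm_minus_commute: "x \<in> V \<Longrightarrow> y \<in> V \<Longrightarrow> nrm (x - y) = nrm (y - x)"
  using nrm_minus[of "x - y"] by simp

lemma cauchy_schwarz:
  assumes "x \<in> V" "y \<in> V"
  shows "\<bar>ip x y\<bar> \<le> nrm x * nrm y"
proof (cases "y = 0")
  case False
  then have pos: "ip y y > 0"
    using assms ip_self_nonneg[of y] ip_self_eq_0[of y] by linarith
  define t where "t = ip x y / ip y y"
  have "0 \<le> ip (x - t *\<^sub>R y) (x - t *\<^sub>R y)"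
    using assms by (simp add: ip_self_nonneg)
  also have "\<dots> = ip x x - 2 * t * ip x y + t * t * ip y y"
    using assms by (simp add: ip_simps ip_commute[of y x] algebra_simps)
  also have "\<dots> = ip x x - (ip x y)\<^sup>2 / ip y y"
    using pos by (simp add: t_def power2_eq_square)
  finally have "(ip x y)\<^sup>2 \<le> ip x x * ip y y"
    using pos by (simp add: field_simps)
  also have "\<dots> = (nrm x * nrm y)\<^sup>2"
    using assms by (simp add: nrm_power2 power_mult_distrib)
  finally have "\<bar>ip x y\<bar> \<le> \<bar>nrm x * nrm y\<bar>"
    by (simp only: abs_le_square_iff)
  then show ?thesis
    using assms by (simp add: abs_mult)
qed (use assms in simp)

lemma nrm_triangle:
  assumes "x \<in> V" "y \<in> V"
  shows "nrm (x + y) \<le> nrm x + nrm y"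
proof (rule power2_le_imp_le)
  have "(nrm (x + y))\<^sup>2 = (nrm x)\<^sup>2 + 2 * ip x y + (nrm y)\<^sup>2"
    using assms by (simp add: nrm_power2 ip_simps ip_commute[of y x])
  also have "\<dots> \<le> (nrm x + nrm y)\<^sup>2"
    using cauchy_schwarz[OF assms] by (simp add: power2_sum)
  finally show "(nrm (x + y))\<^sup>2 \<le> (nrm x + nrm y)\<^sup>2" .
qed (use assms in simp)

lemma nrm_triangle_diff:
  assumes "x \<in> V" "y \<in> V" "z \<in> V"
  shows "nrm (x - z) \<le> nrm (x - y) + nrm (y - z)"
  using nrm_triangle[of "x - y" "y - z"] assms by simp

lemma nrm_diff_le: "x \<in> V \<Longrightarrow> y \<in> V \<Longrightarrow> nrm (x - y) \<le> nrm x + nrm y"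
  using nrm_triangle[of x "- y"] by (simp add: nrm_minus)

lemma nrm_sum_le:
  assumes "\<And>i. i \<in> I \<Longrightarrow> f i \<in> V"
  shows "nrm (\<Sum>i\<in>I. f i) \<le> (\<Sum>i\<in>I. nrm (f i))"
  using assms
proof (induction I rule: infinite_finite_induct)
  case (insert i I)
  then have "nrm (f i + sum f I) \<le> nrm (f i) + nrm (sum f I)"
    by (intro nrm_triangle) auto
  with insert show ?case by (simp add: order_trans[OF _ add_left_mono])
qed auto

lemma parallelogram:
  assumes "x \<in> V" "y \<in> V"
  shows "(nrm (x - y))\<^sup>2 = 2 * ip x x + 2 * ip y y - ip (x + y) (x + y)"
  using assms by (simp add: nrm_power2 ip_simps)

lemma inner_product_on_subset: "subspace W \<Longrightarrow> W \<subseteq> V \<Longrightarrow> inner_product_on W ip"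
  unfolding inner_product_on_def linear_on_def
  by (auto simp: subset_iff ip_linear_left ip_self_pos intro: ip_commute)

text \<open>Norm convergence along an arbitrary filter: the limits needed later run over pairs of a
  biorthogonal system and a test function.\<close>

definition converges :: "('i \<Rightarrow> 'v) \<Rightarrow> 'v \<Rightarrow> 'i filter \<Rightarrow> bool" where
  "converges X x F \<longleftrightarrow> (\<forall>i. X i \<in> V) \<and> x \<in> V \<and> ((\<lambda>i. nrm (X i - x)) \<longlongrightarrow> 0) F"

lemma converges_const [intro]: "x \<in> V \<Longrightarrow> converges (\<lambda>_. x) x F"
  by (simp add: converges_def)

lemma converges_add:
  assumes "converges X x F" "converges Y y F"
  shows "converges (\<lambda>i. X i + Y i) (x + y) F"
proof -
  have in_V: "X i \<in> V" "Y i \<in> V" "x \<in> V" "y \<in> V" for i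
    using assms by (auto simp: converges_def)
  have "((\<lambda>i. nrm (X i - x) + nrm (Y i - y)) \<longlongrightarrow> 0 + 0) F"
    using assms by (intro tendsto_add) (auto simp: converges_def)
  then have lim: "((\<lambda>i. nrm (X i - x) + nrm (Y i - y)) \<longlongrightarrow> 0) F" by simp
  have "norm (nrm (X i + Y i - (x + y))) \<le> nrm (X i - x) + nrm (Y i - y)" for i
    using nrm_triangle[of "X i - x" "Y i - y"] in_V by (simp add: add_diff_add)
  then have "((\<lambda>i. nrm (X i + Y i - (x + y))) \<longlongrightarrow> 0) F"
    by (rule Lim_null_comparison[OF always_eventually[OF allI] lim])
  with in_V show ?thesis by (simp add: converges_def)
qed

lemma converges_scaleR:
  assumes "(c \<longlongrightarrow> d) F" "converges X x F"
  shows "converges (\<lambda>i. c i *\<^sub>R X i) (d *\<^sub>R x) F"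
proof -
  have in_V: "X i \<in> V" "x \<in> V" for i
    using assms by (auto simp: converges_def)
  have "((\<lambda>i. \<bar>c i\<bar> * nrm (X i - x) + \<bar>c i - d\<bar> * nrm x) \<longlongrightarrow> \<bar>d\<bar> * 0 + \<bar>d - d\<bar> * nrm x) F"
    using assms by (intro tendsto_intros) (auto simp: converges_def)
  then have lim: "((\<lambda>i. \<bar>c i\<bar> * nrm (X i - x) + \<bar>c i - d\<bar> * nrm x) \<longlongrightarrow> 0) F" by simp
  have "nrm (c i *\<^sub>R X i - d *\<^sub>R x) \<le> \<bar>c i\<bar> * nrm (X i - x) + \<bar>c i - d\<bar> * nrm x" for i
    using nrm_triangle[of "c i *\<^sub>R (X i - x)" "(c i - d) *\<^sub>R x"] in_V
    by (simp add: nrm_scaleR) (simp add: algebra_simps)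
  then have "norm (nrm (c i *\<^sub>R X i - d *\<^sub>R x)) \<le> \<bar>c i\<bar> * nrm (X i - x) + \<bar>c i - d\<bar> * nrm x" for i
    using in_V by simp
  then have "((\<lambda>i. nrm (c i *\<^sub>R X i - d *\<^sub>R x)) \<longlongrightarrow> 0) F"
    by (rule Lim_null_comparison[OF always_eventually[OF allI] lim])
  with in_V show ?thesis by (simp add: converges_def)
qed

lemma converges_diff:
  "converges X x F \<Longrightarrow> converges Y y F \<Longrightarrow> converges (\<lambda>i. X i - Y i) (x - y) F"
  using converges_add[of X x F "\<lambda>i. (-1) *\<^sub>R Y i" "(-1) *\<^sub>R y"]
    converges_scaleR[OF tendsto_const, of Y y F "-1"] by simp

lemma converges_sum:
  "(\<And>n. n \<in> I \<Longrightarrow> converges (X n) (x n) F) \<Longrightarrow>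
    converges (\<lambda>i. \<Sum>n\<in>I. X n i) (\<Sum>n\<in>I. x n) F"
  by (induction I rule: infinite_finite_induct) (auto intro: converges_add)

lemma tendsto_nrm:
  assumes "converges X x F"
  shows "((\<lambda>i. nrm (X i)) \<longlongrightarrow> nrm x) F"
proof -
  have in_V: "X i \<in> V" "x \<in> V" for i
    using assms by (auto simp: converges_def)
  have "((\<lambda>i. nrm (X i) - nrm x) \<longlongrightarrow> 0) F"
  proof (rule Lim_null_comparison[OF always_eventually])
    have "\<bar>nrm (X i) - nrm x\<bar> \<le> nrm (X i - x)" for i
      using in_V nrm_triangle[of "X i - x" x] nrm_triangle[of "x - X i" "X i"]
        nrm_minus_commute[of x "X i"] by simp
    then show "\<forall>i. norm (nrm (X i) - nrm x) \<le> nrm (X i - x)" by simp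
  qed (use assms in \<open>simp add: converges_def\<close>)
  then show ?thesis by (simp add: LIM_zero_iff)
qed

lemma tendsto_ip:
  assumes "converges X x F" "converges Y y F"
  shows "((\<lambda>i. ip (X i) (Y i)) \<longlongrightarrow> ip x y) F"
proof -
  have in_V: "X i \<in> V" "Y i \<in> V" "x \<in> V" "y \<in> V" for i
    using assms by (auto simp: converges_def)
  have "((\<lambda>i. ip (X i) (Y i) - ip x y) \<longlongrightarrow> 0) F"
  proof (rule Lim_null_comparison[OF always_eventually])
    have "ip (X i) (Y i) - ip x y = ip (X i - x) (Y i) + ip x (Y i - y)" for i
      using in_V by (simp add: ip_simps)
    then have "\<bar>ip (X i) (Y i) - ip x y\<bar> \<le> nrm (X i - x) * nrm (Y i) + nrm x * nrm (Y i - y)" for i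
      using cauchy_schwarz[of "X i - x" "Y i"] cauchy_schwarz[of x "Y i - y"] in_V
      by (simp add: abs_le_iff)
    then show "\<forall>i. norm (ip (X i) (Y i) - ip x y)
        \<le> nrm (X i - x) * nrm (Y i) + nrm x * nrm (Y i - y)" by simp
    have "((\<lambda>i. nrm (X i - x) * nrm (Y i) + nrm x * nrm (Y i - y)) \<longlongrightarrow> 0 * nrm y + nrm x * 0) F"
      using assms tendsto_nrm[OF assms(2)] by (intro tendsto_intros) (auto simp: converges_def)
    then show "((\<lambda>i. nrm (X i - x) * nrm (Y i) + nrm x * nrm (Y i - y)) \<longlongrightarrow> 0) F" by simp
  qed
  then show ?thesis by (simp add: LIM_zero_iff)
qed

definition cauchy :: "(nat \<Rightarrow> 'v) \<Rightarrow> bool" where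
  "cauchy X \<longleftrightarrow> range X \<subseteq> V \<and> (\<forall>e>0. \<exists>M. \<forall>m\<ge>M. \<forall>n\<ge>M. nrm (X m - X n) < e)"

lemma cauchyD: "cauchy X \<Longrightarrow> 0 < e \<Longrightarrow> \<exists>M. \<forall>m\<ge>M. \<forall>n\<ge>M. nrm (X m - X n) < e"
  by (simp add: cauchy_def)

lemma cauchy_in_V: "cauchy X \<Longrightarrow> X n \<in> V"
  by (auto simp: cauchy_def)

lemma metric_space: "Metric_space V (ip_dist V ip)"
proof
  show "0 \<le> ip_dist V ip x y" for x y
    by (simp add: ip_dist_def)
  show "ip_dist V ip x y = ip_dist V ip y x" for x y
    by (simp add: ip_dist_def nrm_minus_commute)
  show "ip_dist V ip x y = 0 \<longleftrightarrow> x = y" if "x \<in> V" "y \<in> V" for x y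
    using that by (simp add: ip_dist_def)
  show "ip_dist V ip x z \<le> ip_dist V ip x y + ip_dist V ip y z"
    if "x \<in> V" "y \<in> V" "z \<in> V" for x y z
    using that nrm_triangle_diff by (simp add: ip_dist_def)
qed

lemma mcomplete_iff:
  "Metric_space.mcomplete V (ip_dist V ip) \<longleftrightarrow>
    (\<forall>X. cauchy X \<longrightarrow> (\<exists>x. converges X x sequentially))"
proof -
  interpret M: Metric_space V "ip_dist V ip" by (rule metric_space)
  have 1: "M.MCauchy X \<longleftrightarrow> cauchy X" for X
    unfolding M.MCauchy_def cauchy_def by (auto simp: ip_dist_def image_subset_iff; meson)
  have 2: "limitin M.mtopology X x sequentially \<longleftrightarrow> converges X x sequentially" if "range X \<subseteq> V" for X x
  proof -
    have X: "X n \<in> V" for n using that by auto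
    show ?thesis
      unfolding M.limitin_metric converges_def tendsto_iff
      using X by (auto simp: ip_dist_def dist_real_def)
  qed
  show ?thesis
    unfolding M.mcomplete_def 1 using 2 by (metis cauchy_def)
qed

lemma hilbert_iff:
  "hilbert_space_on V ip \<longleftrightarrow> (\<forall>X. cauchy X \<longrightarrow> (\<exists>x. converges X x sequentially))"
  by (simp add: hilbert_space_on_def inner_product mcomplete_iff)

lemma ip_closure_eq:
  assumes "S \<subseteq> V"
  shows "ip_closure V ip S = V \<longleftrightarrow> (\<forall>x\<in>V. \<forall>e>0. \<exists>s\<in>S. nrm (s - x) < e)"
proof -
  interpret M: Metric_space V "ip_dist V ip" by (rule metric_space)
  have eq: "ip_closure V ip S = {x \<in> V. \<forall>e>0. \<exists>s\<in>S. nrm (s - x) < e}"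
    unfolding ip_closure_def M.metric_closure_of M.mball_def
    using assms by (auto simp: ip_dist_def subset_iff nrm_minus_commute; metis nrm_minus_commute)
  show ?thesis unfolding eq by blast
qed

end

section \<open>Riesz representation\<close>

context ip_space begin

text \<open>It serves the test functions with the corrected form as well as Hilbert spaces.  The sequence
  minimises \<open>J x = \<langle>x, x\<rangle> - 2 l x\<close>, which is bounded below because \<open>l\<close> is
  bounded.  By the parallelogram law it is Cauchy; since \<open>J\<close> is nearly minimal at \<open>g n\<close>, its derivative there
  in every direction \<open>f\<close>, namely \<open>2 (\<langle>g n, f\<rangle> - l f)\<close>, tends to \<open>0\<close>.\<close>

lemma bounded_functional_is_limit:
  assumes l: "bounded_functional_on V ip l"
  shows "\<exists>g. cauchy g \<and> (\<forall>f\<in>V. (\<lambda>n. ip (g n) f) \<longlonglongrightarrow> l f)"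
proof -
  from l obtain C where lin: "linear_on V l" and C: "\<And>x. x \<in> V \<Longrightarrow> \<bar>l x\<bar> \<le> C * nrm x"
    by (auto simp: bounded_functional_on_def)
  have l_add: "l (x + y) = l x + l y" and l_scale: "l (c *\<^sub>R x) = c * l x" if "x \<in> V" "y \<in> V" for x y c
    using lin that by (auto simp: linear_on_def)
  define J where "J x = ip x x - 2 * l x" for x
  have lower: "- C\<^sup>2 \<le> J x" if "x \<in> V" for x
  proof -
    have "0 \<le> (nrm x - C)\<^sup>2" by simp
    also have "\<dots> = ip x x - 2 * (C * nrm x) + C\<^sup>2"
      using that by (simp add: power2_diff nrm_power2)
    also have "\<dots> \<le> J x + C\<^sup>2"
      using C[OF that] by (simp add: J_def abs_le_iff)
    finally show ?thesis by simp
  qed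
  then have bdd: "bdd_below (J ` V)" by (auto simp: bdd_below_def)
  define m where "m = Inf (J ` V)"
  have m: "m \<le> J x" if "x \<in> V" for x
    using that bdd by (simp add: m_def cInf_lower)
  have "J ` V \<noteq> {}" using in_V(1) by blast
  then have "\<exists>y\<in>J ` V. y < m + 1 / Suc n" for n
    unfolding m_def by (rule cInf_lessD) simp
  then have "\<exists>x\<in>V. J x < m + 1 / Suc n" for n by (simp add: bex_simps)
  then obtain g where g: "\<And>n. g n \<in> V" "\<And>n. J (g n) < m + 1 / Suc n" by metis
  have small: "\<exists>M. \<forall>n\<ge>M. c / Suc n < e" if "e > 0" for c e :: real
  proof -
    have "(\<lambda>n. c * (1 / Suc n)) \<longlonglongrightarrow> c * 0"
      by (intro tendsto_mult tendsto_const LIMSEQ_Suc lim_1_over_n)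
    then have "\<forall>\<^sub>F n in sequentially. c / Suc n < e"
      using that by (auto dest: order_tendstoD(2))
    then show ?thesis by (simp add: eventually_sequentially)
  qed
  have "cauchy g"
    unfolding cauchy_def
  proof (intro conjI allI impI)
    show "range g \<subseteq> V" using g by auto
    fix e :: real assume e: "e > 0"
    then obtain M where M: "\<And>n. n \<ge> M \<Longrightarrow> 4 / Suc n < e\<^sup>2"
      using small[of "e\<^sup>2" 4] by auto
    have "nrm (g a - g b) < e" if "a \<ge> M" "b \<ge> M" for a b
    proof -
      let ?z = "(1 / 2) *\<^sub>R (g a + g b)"
      have "(nrm (g a - g b))\<^sup>2 = 2 * J (g a) + 2 * J (g b) - 4 * J ?z"
        using g(1)[of a] g(1)[of b]
        by (simp add: parallelogram J_def ip_linear_left(2) ip_linear_right(2) l_add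
            l_scale[OF _ in_V(1)] del: scaleR_add_right) argo
      also have "\<dots> < 2 * (m + 1 / Suc a) + 2 * (m + 1 / Suc b) - 4 * m"
        using g(2)[of a] g(2)[of b] m[of ?z] g(1)[of a] g(1)[of b] by simp
      also have "\<dots> < e\<^sup>2" using M[OF that(1)] M[OF that(2)] by simp
      finally show ?thesis using e by (simp add: power2_less_imp_less)
    qed
    then show "\<exists>M. \<forall>a\<ge>M. \<forall>b\<ge>M. nrm (g a - g b) < e" by blast
  qed
  moreover have "(\<lambda>n. ip (g n) f) \<longlonglongrightarrow> l f" if f: "f \<in> V" for f
  proof -
    define s where "s = 1 + ip f f"
    have s: "s > 0" "ip f f \<le> s" using ip_self_nonneg[OF f] by (auto simp: s_def)
    have bound: "(ip (g n) f - l f)\<^sup>2 \<le> s * (1 / Suc n)" for n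
    proof -
      define d where "d = ip (g n) f - l f"
      \<comment> \<open>Nearly the minimiser of \<open>J\<close> on the line through \<open>g n\<close> in direction \<open>f\<close>; the summand 1 in \<open>s\<close> allows \<open>f = 0\<close>.\<close>
      define t where "t = - d / s"
      have "J (g n + t *\<^sub>R f) = J (g n) + 2 * t * d + t\<^sup>2 * ip f f"
        using f g(1)[of n]
        by (simp add: J_def d_def ip_simps l_add l_scale[OF f f] ip_commute[of f "g n"]
            algebra_simps power2_eq_square)
      moreover have "t\<^sup>2 * ip f f \<le> t\<^sup>2 * s" using s by (intro mult_left_mono) auto
      moreover have "2 * t * d + t\<^sup>2 * s = - d\<^sup>2 / s"
        using s by (simp add: t_def power2_eq_square field_simps)
      ultimately have "m \<le> J (g n) - d\<^sup>2 / s"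
        using m[of "g n + t *\<^sub>R f"] f g(1)[of n] by simp
      then have "d\<^sup>2 / s \<le> 1 / Suc n" using g(2)[of n] by simp
      then show ?thesis using s by (simp add: d_def field_simps)
    qed
    have "(\<lambda>n. s * (1 / Suc n)) \<longlonglongrightarrow> s * 0"
      by (intro tendsto_mult tendsto_const LIMSEQ_Suc lim_1_over_n)
    then have lim: "(\<lambda>n. s * (1 / Suc n)) \<longlonglongrightarrow> 0" by simp
    have "(\<lambda>n. (ip (g n) f - l f)\<^sup>2) \<longlonglongrightarrow> 0"
      by (rule Lim_null_comparison[OF always_eventually[OF allI] lim]) (use bound in simp)
    then have "(\<lambda>n. ip (g n) f - l f) \<longlonglongrightarrow> 0"
      by (simp add: power_tendsto_0_iff)
    then show ?thesis by (simp add: LIM_zero_iff)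
  qed
  ultimately show ?thesis by blast
qed

lemma riesz_representation:
  assumes "hilbert_space_on V ip" "bounded_functional_on V ip l"
  shows "\<exists>w\<in>V. \<forall>x\<in>V. ip w x = l x"
proof -
  obtain g where g: "cauchy g" "\<And>f. f \<in> V \<Longrightarrow> (\<lambda>n. ip (g n) f) \<longlonglongrightarrow> l f"
    using bounded_functional_is_limit[OF assms(2)] by blast
  then obtain w where w: "converges g w sequentially"
    using assms(1) hilbert_iff by blast
  then have "w \<in> V" by (simp add: converges_def)
  moreover have "ip w x = l x" if "x \<in> V" for x
    using tendsto_ip[OF w converges_const[OF that]] g(2)[OF that] by (rule LIMSEQ_unique)
  ultimately show ?thesis by blast
qed

lemma eq_if_ip_eq:
  assumes "x \<in> V" "y \<in> V" "\<And>z. z \<in> V \<Longrightarrow> ip x z = ip y z"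
  shows "x = y"
proof -
  have "ip (x - y) (x - y) = 0" using assms by (simp add: ip_simps)
  then show ?thesis using assms by simp
qed

lemma hilbert_space_on_closed_subspace:
  assumes "hilbert_space_on V ip" "subspace W" "W \<subseteq> V"
    and closed: "\<And>X x. converges X x sequentially \<Longrightarrow> (\<And>n. X n \<in> W) \<Longrightarrow> x \<in> W"
  shows "hilbert_space_on W ip"
proof -
  interpret W: ip_space W ip
    by standard (rule inner_product_on_subset[OF assms(2,3)])
  show ?thesis
    unfolding W.hilbert_iff
  proof (intro allI impI)
    fix X assume X: "W.cauchy X"
    then have "cauchy X" using assms(3) by (auto simp: cauchy_def W.cauchy_def)
    then obtain x where x: "converges X x sequentially" using assms(1) hilbert_iff by blast
    then have "x \<in> W" using W.cauchy_in_V[OF X] closed by blast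
    then show "\<exists>x. W.converges X x sequentially"
      using x W.cauchy_in_V[OF X] by (auto simp: converges_def W.converges_def)
  qed
qed

lemma hilbert_space_on_equivalent_norm:
  assumes "hilbert_space_on V ip" and ip2: "inner_product_on V ip2"
    and C: "\<And>x. x \<in> V \<Longrightarrow> nrm x \<le> C * ip_norm ip2 x"
    and D: "\<And>x. x \<in> V \<Longrightarrow> ip_norm ip2 x \<le> D * nrm x"
  shows "hilbert_space_on V ip2"
proof -
  interpret E: ip_space V ip2 by standard (rule ip2)
  show ?thesis
    unfolding E.hilbert_iff
  proof (intro allI impI)
    fix X assume X: "E.cauchy X"
    then have in_V: "X n \<in> V" for n by (rule E.cauchy_in_V)
    have "cauchy X"
      unfolding cauchy_def
    proof (intro conjI allI impI)
      fix e :: real assume e: "e > 0"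
      let ?d = "e / (\<bar>C\<bar> + 1)"
      have "?d > 0" using e by simp
      from E.cauchyD[OF X this] obtain M where M: "\<forall>m\<ge>M. \<forall>n\<ge>M. E.nrm (X m - X n) < ?d" by blast
      have "nrm (X m - X n) < e" if "m \<ge> M" "n \<ge> M" for m n
      proof -
        have "nrm (X m - X n) \<le> C * E.nrm (X m - X n)" using in_V C by simp
        also have "\<dots> \<le> (\<bar>C\<bar> + 1) * E.nrm (X m - X n)"
          using in_V by (intro mult_right_mono) auto
        also have "\<dots> < (\<bar>C\<bar> + 1) * ?d"
          using M that by (intro mult_strict_left_mono) auto
        finally show ?thesis by simp
      qed
      then show "\<exists>M. \<forall>m\<ge>M. \<forall>n\<ge>M. nrm (X m - X n) < e" by blast
    qed (use in_V in auto)
    then obtain x where x: "converges X x sequentially" using assms(1) hilbert_iff by blast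
    then have xV: "x \<in> V" and lim: "(\<lambda>n. nrm (X n - x)) \<longlonglongrightarrow> 0" by (auto simp: converges_def)
    have "(\<lambda>n. D * nrm (X n - x)) \<longlonglongrightarrow> 0" using tendsto_mult[OF tendsto_const lim] by simp
    then have "(\<lambda>n. E.nrm (X n - x)) \<longlonglongrightarrow> 0"
      by (rule Lim_null_comparison[OF always_eventually, rotated]) (use in_V xV D in simp)
    then show "\<exists>x. E.converges X x sequentially"
      using in_V xV by (auto simp: E.converges_def)
  qed
qed

end

text \<open>The inner products of the theorem agree with more convenient expressions only on their carriers,
  so the Hilbert space notions have to be transferred along such an agreement.\<close>

lemma inner_product_on_cong:
  assumes "\<And>x y. x \<in> V \<Longrightarrow> y \<in> V \<Longrightarrow> ip x y = ip' x y"
  shows "inner_product_on V ip \<longleftrightarrow> inner_product_on V ip'"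
  unfolding inner_product_on_def linear_on_def
  using assms by (intro conj_cong) (auto simp: subspace_add subspace_scale)

lemma ip_dist_cong:
  assumes "\<And>x y. x \<in> V \<Longrightarrow> y \<in> V \<Longrightarrow> ip x y = ip' x y" "subspace V"
  shows "ip_dist V ip = ip_dist V ip'"
  using assms by (simp add: fun_eq_iff ip_dist_def ip_norm_def subspace_diff)

lemma hilbert_space_on_cong:
  assumes "\<And>x y. x \<in> V \<Longrightarrow> y \<in> V \<Longrightarrow> ip x y = ip' x y"
  shows "hilbert_space_on V ip \<longleftrightarrow> hilbert_space_on V ip'"
  using inner_product_on_cong[of V ip ip', OF assms] ip_dist_cong[of V ip ip', OF assms]
  unfolding hilbert_space_on_def by (auto simp: inner_product_on_def)

lemma orthogonal_sum_cong:
  assumes "\<And>x y. x \<in> U \<Longrightarrow> y \<in> W \<Longrightarrow> ip x y = ip' x y"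
  shows "orthogonal_sum V ip U W \<longleftrightarrow> orthogonal_sum V ip' U W"
  using assms by (simp add: orthogonal_sum_def cong: conj_cong)

section \<open>Dual pairs from transported inner products\<close>

text \<open>If the pairing of \<open>U\<close> with a Hilbert space \<open>W\<close> is the inner product of \<open>W\<close> after a linear
  bijection \<open>K\<close>, then by the Riesz theorem \<open>U\<close>, with the inner product transported by \<open>K\<close>, is the dual of \<open>W\<close>
  and \<open>K\<close> is the inverse Riesz map.  The three dual pairs of the theorem are of this kind, with the same \<open>K\<close>.\<close>

locale riesz_pair = W: ip_space W ip
  for W :: "'v::real_vector set" and ip +
  fixes U :: "'u::real_vector set" and ipU pr K
  assumes hilbert: "hilbert_space_on W ip"
    and subspace_U: "subspace U"
    and linear_K: "linear_on U K"
    and bij_K: "bij_betw K U W"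
    and ipU: "\<And>u v. u \<in> U \<Longrightarrow> v \<in> U \<Longrightarrow> ipU u v = ip (K u) (K v)"
    and pr: "\<And>u x. u \<in> U \<Longrightarrow> x \<in> W \<Longrightarrow> pr u x = ip (K u) x"
begin

lemma K_in_W [simp]: "u \<in> U \<Longrightarrow> K u \<in> W"
  using bij_K by (auto simp: bij_betw_def)

lemma K_linear:
  "u \<in> U \<Longrightarrow> v \<in> U \<Longrightarrow> K (u + v) = K u + K v" "u \<in> U \<Longrightarrow> K (c *\<^sub>R u) = c *\<^sub>R K u"
  using linear_K by (auto simp: linear_on_def)

lemma U_closed [simp]:
  "0 \<in> U" "u \<in> U \<Longrightarrow> v \<in> U \<Longrightarrow> u + v \<in> U" "u \<in> U \<Longrightarrow> v \<in> U \<Longrightarrow> u - v \<in> U" "u \<in> U \<Longrightarrow> c *\<^sub>R u \<in> U"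
  using subspace_U by (auto simp: subspace_0 subspace_add subspace_diff subspace_scale)

lemma K_diff: "u \<in> U \<Longrightarrow> v \<in> U \<Longrightarrow> K (u - v) = K u - K v"
  using K_linear(1)[of "u - v" v] by simp

lemma K_zero [simp]: "K 0 = 0"
  using K_linear(2)[of 0 0] by simp

lemma K_eq_0: "u \<in> U \<Longrightarrow> K u = 0 \<longleftrightarrow> u = 0"
  using bij_K K_zero U_closed(1) by (metis bij_betw_imp_inj_on inj_onD)

lemma inner_product_U: "inner_product_on U ipU"
  unfolding inner_product_on_def linear_on_def
  using subspace_U
  by (auto simp: ipU K_linear W.ip_linear_left K_eq_0 intro: W.ip_commute W.ip_self_pos)

sublocale U: ip_space U ipU
  by standard (rule inner_product_U)

lemma nrm_U: "u \<in> U \<Longrightarrow> U.nrm u = W.nrm (K u)"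
  by (simp add: ip_norm_def ipU)

lemma hilbert_U: "hilbert_space_on U ipU"
  unfolding U.hilbert_iff
proof (intro allI impI)
  fix X assume X: "U.cauchy X"
  then have in_U: "X n \<in> U" for n by (rule U.cauchy_in_V)
  have "W.cauchy (\<lambda>n. K (X n))"
    using X in_U by (auto simp: W.cauchy_def U.cauchy_def nrm_U K_diff)
  then obtain w where w: "W.converges (\<lambda>n. K (X n)) w sequentially"
    using hilbert W.hilbert_iff by blast
  then have "w \<in> W" by (simp add: W.converges_def)
  then obtain u where u: "u \<in> U" "w = K u" using bij_K by (auto simp: bij_betw_def)
  have "U.converges X u sequentially"
    using w in_U u by (simp add: W.converges_def U.converges_def nrm_U K_diff)
  then show "\<exists>u. U.converges X u sequentially" ..
qed

lemma is_dual_of: "is_dual_of U ipU W ip pr"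
proof -
  have bounded: "bounded_functional_on W ip (pr u)" if u: "u \<in> U" for u
    unfolding bounded_functional_on_def linear_on_def
    using u W.cauchy_schwarz[of "K u"] by (auto simp: pr W.ip_linear_right)
  have unique: "\<exists>!u. u \<in> U \<and> (\<forall>x\<in>W. pr u x = l x)" if l: "bounded_functional_on W ip l" for l
  proof -
    obtain w where w: "w \<in> W" "\<forall>x\<in>W. ip w x = l x"
      using W.riesz_representation[OF hilbert l] by blast
    then obtain u where u: "u \<in> U" "K u = w" using bij_K by (auto simp: bij_betw_def)
    show ?thesis
    proof (rule ex1I[of _ u])
      show "u \<in> U \<and> (\<forall>x\<in>W. pr u x = l x)" using u w by (simp add: pr)
      fix v assume v: "v \<in> U \<and> (\<forall>x\<in>W. pr v x = l x)"
      then have "K v = w"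
        using w by (intro W.eq_if_ip_eq) (auto simp: pr)
      with u v bij_K show "v = u" by (metis bij_betw_imp_inj_on inj_onD)
    qed
  qed
  have norm: "U.nrm u = (SUP x\<in>{x\<in>W. W.nrm x \<le> 1}. \<bar>pr u x\<bar>)" if u: "u \<in> U" for u
  proof (rule antisym)
    let ?B = "{x\<in>W. W.nrm x \<le> 1}"
    have le: "\<bar>pr u x\<bar> \<le> U.nrm u" if "x \<in> ?B" for x
    proof -
      have "\<bar>pr u x\<bar> \<le> W.nrm (K u) * W.nrm x"
        using u that by (simp add: pr W.cauchy_schwarz)
      also have "\<dots> \<le> W.nrm (K u) * 1"
        using u that by (intro mult_left_mono) auto
      finally show ?thesis using u by (simp add: nrm_U)
    qed
    show "(SUP x\<in>?B. \<bar>pr u x\<bar>) \<le> U.nrm u"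
      by (rule cSUP_least) (use le in \<open>auto intro: exI[of _ 0]\<close>)
    have bdd: "bdd_above ((\<lambda>x. \<bar>pr u x\<bar>) ` ?B)" using le by (intro bdd_aboveI2)
    show "U.nrm u \<le> (SUP x\<in>?B. \<bar>pr u x\<bar>)"
    proof (cases "u = 0")
      case True
      have "\<bar>pr u 0\<bar> \<le> (SUP x\<in>?B. \<bar>pr u x\<bar>)" by (rule cSUP_upper[OF _ bdd]) simp
      with True show ?thesis by simp
    next
      case False
      define w where "w = K u"
      have w: "w \<in> W" "W.nrm w > 0"
        using u False K_eq_0 W.nrm_nonneg[of "K u"] W.nrm_eq_0[of "K u"]
        by (auto simp: w_def less_le)
      \<comment> \<open>The supremum is attained at the normalised representing vector.\<close>
      define x where "x = (1 / W.nrm w) *\<^sub>R w"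
      have "x \<in> ?B" using w by (simp add: x_def W.nrm_scaleR)
      moreover have "pr u x = W.nrm w"
        using w u by (simp add: pr x_def W.ip_linear_right flip: w_def)
          (simp add: W.nrm_power2[symmetric] power2_eq_square)
      ultimately show ?thesis
        using cSUP_upper[OF _ bdd, of x] w u by (simp add: nrm_U flip: w_def)
    qed
  qed
  have "linear_on U (\<lambda>u. pr u x)" if "x \<in> W" for x
    using that by (simp add: linear_on_def pr K_linear W.ip_linear_left)
  then show ?thesis
    unfolding is_dual_of_def using hilbert hilbert_U bounded unique norm by blast
qed

lemma is_riesz_map_inverse:
  assumes J: "\<And>x. x \<in> W \<Longrightarrow> J x \<in> U" "\<And>x. x \<in> W \<Longrightarrow> K (J x) = x"
  shows "is_riesz_map W ip U ipU pr J"
proof -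
  have inj: "u = v" if "u \<in> U" "v \<in> U" "K u = K v" for u v
    using that bij_K by (metis bij_betw_imp_inj_on inj_onD)
  have "linear_on W J"
    unfolding linear_on_def using J by (auto intro!: inj simp: K_linear)
  moreover have "bij_betw J W U"
  proof (rule bij_betw_byWitness[of _ K])
    show "\<forall>u\<in>U. J (K u) = u" using J by (auto intro!: inj)
  qed (use J in auto)
  ultimately show ?thesis
    unfolding is_riesz_map_def using J by (simp add: nrm_U pr)
qed

text \<open>A Hilbert subspace of \<open>W\<close> and its preimage are again in duality under the same pairing; this
  handles the two summands of an orthogonal sum.\<close>

lemma restrict:
  assumes "hilbert_space_on W1 ip" "W1 \<subseteq> W"
  shows "riesz_pair W1 ip {u\<in>U. K u \<in> W1} ipU pr K"
proof -
  interpret W1: ip_space W1 ip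
    by standard (use assms(1) in \<open>simp add: hilbert_space_on_def\<close>)
  show ?thesis
  proof
    show "subspace {u\<in>U. K u \<in> W1}"
      using subspace_U W1.subspace by (auto simp: subspace_def K_linear)
    show "linear_on {u\<in>U. K u \<in> W1} K"
      by (simp add: linear_on_def K_linear)
    show "bij_betw K {u\<in>U. K u \<in> W1} W1"
      using bij_K assms(2) by (auto simp: bij_betw_def inj_on_def image_iff subset_iff)
  qed (use assms in \<open>auto simp: ipU pr\<close>)
qed

lemma orthogonal_sum_preimage:
  assumes "orthogonal_sum W ip W1 W2"
  shows "orthogonal_sum U ipU {u\<in>U. K u \<in> W1} {u\<in>U. K u \<in> W2}"
proof -
  from assms have W: "subspace W1" "subspace W2" "W = {x + y |x y. x \<in> W1 \<and> y \<in> W2}"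
    "W1 \<inter> W2 = {0}" "\<forall>x\<in>W1. \<forall>y\<in>W2. ip x y = 0"
    by (auto simp: orthogonal_sum_def)
  have sub: "x \<in> W" if "x \<in> W1 \<or> x \<in> W2" for x
  proof -
    have "x = x + 0" "x = 0 + x" by simp_all
    with that show ?thesis
      unfolding W(3) using subspace_0[OF W(1)] subspace_0[OF W(2)] by blast
  qed
  show ?thesis
    unfolding orthogonal_sum_def
  proof (intro conjI)
    show "subspace {u\<in>U. K u \<in> W1}" "subspace {u\<in>U. K u \<in> W2}"
      using subspace_U W(1,2) by (auto simp: subspace_def K_linear)
    show "U = {u + v |u v. u \<in> {u\<in>U. K u \<in> W1} \<and> v \<in> {u\<in>U. K u \<in> W2}}"
    proof (intro set_eqI iffI)
      fix u assume u: "u \<in> U"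
      then have "K u \<in> W" by simp
      then obtain x y where xy: "K u = x + y" "x \<in> W1" "y \<in> W2" using W(3) by blast
      then obtain v w where vw: "v \<in> U" "w \<in> U" "K v = x" "K w = y"
        using sub bij_K unfolding bij_betw_def by (metis imageE)
      then have "K u = K (v + w)" using xy by (simp add: K_linear)
      then have "u = v + w" using u vw bij_K by (metis U_closed(2) bij_betw_imp_inj_on inj_onD)
      with vw xy show "u \<in> {u + v |u v. u \<in> {u\<in>U. K u \<in> W1} \<and> v \<in> {u\<in>U. K u \<in> W2}}" by blast
    qed auto
    show "{u\<in>U. K u \<in> W1} \<inter> {u\<in>U. K u \<in> W2} = {0}"
      using W(4) K_eq_0 subspace_0[OF W(1)] subspace_0[OF W(2)] by auto
    show "\<forall>u\<in>{u\<in>U. K u \<in> W1}. \<forall>v\<in>{u\<in>U. K u \<in> W2}. ipU u v = 0"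
      using W(5) by (simp add: ipU)
  qed
qed

text \<open>The relation is symmetric, which gives the predual from the dual.\<close>

lemma reverse:
  assumes J: "\<And>x. x \<in> W \<Longrightarrow> J x \<in> U" "\<And>x. x \<in> W \<Longrightarrow> K (J x) = x"
  shows "riesz_pair U ipU W ip (\<lambda>x u. pr u x) J"
proof
  show "linear_on W J" "bij_betw J W U"
    using is_riesz_map_inverse[OF J] by (auto simp: is_riesz_map_def)
qed (use J hilbert_U W.subspace in \<open>auto simp: ipU pr intro: W.ip_commute\<close>)

end

section \<open>The inner product adapted to a biorthogonal system\<close>

lemma subspace_common_kernel:
  assumes "subspace V" "\<And>n. n \<in> I \<Longrightarrow> linear_on V (c n)"
  shows "subspace {x\<in>V. \<forall>n\<in>I. c n x = (0::real)}"
  unfolding subspace_def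
proof (intro conjI allI impI ballI)
  have c_lin: "c n (x + y) = c n x + c n y" "c n (r *\<^sub>R x) = r * c n x"
    if "n \<in> I" "x \<in> V" "y \<in> V" for n x y r
    using assms(2)[OF that(1)] that(2,3) by (auto simp: linear_on_def)
  note sub = subspace_0[OF assms(1)] subspace_add[OF assms(1)] subspace_scale[OF assms(1)]
  show "0 \<in> {x\<in>V. \<forall>n\<in>I. c n x = (0::real)}"
    using sub c_lin(2)[of _ 0 0 0] by simp
  show "x + y \<in> {x\<in>V. \<forall>n\<in>I. c n x = (0::real)}"
    if "x \<in> {x\<in>V. \<forall>n\<in>I. c n x = (0::real)}" "y \<in> {x\<in>V. \<forall>n\<in>I. c n x = (0::real)}" for x y
    using that sub c_lin by simp
  show "r *\<^sub>R x \<in> {x\<in>V. \<forall>n\<in>I. c n x = (0::real)}"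
    if "x \<in> {x\<in>V. \<forall>n\<in>I. c n x = (0::real)}" for x r
    using that sub c_lin(2)[of _ x x r] by simp
qed

text \<open>Finitely many bounded functionals \<open>c n\<close> with a biorthogonal family \<open>\<phi>\<close> split a Hilbert space into
  the common kernel of the functionals and the span of \<open>\<phi>\<close>, in general not orthogonally.\<close>

locale biorthogonal_splitting = ip_space V ip
  for V :: "'v::real_vector set" and ip +
  fixes I :: "nat set" and c :: "nat \<Rightarrow> 'v \<Rightarrow> real" and \<phi> :: "nat \<Rightarrow> 'v"
  assumes finite_I [simp]: "finite I"
    and hilbert: "hilbert_space_on V ip"
    and c_bounded: "\<And>n. n \<in> I \<Longrightarrow> bounded_functional_on V ip (c n)"
    and \<phi>_in_V [simp]: "\<And>n. n \<in> I \<Longrightarrow> \<phi> n \<in> V"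
    and biorth: "\<And>n m. n \<in> I \<Longrightarrow> m \<in> I \<Longrightarrow> c n (\<phi> m) = (if m = n then 1 else 0)"
begin

definition proj :: "'v \<Rightarrow> 'v" where
  "proj x = x - (\<Sum>n\<in>I. c n x *\<^sub>R \<phi> n)"

text \<open>This inner product forces the splitting to be orthogonal and \<open>\<phi>\<close> to be orthonormal, and leaves the
  original one unchanged on the kernel.\<close>

definition adapted :: "'v \<Rightarrow> 'v \<Rightarrow> real" where
  "adapted x y = ip (proj x) (proj y) + (\<Sum>n\<in>I. c n x * c n y)"

abbreviation kernel :: "'v set" where
  "kernel \<equiv> {x\<in>V. \<forall>n\<in>I. c n x = 0}"

lemma c_linear_on: "n \<in> I \<Longrightarrow> linear_on V (c n)"
  using c_bounded by (auto simp: bounded_functional_on_def)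

lemma c_linear:
  "n \<in> I \<Longrightarrow> x \<in> V \<Longrightarrow> y \<in> V \<Longrightarrow> c n (x + y) = c n x + c n y"
  "n \<in> I \<Longrightarrow> x \<in> V \<Longrightarrow> c n (r *\<^sub>R x) = r * c n x"
  using c_linear_on by (auto simp: linear_on_def)

lemma c_diff: "n \<in> I \<Longrightarrow> x \<in> V \<Longrightarrow> y \<in> V \<Longrightarrow> c n (x - y) = c n x - c n y"
  using c_linear(1)[of n "x - y" y] by simp

lemma c_zero [simp]: "n \<in> I \<Longrightarrow> c n 0 = 0"
  using c_linear(2)[of n 0 0] by simp

lemma c_sum:
  "n \<in> I \<Longrightarrow> (\<And>i. i \<in> S \<Longrightarrow> f i \<in> V) \<Longrightarrow> c n (\<Sum>i\<in>S. f i) = (\<Sum>i\<in>S. c n (f i))"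
  by (induction S rule: infinite_finite_induct) (auto simp: c_linear)

lemma proj_in_V [simp]: "x \<in> V \<Longrightarrow> proj x \<in> V"
  by (simp add: proj_def)

lemma proj_linear:
  "x \<in> V \<Longrightarrow> y \<in> V \<Longrightarrow> proj (x + y) = proj x + proj y"
  "x \<in> V \<Longrightarrow> proj (r *\<^sub>R x) = r *\<^sub>R proj x"
  by (simp_all add: proj_def c_linear scaleR_add_left sum.distrib scaleR_diff_right scaleR_sum_right)

lemma c_proj [simp]:
  assumes "n \<in> I" "x \<in> V"
  shows "c n (proj x) = 0"
proof -
  have "c n (\<Sum>m\<in>I. c m x *\<^sub>R \<phi> m) = (\<Sum>m\<in>I. c m x * c n (\<phi> m))"
    using assms by (simp add: c_sum c_linear)
  also have "\<dots> = (\<Sum>m\<in>I. if m = n then c m x else 0)"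
    using assms by (intro sum.cong) (auto simp: biorth)
  also have "\<dots> = c n x" using assms by simp
  finally show ?thesis using assms by (simp add: proj_def c_diff)
qed

lemma proj_in_kernel [simp]: "x \<in> V \<Longrightarrow> proj x \<in> kernel"
  by simp

lemma proj_kernel: "x \<in> kernel \<Longrightarrow> proj x = x"
  by (simp add: proj_def)

lemma proj_\<phi> [simp]:
  assumes "n \<in> I"
  shows "proj (\<phi> n) = 0"
proof -
  have "(\<Sum>m\<in>I. c m (\<phi> n) *\<^sub>R \<phi> m) = (\<Sum>m\<in>I. if m = n then \<phi> m else 0)"
    using assms by (intro sum.cong) (auto simp: biorth)
  then show ?thesis using assms by (simp add: proj_def)
qed

lemma splitting: "x = proj x + (\<Sum>n\<in>I. c n x *\<^sub>R \<phi> n)"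
  by (simp add: proj_def)

lemma inner_product_adapted: "inner_product_on V adapted"
  unfolding inner_product_on_def
proof (intro conjI ballI impI)
  fix x assume x: "x \<in> V" "x \<noteq> 0"
  have sq: "0 \<le> (\<Sum>n\<in>I. c n x * c n x)" by (intro sum_nonneg) auto
  have "adapted x x \<noteq> 0"
  proof
    assume "adapted x x = 0"
    then have 0: "ip (proj x) (proj x) = 0" "(\<Sum>n\<in>I. c n x * c n x) = 0"
      using sq ip_self_nonneg[OF proj_in_V[OF x(1)]] unfolding adapted_def by linarith+
    from 0(2) have "\<forall>n\<in>I. c n x = 0" by (simp add: sum_nonneg_eq_0_iff)
    moreover have "proj x = 0" using 0(1) x by simp
    ultimately have "x = 0" using splitting[of x] by simp
    with x show False by simp
  qed
  then show "0 < adapted x x"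
    using sq ip_self_nonneg[of "proj x"] x by (auto simp: adapted_def)
next
  fix y assume "y \<in> V"
  then show "linear_on V (\<lambda>x. adapted x y)"
    by (auto simp: linear_on_def adapted_def proj_linear ip_linear_left c_linear distrib_right
        sum.distrib distrib_left sum_distrib_left mult.assoc)
qed (auto simp: subspace adapted_def ip_commute mult.commute)

sublocale adapted: ip_space V adapted
  by standard (rule inner_product_adapted)

lemma c_le_adapted:
  assumes "n \<in> I" "x \<in> V"
  shows "\<bar>c n x\<bar> \<le> adapted.nrm x"
proof -
  have "(c n x)\<^sup>2 \<le> (\<Sum>n\<in>I. c n x * c n x)"
    using assms member_le_sum[of n I "\<lambda>n. c n x * c n x"] by (simp add: power2_eq_square)
  also have "\<dots> \<le> (adapted.nrm x)\<^sup>2"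
    using assms ip_self_nonneg[of "proj x"] by (simp add: adapted.nrm_power2) (simp add: adapted_def)
  finally show ?thesis
    using assms abs_le_square_iff[of "c n x" "adapted.nrm x"] by simp
qed

lemma proj_le_adapted:
  assumes "x \<in> V"
  shows "nrm (proj x) \<le> adapted.nrm x"
  using assms by (simp add: ip_norm_def adapted_def sum_nonneg)

text \<open>The two norms are equivalent since the splitting into \<open>proj x\<close> and the coordinates \<open>c n x\<close> is
  continuous.  Hence the adapted inner product is complete and has the same bounded functionals.\<close>

lemma nrm_le_adapted: "\<exists>C. \<forall>x\<in>V. nrm x \<le> C * adapted.nrm x"
proof (intro exI ballI)
  fix x assume x: "x \<in> V"
  have "nrm x \<le> nrm (proj x) + nrm (\<Sum>n\<in>I. c n x *\<^sub>R \<phi> n)"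
    using splitting[of x] nrm_triangle[of "proj x" "\<Sum>n\<in>I. c n x *\<^sub>R \<phi> n"] x by simp
  also have "nrm (\<Sum>n\<in>I. c n x *\<^sub>R \<phi> n) \<le> (\<Sum>n\<in>I. nrm (c n x *\<^sub>R \<phi> n))"
    by (rule nrm_sum_le) simp
  also have "\<dots> \<le> (\<Sum>n\<in>I. adapted.nrm x * nrm (\<phi> n))"
    using x by (intro sum_mono) (auto simp: nrm_scaleR c_le_adapted intro!: mult_right_mono)
  also have "nrm (proj x) \<le> adapted.nrm x" by (rule proj_le_adapted[OF x])
  finally show "nrm x \<le> (1 + (\<Sum>n\<in>I. nrm (\<phi> n))) * adapted.nrm x"
    by (simp add: sum_distrib_left algebra_simps)
qed

lemma c_bound: "n \<in> I \<Longrightarrow> \<exists>C. \<forall>x\<in>V. \<bar>c n x\<bar> \<le> C * nrm x"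
  using c_bounded by (auto simp: bounded_functional_on_def)

lemma proj_le_nrm: "\<exists>C. \<forall>x\<in>V. nrm (proj x) \<le> C * nrm x"
proof -
  from c_bound obtain C where C: "\<And>n x. n \<in> I \<Longrightarrow> x \<in> V \<Longrightarrow> \<bar>c n x\<bar> \<le> C n * nrm x" by metis
  show ?thesis
  proof (intro exI ballI)
    fix x assume x: "x \<in> V"
    have "nrm (proj x) \<le> nrm x + nrm (\<Sum>n\<in>I. c n x *\<^sub>R \<phi> n)"
      using x by (simp add: proj_def nrm_diff_le)
    also have "nrm (\<Sum>n\<in>I. c n x *\<^sub>R \<phi> n) \<le> (\<Sum>n\<in>I. nrm (c n x *\<^sub>R \<phi> n))"
      by (rule nrm_sum_le) simp
    also have "\<dots> \<le> (\<Sum>n\<in>I. (C n * nrm x) * nrm (\<phi> n))"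
      using x C by (intro sum_mono) (auto simp: nrm_scaleR intro!: mult_right_mono)
    finally show "nrm (proj x) \<le> (1 + (\<Sum>n\<in>I. C n * nrm (\<phi> n))) * nrm x"
      by (simp add: sum_distrib_left algebra_simps)
  qed
qed

lemma adapted_le_nrm: "\<exists>C. \<forall>x\<in>V. adapted.nrm x \<le> C * nrm x"
proof -
  from c_bound obtain C where C: "\<And>n x. n \<in> I \<Longrightarrow> x \<in> V \<Longrightarrow> \<bar>c n x\<bar> \<le> C n * nrm x" by metis
  from proj_le_nrm obtain D where D: "\<And>x. x \<in> V \<Longrightarrow> nrm (proj x) \<le> D * nrm x" by blast
  let ?C = "D\<^sup>2 + (\<Sum>n\<in>I. (C n)\<^sup>2)"
  have "adapted.nrm x \<le> sqrt ?C * nrm x" if x: "x \<in> V" for x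
  proof (rule power2_le_imp_le)
    have C_sq: "(c n x)\<^sup>2 \<le> (C n)\<^sup>2 * (nrm x)\<^sup>2" if "n \<in> I" for n
      using power_mono[OF C[OF that x] abs_ge_zero, of 2] by (simp add: power_mult_distrib)
    have "(adapted.nrm x)\<^sup>2 = (nrm (proj x))\<^sup>2 + (\<Sum>n\<in>I. (c n x)\<^sup>2)"
      using x by (simp add: adapted.nrm_power2 nrm_power2) (simp add: adapted_def power2_eq_square)
    also have "\<dots> \<le> (D * nrm x)\<^sup>2 + (\<Sum>n\<in>I. (C n)\<^sup>2 * (nrm x)\<^sup>2)"
      using x D C_sq by (intro add_mono sum_mono power_mono) auto
    also have "\<dots> = (sqrt ?C * nrm x)\<^sup>2"
      by (simp add: power_mult_distrib sum_nonneg distrib_right sum_distrib_right)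
    finally show "(adapted.nrm x)\<^sup>2 \<le> (sqrt ?C * nrm x)\<^sup>2" .
  qed (use x in \<open>simp add: sum_nonneg\<close>)
  then show ?thesis by blast
qed

lemma hilbert_adapted: "hilbert_space_on V adapted"
  using hilbert_space_on_equivalent_norm[OF hilbert inner_product_adapted]
    nrm_le_adapted adapted_le_nrm by blast

lemma adapted_converges:
  assumes "converges X x F"
  shows "adapted.converges X x F"
proof -
  obtain C where C: "\<And>x. x \<in> V \<Longrightarrow> adapted.nrm x \<le> C * nrm x" using adapted_le_nrm by blast
  have in_V: "X i \<in> V" "x \<in> V" for i using assms by (auto simp: converges_def)
  have "((\<lambda>i. nrm (X i - x)) \<longlongrightarrow> 0) F" using assms by (simp add: converges_def)
  from tendsto_mult[OF tendsto_const this] have "((\<lambda>i. C * nrm (X i - x)) \<longlongrightarrow> 0) F" by simp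
  then have "((\<lambda>i. adapted.nrm (X i - x)) \<longlongrightarrow> 0) F"
    by (rule Lim_null_comparison[OF always_eventually, rotated]) (use in_V C in simp)
  with in_V show ?thesis by (simp add: adapted.converges_def)
qed

lemma bounded_functional_adapted:
  assumes "bounded_functional_on V ip l"
  shows "bounded_functional_on V adapted l"
proof -
  obtain C where C: "\<And>x. x \<in> V \<Longrightarrow> nrm x \<le> C * adapted.nrm x" using nrm_le_adapted by blast
  from assms obtain D where D: "linear_on V l" "\<And>x. x \<in> V \<Longrightarrow> \<bar>l x\<bar> \<le> D * nrm x"
    by (auto simp: bounded_functional_on_def)
  have "\<bar>l x\<bar> \<le> (\<bar>D\<bar> * C) * adapted.nrm x" if x: "x \<in> V" for x
  proof -
    have "\<bar>l x\<bar> \<le> \<bar>D\<bar> * nrm x"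
      using D(2)[OF x] x by (meson abs_ge_self mult_right_mono nrm_nonneg order_trans)
    also have "\<dots> \<le> \<bar>D\<bar> * (C * adapted.nrm x)" using C[OF x] by (intro mult_left_mono) auto
    finally show ?thesis by (simp add: mult.assoc)
  qed
  with D(1) show ?thesis by (auto simp: bounded_functional_on_def)
qed

text \<open>Thus \<open>\<phi> n\<close> is the Riesz representative of \<open>c n\<close>, which identifies the orthogonal complement of the
  span as the common kernel.\<close>

lemma adapted_\<phi>:
  assumes "n \<in> I" "x \<in> V"
  shows "adapted (\<phi> n) x = c n x"
proof -
  have "(\<Sum>m\<in>I. c m (\<phi> n) * c m x) = (\<Sum>m\<in>I. if m = n then c m x else 0)"
    using assms by (intro sum.cong) (auto simp: biorth)
  then show ?thesis using assms by (simp add: adapted_def)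
qed

lemma adapted_kernel: "x \<in> kernel \<Longrightarrow> y \<in> V \<Longrightarrow> adapted x y = ip x (proj y)"
  by (simp add: adapted_def proj_kernel)

lemma span_subset: "span (\<phi> ` I) \<subseteq> V"
  using subspace by (intro span_minimal) auto

lemma sum_in_span: "(\<Sum>n\<in>I. r n *\<^sub>R \<phi> n) \<in> span (\<phi> ` I)"
  by (intro span_sum span_scale span_base) auto

lemma in_span_iff: "x \<in> span (\<phi> ` I) \<longleftrightarrow> x \<in> V \<and> proj x = 0"
proof
  assume "x \<in> span (\<phi> ` I)"
  moreover have "subspace {x\<in>V. proj x = 0}"
    using subspace by (auto simp: subspace_def proj_linear proj_def[of 0])
  moreover have "\<phi> ` I \<subseteq> {x\<in>V. proj x = 0}" by auto
  ultimately show "x \<in> V \<and> proj x = 0"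
    using span_minimal[of "\<phi> ` I" "{x\<in>V. proj x = 0}"] by blast
next
  assume "x \<in> V \<and> proj x = 0"
  then have "x = (\<Sum>n\<in>I. c n x *\<^sub>R \<phi> n)" using splitting[of x] by simp
  then show "x \<in> span (\<phi> ` I)" using sum_in_span by metis
qed

lemma subspace_kernel: "subspace kernel"
  by (rule subspace_common_kernel[OF subspace c_linear_on])

lemma orthogonal_complement_span:
  "kernel = {x\<in>V. \<forall>y\<in>span (\<phi> ` I). adapted x y = 0}"
proof (intro set_eqI iffI)
  fix x assume x: "x \<in> kernel"
  have "adapted x y = 0" if "y \<in> span (\<phi> ` I)" for y
    using x that in_span_iff[of y] by (simp add: adapted_kernel)
  with x show "x \<in> {x\<in>V. \<forall>y\<in>span (\<phi> ` I). adapted x y = 0}" by simp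
next
  fix x assume x: "x \<in> {x\<in>V. \<forall>y\<in>span (\<phi> ` I). adapted x y = 0}"
  have "c n x = 0" if n: "n \<in> I" for n
    using x n adapted_\<phi>[of n x] adapted.ip_commute[of x "\<phi> n"] span_base[of "\<phi> n" "\<phi> ` I"] by simp
  with x show "x \<in> kernel" by simp
qed

lemma orthogonal_sum: "orthogonal_sum V adapted kernel (span (\<phi> ` I))"
  unfolding orthogonal_sum_def
proof (intro conjI ballI)
  show "V = {u + w |u w. u \<in> kernel \<and> w \<in> span (\<phi> ` I)}"
  proof (intro set_eqI iffI)
    fix x assume "x \<in> V"
    then show "x \<in> {u + w |u w. u \<in> kernel \<and> w \<in> span (\<phi> ` I)}"
      using splitting[of x] proj_in_kernel[of x] sum_in_span[of "\<lambda>n. c n x"] by blast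
  next
    fix x assume "x \<in> {u + w |u w. u \<in> kernel \<and> w \<in> span (\<phi> ` I)}"
    then show "x \<in> V" using span_subset by auto
  qed
  have "x = 0" if "x \<in> kernel" "x \<in> span (\<phi> ` I)" for x
    using that proj_kernel[of x] in_span_iff[of x] by simp
  then show "kernel \<inter> span (\<phi> ` I) = {0}"
    using subspace_0[OF subspace_kernel] span_zero[of "\<phi> ` I"] by blast
  show "adapted u w = 0" if "u \<in> kernel" "w \<in> span (\<phi> ` I)" for u w
    using that orthogonal_complement_span by blast
qed (use subspace_kernel in auto)

lemma hilbert_kernel: "hilbert_space_on kernel adapted"
proof (rule adapted.hilbert_space_on_closed_subspace[OF hilbert_adapted subspace_kernel])
  fix X x assume X: "adapted.converges X x sequentially" and ker: "\<And>n. X n \<in> kernel"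
  then have x: "x \<in> V" by (simp add: adapted.converges_def)
  have "c n x = 0" if n: "n \<in> I" for n
  proof -
    have "(\<lambda>i. adapted (\<phi> n) (X i)) \<longlonglongrightarrow> adapted (\<phi> n) x"
      using n by (intro adapted.tendsto_ip X adapted.converges_const) auto
    then have "(\<lambda>i. 0) \<longlonglongrightarrow> c n x" using n x ker by (simp add: adapted_\<phi>)
    then show ?thesis by (simp add: LIMSEQ_const_iff)
  qed
  with x show "x \<in> kernel" by simp
qed simp

text \<open>Closed because it is the kernel of the projection, tested here against \<open>proj x\<close> itself.\<close>

lemma hilbert_span: "hilbert_space_on (span (\<phi> ` I)) adapted"
proof (rule adapted.hilbert_space_on_closed_subspace[OF hilbert_adapted subspace_span span_subset])
  fix X x assume X: "adapted.converges X x sequentially" and span: "\<And>n. X n \<in> span (\<phi> ` I)"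
  then have x: "x \<in> V" by (simp add: adapted.converges_def)
  have proj_X: "X i \<in> V \<and> proj (X i) = 0" for i using span in_span_iff by blast
  have "(\<lambda>i. adapted (X i) (proj x)) \<longlonglongrightarrow> adapted x (proj x)"
    using x by (intro adapted.tendsto_ip X adapted.converges_const) auto
  moreover have "adapted (X i) (proj x) = 0" for i
    using proj_X x by (simp add: adapted_def)
  moreover have "adapted x (proj x) = ip (proj x) (proj x)"
    using x by (simp add: adapted_def proj_kernel)
  ultimately have "proj x = 0" using x by (simp add: LIMSEQ_const_iff)
  with x show "x \<in> span (\<phi> ` I)" by (simp add: in_span_iff)
qed

end

section \<open>Equicontinuity in reflexive spaces\<close>

lemma dual_apply_Dual: "linear u \<Longrightarrow> continuous_on UNIV u \<Longrightarrow> dual_apply (Dual u) = u"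
  by (simp add: Dual_inverse)

lemma dual_eqI: "(\<And>f. dual_apply u f = dual_apply v f) \<Longrightarrow> u = v"
  by (simp add: dual_apply_inject[symmetric] fun_eq_iff)

lemma dual_apply_diff: "dual_apply u (x - y) = dual_apply u x - dual_apply u y"
  using linear_dual_apply[of u] by (rule linear_diff)

lemma dual_apply_sum: "dual_apply u (\<Sum>i\<in>I. f i) = (\<Sum>i\<in>I. dual_apply u (f i))"
  using linear_dual_apply[of u] by (rule linear_sum)

lemma dual_apply_sum_left: "dual_apply (\<Sum>i\<in>I. u i) x = (\<Sum>i\<in>I. dual_apply (u i) x)"
  by (induction I rule: infinite_finite_induct) (auto simp: dual_apply_rep)

lemma continuous_on_scaleR_left:
  "continuous_on UNIV (\<lambda>x::'a::locally_convex_space. c *\<^sub>R x)"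
proof -
  have "((\<lambda>x. c *\<^sub>R x) \<longlongrightarrow> c *\<^sub>R y) (at y)" for y :: 'a
  proof -
    have "((\<lambda>x. (c, x)) \<longlongrightarrow> (c, y)) (at y)" by (intro tendsto_intros)
    then have "filterlim (\<lambda>x. (c, x)) (nhds c \<times>\<^sub>F nhds y) (at y)" by (simp add: nhds_prod)
    from filterlim_compose[OF tendsto_scaleR_prod this] show ?thesis by simp
  qed
  then show ?thesis by (simp add: continuous_on_def)
qed

lemma continuous_on_scaleR_right:
  "continuous_on UNIV (\<lambda>c. c *\<^sub>R (x::'a::locally_convex_space))"
proof -
  have "((\<lambda>c. c *\<^sub>R x) \<longlongrightarrow> c *\<^sub>R x) (at c)" for c
  proof -
    have "((\<lambda>c. (c, x)) \<longlongrightarrow> (c, x)) (at c)" by (intro tendsto_intros)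
    then have "filterlim (\<lambda>c. (c, x)) (nhds c \<times>\<^sub>F nhds x) (at c)" by (simp add: nhds_prod)
    from filterlim_compose[OF tendsto_scaleR_prod this] show ?thesis by simp
  qed
  then show ?thesis by (simp add: continuous_on_def)
qed

lemma vn_bounded_linear_image:
  fixes f :: "'a::locally_convex_space \<Rightarrow> 'b::locally_convex_space"
  assumes "linear f" "continuous_on UNIV f" "vn_bounded B"
  shows "vn_bounded (f ` B)"
  unfolding vn_bounded_def
proof (intro allI impI)
  fix U :: "'b set" assume "open U" "0 \<in> U"
  then have "open (f -` U)" "0 \<in> f -` U"
    using assms by (auto intro: open_vimage simp: linear_0)
  with assms(3) obtain r where "r > 0" "\<And>t x. \<bar>t\<bar> \<le> r \<Longrightarrow> x \<in> B \<Longrightarrow> t *\<^sub>R x \<in> f -` U"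
    unfolding vn_bounded_def by meson
  then show "\<exists>r>0. \<forall>t. \<bar>t\<bar> \<le> r \<longrightarrow> (\<forall>y\<in>f ` B. t *\<^sub>R y \<in> U)"
    using assms(1) by (intro exI[of _ r]) (auto simp: linear_scale)
qed

text \<open>Evaluation is in general only separately continuous on the product of the dual and the space, so
  continuity of \<open>\<langle>A f, f\<rangle>\<close> in \<open>f\<close> is not immediate.  What the strong topology gives directly is boundedness
  on bounded sets.\<close>

lemma operator_bounded_on_bounded:
  fixes A :: "'s::locally_convex_space \<Rightarrow> 's dual"
  assumes "linear A" "continuous_on UNIV A" "vn_bounded B"
  shows "\<exists>M. \<forall>x\<in>B. \<forall>y\<in>B. \<bar>dual_apply (A x) y\<bar> \<le> M"
proof -
  have "\<forall>\<^sub>F v in nhds 0. \<forall>y\<in>B. \<bar>dual_apply v y - dual_apply 0 y\<bar> < 1"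
    using assms(3) by (rule eventually_dual_ball) simp
  then obtain U where U: "open U" "0 \<in> U" "\<And>v y. v \<in> U \<Longrightarrow> y \<in> B \<Longrightarrow> \<bar>dual_apply v y\<bar> < 1"
    unfolding eventually_nhds by (auto simp: dual_apply_rep)
  have "vn_bounded (A ` B)" using assms by (rule vn_bounded_linear_image)
  with U(1,2) obtain r where r: "r > 0" "\<And>x. x \<in> B \<Longrightarrow> r *\<^sub>R A x \<in> U"
    unfolding vn_bounded_def by (metis abs_of_pos imageI order_refl)
  have "\<bar>dual_apply (A x) y\<bar> \<le> 1 / r" if "x \<in> B" "y \<in> B" for x y
    using U(3)[OF r(2)[OF that(1)] that(2)] r(1) by (simp add: dual_apply_rep abs_mult field_simps)
  then show ?thesis by blast
qed

lemma evaluation_is_dual: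
  "dual_apply (Dual (\<lambda>u :: 's::locally_convex_space dual. dual_apply u x)) = (\<lambda>u. dual_apply u x)"
proof (rule dual_apply_Dual)
  show "linear (\<lambda>u. dual_apply u x)" by (simp add: linear_iff dual_apply_rep)
  have "((\<lambda>u. dual_apply u x) \<longlongrightarrow> dual_apply v x) (at v)" for v :: "'s dual"
  proof (rule tendstoI)
    fix e :: real assume "e > 0"
    from eventually_dual_ball[OF vn_bounded_singleton this, of x v]
    show "\<forall>\<^sub>F u in at v. dist (dual_apply u x) (dual_apply v x) < e"
      by (simp add: dist_real_def eventually_nhds_conv_at)
  qed
  then show "continuous_on UNIV (\<lambda>u :: 's dual. dual_apply u x)" by (simp add: continuous_on_def)
qed

text \<open>The polar of \<open>K\<close> in the bidual is a neighbourhood of \<open>0\<close> by definition of the strong topology.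
  By reflexivity the canonical map into the bidual is continuous, and the preimage of the polar is the
  required neighbourhood.\<close>

lemma bounded_set_of_functionals_equicontinuous:
  fixes K :: "'s::locally_convex_space dual set"
  assumes refl: "reflexive_space TYPE('s)" and K: "vn_bounded K"
  shows "\<exists>U. open U \<and> 0 \<in> U \<and> (\<forall>f\<in>U. \<forall>u\<in>K. \<bar>dual_apply u f\<bar> < 1)"
proof -
  let ?E = "\<lambda>x::'s. Dual (\<lambda>u. dual_apply u x)"
  have cont: "continuous_on UNIV ?E"
    using refl unfolding reflexive_space_def homeomorphism_def by blast
  have E0: "?E 0 = 0"
    by (rule dual_eqI) (subst evaluation_is_dual, simp add: dual_apply_simps zero_dual.rep_eq)
  have "\<forall>\<^sub>F w in nhds (0 :: 's dual dual). \<forall>u\<in>K. \<bar>dual_apply w u - dual_apply 0 u\<bar> < 1"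
    using K by (rule eventually_dual_ball) simp
  then obtain W where W: "open W" "0 \<in> W" "\<And>w u. w \<in> W \<Longrightarrow> u \<in> K \<Longrightarrow> \<bar>dual_apply w u\<bar> < 1"
    unfolding eventually_nhds by (auto simp: zero_dual.rep_eq)
  have "\<bar>dual_apply u f\<bar> < 1" if "f \<in> ?E -` W" "u \<in> K" for f u
    using W(3)[of "?E f" u] that by (simp add: evaluation_is_dual)
  moreover have "open (?E -` W)" using W(1) cont by (rule open_vimage)
  moreover have "0 \<in> ?E -` W" using W(2) E0 by simp
  ultimately show ?thesis by blast
qed

section \<open>Completing a continuous form inside the dual\<close>

locale continuous_form = ip_space UNIV b
  for b :: "'s::locally_convex_space \<Rightarrow> 's \<Rightarrow> real" +
  assumes norm_nbhd: "\<exists>U. open U \<and> 0 \<in> U \<and> (\<forall>f\<in>U. b f f \<le> 1)"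
begin

text \<open>A linear functional is continuous once it is small on a neighbourhood of \<open>0\<close>; here a multiple of the
  neighbourhood on which the norm is at most \<open>1\<close>.\<close>

lemma norm_bounded_functional_continuous:
  assumes lin: "linear l" and C: "\<And>f. \<bar>l f\<bar> \<le> C * nrm f"
  shows "continuous_on UNIV l"
proof -
  obtain U where U: "open U" "0 \<in> U" "\<And>f. f \<in> U \<Longrightarrow> b f f \<le> 1" using norm_nbhd by blast
  define D where "D = \<bar>C\<bar> + 1"
  have D: "D > 0" "\<And>f. \<bar>l f\<bar> \<le> D * nrm f"
    unfolding D_def
  proof -
    fix f
    have "\<bar>l f\<bar> \<le> C * nrm f" by (rule C)
    also have "\<dots> \<le> (\<bar>C\<bar> + 1) * nrm f" by (intro mult_right_mono) auto
    finally show "\<bar>l f\<bar> \<le> (\<bar>C\<bar> + 1) * nrm f" .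
  qed auto
  have "(l \<longlongrightarrow> l x) (at x)" for x
  proof (rule tendstoI)
    fix e :: real assume e: "e > 0"
    define g where "g y = (2 * D / e) *\<^sub>R (y - x)" for y
    have "continuous_on UNIV (\<lambda>y. y - x)"
      unfolding continuous_on_def by (intro ballI tendsto_diff tendsto_ident_at tendsto_const)
    then have "continuous_on UNIV g"
      unfolding g_def by (rule continuous_on_compose2[OF continuous_on_scaleR_left]) auto
    then have "open (g -` U)" using U(1) by (intro open_vimage)
    moreover have "x \<in> g -` U" using U(2) by (simp add: g_def)
    ultimately have "\<forall>\<^sub>F y in at x. y \<in> g -` U"
      by (intro eventually_at_in_open') auto
    then show "\<forall>\<^sub>F y in at x. dist (l y) (l x) < e"
    proof eventually_elim
      case (elim y)
      have "nrm (g y) \<le> 1"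
        using U(3)[of "g y"] elim by (simp add: ip_norm_def)
      then have "D * nrm (y - x) * 2 \<le> e"
        using e D(1) unfolding g_def nrm_scaleR[OF UNIV_I] by (simp add: abs_mult field_simps)
      moreover have "\<bar>l (y - x)\<bar> \<le> D * nrm (y - x)" by (rule D(2))
      ultimately show ?case using e lin by (simp add: dist_real_def linear_diff)
    qed
  qed
  then show ?thesis by (simp add: continuous_on_def)
qed

lemma norm_bounded_functional_is_dual:
  assumes "linear l" "\<And>f. \<bar>l f\<bar> \<le> C * nrm f"
  shows "dual_apply (Dual l) = l"
  using assms by (intro dual_apply_Dual norm_bounded_functional_continuous)

definition bounded_dual :: "'s dual set" where
  "bounded_dual = {u. \<exists>C. \<forall>f. \<bar>dual_apply u f\<bar> \<le> C * nrm f}"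

definition to_dual :: "'s \<Rightarrow> 's dual" where
  "to_dual f = Dual (b f)"

lemma dual_apply_to_dual [simp]: "dual_apply (to_dual f) = b f"
  unfolding to_dual_def
  by (rule norm_bounded_functional_is_dual[where C = "nrm f"])
     (auto simp: linear_iff ip_linear_right cauchy_schwarz)

lemma to_dual_in [simp]: "to_dual f \<in> bounded_dual"
  using cauchy_schwarz[of f] by (auto simp: bounded_dual_def)

lemma subspace_bounded_dual: "subspace bounded_dual"
  unfolding subspace_def
proof (intro conjI allI impI ballI)
  show "0 \<in> bounded_dual"
    by (auto simp: bounded_dual_def dual_apply_rep intro: exI[of _ 0])
next
  fix u v assume "u \<in> bounded_dual" "v \<in> bounded_dual"
  then obtain C D where "\<And>f. \<bar>dual_apply u f\<bar> \<le> C * nrm f" "\<And>f. \<bar>dual_apply v f\<bar> \<le> D * nrm f"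
    by (auto simp: bounded_dual_def)
  then have "\<bar>dual_apply (u + v) f\<bar> \<le> (C + D) * nrm f" for f
    unfolding dual_apply_rep distrib_right by (meson abs_triangle_ineq add_mono order_trans)
  then show "u + v \<in> bounded_dual" by (auto simp: bounded_dual_def)
next
  fix u and c :: real assume "u \<in> bounded_dual"
  then obtain C where "\<And>f. \<bar>dual_apply u f\<bar> \<le> C * nrm f" by (auto simp: bounded_dual_def)
  then have "\<bar>dual_apply (c *\<^sub>R u) f\<bar> \<le> (\<bar>c\<bar> * C) * nrm f" for f
    by (simp add: dual_apply_rep abs_mult mult.assoc mult_left_mono)
  then show "c *\<^sub>R u \<in> bounded_dual" by (auto simp: bounded_dual_def)
qed

lemma bounded_functional_dual_apply: "u \<in> bounded_dual \<Longrightarrow> bounded_functional_on UNIV b (dual_apply u)"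
  by (auto simp: bounded_dual_def bounded_functional_on_def linear_on_def dual_apply_simps)

text \<open>A Cauchy sequence in the uncompleted space that represents \<open>u\<close>.  The choice is immaterial, as the
  limits defining the inner product turn out to depend on the functionals only.\<close>

definition approximant :: "'s dual \<Rightarrow> nat \<Rightarrow> 's" where
  "approximant u = (SOME g. cauchy g \<and> (\<forall>f. (\<lambda>n. b (g n) f) \<longlonglongrightarrow> dual_apply u f))"

lemma approximant:
  assumes "u \<in> bounded_dual"
  shows "cauchy (approximant u)" "(\<lambda>n. b (approximant u n) f) \<longlonglongrightarrow> dual_apply u f"
proof -
  have "\<exists>g. cauchy g \<and> (\<forall>f. (\<lambda>n. b (g n) f) \<longlonglongrightarrow> dual_apply u f)"
    using bounded_functional_is_limit[OF bounded_functional_dual_apply[OF assms]] by auto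
  from someI_ex[OF this] show "cauchy (approximant u)" "(\<lambda>n. b (approximant u n) f) \<longlonglongrightarrow> dual_apply u f"
    by (auto simp: approximant_def)
qed

text \<open>The representing sequence converges to \<open>u\<close> in the dual norm: the Cauchy estimate holds uniformly
  over the unit ball, and one index is sent to infinity.\<close>

lemma approximant_uniform:
  assumes "u \<in> bounded_dual" "e > 0"
  shows "\<exists>M. \<forall>n\<ge>M. \<forall>f. \<bar>b (approximant u n) f - dual_apply u f\<bar> \<le> e * nrm f"
proof -
  from cauchyD[OF approximant(1)[OF assms(1)] assms(2)] obtain M
    where M: "\<And>m n. m \<ge> M \<Longrightarrow> n \<ge> M \<Longrightarrow> nrm (approximant u m - approximant u n) < e" by blast
  have "\<bar>b (approximant u n) f - dual_apply u f\<bar> \<le> e * nrm f" if n: "n \<ge> M" for n f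
  proof (rule tendsto_upperbound)
    show "(\<lambda>m. \<bar>b (approximant u n) f - b (approximant u m) f\<bar>) \<longlonglongrightarrow> \<bar>b (approximant u n) f - dual_apply u f\<bar>"
      by (intro tendsto_intros approximant assms)
    have "\<bar>b (approximant u n) f - b (approximant u m) f\<bar> \<le> e * nrm f" if "m \<ge> M" for m
    proof -
      have "\<bar>b (approximant u n - approximant u m) f\<bar> \<le> nrm (approximant u n - approximant u m) * nrm f"
        by (simp add: cauchy_schwarz)
      also have "\<dots> \<le> e * nrm f" using M[OF n that] by (intro mult_right_mono) auto
      finally show ?thesis by (simp add: ip_diff)
    qed
    then show "\<forall>\<^sub>F m in sequentially. \<bar>b (approximant u n) f - b (approximant u m) f\<bar> \<le> e * nrm f"
      by (auto simp: eventually_sequentially)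
  qed simp
  then show ?thesis by blast
qed

lemma cauchy_bounded:
  assumes "cauchy X"
  shows "\<exists>B\<ge>0. \<forall>n. nrm (X n) \<le> B"
proof -
  from cauchyD[OF assms, of 1] obtain M where M: "\<And>m n. m \<ge> M \<Longrightarrow> n \<ge> M \<Longrightarrow> nrm (X m - X n) < 1"
    by auto
  let ?B = "(\<Sum>n<M. nrm (X n)) + (nrm (X M) + 1)"
  have "nrm (X n) \<le> ?B" for n
  proof (cases "n < M")
    case True
    then have "nrm (X n) \<le> (\<Sum>n<M. nrm (X n))" by (intro member_le_sum) auto
    then show ?thesis by (simp add: add_increasing2)
  next
    case False
    then have "nrm (X n) \<le> nrm (X M) + 1"
      using M[of n M] nrm_triangle[of "X n - X M" "X M"] by simp
    then show ?thesis by (simp add: add_increasing sum_nonneg)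
  qed
  moreover have "?B \<ge> 0" by (intro add_nonneg_nonneg sum_nonneg) auto
  ultimately show ?thesis by blast
qed

definition dual_ip :: "'s dual \<Rightarrow> 's dual \<Rightarrow> real" where
  "dual_ip u v = lim (\<lambda>n. dual_apply v (approximant u n))"

lemma dual_ip_limit:
  assumes u: "u \<in> bounded_dual" and v: "v \<in> bounded_dual"
  shows "(\<lambda>n. dual_apply v (approximant u n)) \<longlonglongrightarrow> dual_ip u v"
proof -
  obtain C where C: "\<And>f. \<bar>dual_apply v f\<bar> \<le> C * nrm f" using v by (auto simp: bounded_dual_def)
  have "Cauchy (\<lambda>n. dual_apply v (approximant u n))"
  proof (rule CauchyI)
    fix e :: real assume e: "e > 0"
    then have "e / (\<bar>C\<bar> + 1) > 0" by simp
    from cauchyD[OF approximant(1)[OF u] this] obtain M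
      where M: "\<And>m n. m \<ge> M \<Longrightarrow> n \<ge> M \<Longrightarrow> nrm (approximant u m - approximant u n) < e / (\<bar>C\<bar> + 1)" by blast
    have "norm (dual_apply v (approximant u m) - dual_apply v (approximant u n)) < e" if "m \<ge> M" "n \<ge> M" for m n
    proof -
      have "\<bar>dual_apply v (approximant u m - approximant u n)\<bar> \<le> C * nrm (approximant u m - approximant u n)" by (rule C)
      also have "\<dots> \<le> (\<bar>C\<bar> + 1) * nrm (approximant u m - approximant u n)" by (intro mult_right_mono) auto
      also have "\<dots> < (\<bar>C\<bar> + 1) * (e / (\<bar>C\<bar> + 1))"
        using M[OF that] by (intro mult_strict_left_mono) auto
      finally show ?thesis by (simp add: dual_apply_diff)
    qed
    then show "\<exists>M. \<forall>m\<ge>M. \<forall>n\<ge>M. norm (dual_apply v (approximant u m) - dual_apply v (approximant u n)) < e" by blast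
  qed
  then show ?thesis unfolding dual_ip_def by (simp add: Cauchy_convergent convergent_LIMSEQ_iff[symmetric])
qed

text \<open>The symmetric description of the inner product.  It follows from the uniform convergence above since
  Cauchy sequences are bounded.\<close>

lemma dual_ip_limit_approximants:
  assumes u: "u \<in> bounded_dual" and v: "v \<in> bounded_dual"
  shows "(\<lambda>n. b (approximant v n) (approximant u n)) \<longlonglongrightarrow> dual_ip u v"
proof -
  obtain B where B: "B \<ge> 0" "\<And>n. nrm (approximant u n) \<le> B" using cauchy_bounded[OF approximant(1)[OF u]] by blast
  have "(\<lambda>n. b (approximant v n) (approximant u n) - dual_apply v (approximant u n)) \<longlonglongrightarrow> 0"
  proof (rule LIMSEQ_I)
    fix e :: real assume e: "e > 0"
    then have "e / (B + 1) > 0" using B by simp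
    from approximant_uniform[OF v this] obtain M where M: "\<And>n f. n \<ge> M \<Longrightarrow>
      \<bar>b (approximant v n) f - dual_apply v f\<bar> \<le> e / (B + 1) * nrm f" by blast
    have "norm (b (approximant v n) (approximant u n) - dual_apply v (approximant u n) - 0) < e" if "n \<ge> M" for n
    proof -
      have "\<bar>b (approximant v n) (approximant u n) - dual_apply v (approximant u n)\<bar> \<le> e / (B + 1) * nrm (approximant u n)"
        by (rule M[OF that])
      also have "\<dots> < e / (B + 1) * (B + 1)"
        using B(1) B(2)[of n] e by (intro mult_strict_left_mono) auto
      finally show ?thesis using B by simp
    qed
    then show "\<exists>M. \<forall>n\<ge>M. norm (b (approximant v n) (approximant u n) - dual_apply v (approximant u n) - 0) < e" by blast
  qed
  from tendsto_add[OF this dual_ip_limit[OF u v]] show ?thesis by simp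
qed

lemma dual_ip_commute: "u \<in> bounded_dual \<Longrightarrow> v \<in> bounded_dual \<Longrightarrow> dual_ip u v = dual_ip v u"
  using LIMSEQ_unique[OF dual_ip_limit_approximants[of u v]] dual_ip_limit_approximants[of v u]
  by (simp add: ip_commute)

lemma dual_ip_nonneg: "u \<in> bounded_dual \<Longrightarrow> 0 \<le> dual_ip u u"
  using dual_ip_limit_approximants[of u u] by (rule LIMSEQ_le_const) (auto simp: ip_self_nonneg)

lemma nrm_approximant_limit: "u \<in> bounded_dual \<Longrightarrow> (\<lambda>n. nrm (approximant u n)) \<longlonglongrightarrow> ip_norm dual_ip u"
  using tendsto_real_sqrt[OF dual_ip_limit_approximants[of u u]] by (simp add: ip_norm_def)

lemma dual_apply_le:
  assumes "u \<in> bounded_dual"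
  shows "\<bar>dual_apply u f\<bar> \<le> ip_norm dual_ip u * nrm f"
proof (rule LIMSEQ_le)
  show "(\<lambda>n. \<bar>b (approximant u n) f\<bar>) \<longlonglongrightarrow> \<bar>dual_apply u f\<bar>"
    by (intro tendsto_intros approximant assms)
  show "(\<lambda>n. nrm (approximant u n) * nrm f) \<longlonglongrightarrow> ip_norm dual_ip u * nrm f"
    by (intro tendsto_intros nrm_approximant_limit assms)
qed (simp add: cauchy_schwarz)

text \<open>Together with \<open>dual_apply_le\<close>, the norm of the inner product is the dual norm.  This turns pointwise
  estimates on functionals into convergence.\<close>

lemma dual_norm_le:
  assumes u: "u \<in> bounded_dual" and C: "\<And>f. \<bar>dual_apply u f\<bar> \<le> C * nrm f" "C \<ge> 0"
  shows "ip_norm dual_ip u \<le> C"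
proof -
  have "dual_ip u u \<le> C * ip_norm dual_ip u"
  proof (rule LIMSEQ_le)
    show "(\<lambda>n. dual_apply u (approximant u n)) \<longlonglongrightarrow> dual_ip u u" by (rule dual_ip_limit[OF u u])
    show "(\<lambda>n. C * nrm (approximant u n)) \<longlonglongrightarrow> C * ip_norm dual_ip u"
      by (intro tendsto_intros nrm_approximant_limit u)
  qed (use C(1) in \<open>auto simp: abs_le_iff\<close>)
  then have "ip_norm dual_ip u * ip_norm dual_ip u \<le> C * ip_norm dual_ip u"
    using dual_ip_nonneg[OF u] by (simp add: ip_norm_def)
  then show ?thesis
    using C(2) dual_ip_nonneg[OF u] mult_right_le_imp_le[of "ip_norm dual_ip u" "ip_norm dual_ip u" C]
    by (cases "ip_norm dual_ip u = 0") (auto simp: ip_norm_def less_le)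
qed

lemma inner_product_dual: "inner_product_on bounded_dual dual_ip"
  unfolding inner_product_on_def
proof (intro conjI ballI impI)
  have right: "dual_ip u (v + w) = dual_ip u v + dual_ip u w" "dual_ip u (c *\<^sub>R v) = c * dual_ip u v"
    if "u \<in> bounded_dual" "v \<in> bounded_dual" "w \<in> bounded_dual" for u v w c
  proof -
    have *: "v + w \<in> bounded_dual" "c *\<^sub>R v \<in> bounded_dual"
      using that subspace_bounded_dual by (auto simp: subspace_add subspace_scale)
    have "(\<lambda>n. dual_apply (v + w) (approximant u n)) \<longlonglongrightarrow> dual_ip u v + dual_ip u w"
      unfolding dual_apply_rep by (intro tendsto_intros dual_ip_limit that)
    with dual_ip_limit[OF that(1) *(1)] show "dual_ip u (v + w) = dual_ip u v + dual_ip u w"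
      by (rule LIMSEQ_unique)
    have "(\<lambda>n. dual_apply (c *\<^sub>R v) (approximant u n)) \<longlonglongrightarrow> c * dual_ip u v"
      unfolding dual_apply_rep by (intro tendsto_intros dual_ip_limit that)
    with dual_ip_limit[OF that(1) *(2)] show "dual_ip u (c *\<^sub>R v) = c * dual_ip u v"
      by (rule LIMSEQ_unique)
  qed
  show "linear_on bounded_dual (\<lambda>u. dual_ip u w)" if "w \<in> bounded_dual" for w
    unfolding linear_on_def
    using that right subspace_bounded_dual
    by (auto simp: subspace_add subspace_scale dual_ip_commute[of _ w])
  fix u assume u: "u \<in> bounded_dual" "u \<noteq> 0"
  have "dual_ip u u \<noteq> 0"
  proof
    assume "dual_ip u u = 0"
    then have "\<bar>dual_apply u f\<bar> \<le> 0" for f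
      using dual_apply_le[OF u(1), of f] by (simp add: ip_norm_def)
    then have "u = 0" by (intro dual_eqI) (simp add: zero_dual.rep_eq)
    with u show False by simp
  qed
  with dual_ip_nonneg[OF u(1)] show "0 < dual_ip u u" by simp
qed (auto intro: dual_ip_commute subspace_bounded_dual)

sublocale D: ip_space bounded_dual dual_ip
  by standard (rule inner_product_dual)

text \<open>As for every normed dual: a Cauchy sequence converges pointwise, the limit is linear and
  norm-bounded, hence belongs to the dual, and the convergence is uniform on the unit ball.\<close>

lemma hilbert_bounded_dual: "hilbert_space_on bounded_dual dual_ip"
  unfolding D.hilbert_iff
proof (intro allI impI)
  fix X assume X: "D.cauchy X"
  then have in_D: "X n \<in> bounded_dual" for n by (rule D.cauchy_in_V)
  have pointwise: "\<bar>dual_apply (X m) f - dual_apply (X n) f\<bar> \<le> D.nrm (X m - X n) * nrm f" for m n f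
    using dual_apply_le[of "X m - X n" f] in_D by (simp add: dual_apply_rep)
  have "Cauchy (\<lambda>n. dual_apply (X n) f)" for f
  proof (rule CauchyI)
    fix e :: real assume e: "e > 0"
    then have "e / (nrm f + 1) > 0" by (simp add: add_nonneg_pos)
    from D.cauchyD[OF X this] obtain M
      where M: "\<And>m n. m \<ge> M \<Longrightarrow> n \<ge> M \<Longrightarrow> D.nrm (X m - X n) < e / (nrm f + 1)" by blast
    have "norm (dual_apply (X m) f - dual_apply (X n) f) < e" if "m \<ge> M" "n \<ge> M" for m n
    proof -
      have "norm (dual_apply (X m) f - dual_apply (X n) f) \<le> D.nrm (X m - X n) * nrm f"
        using pointwise by simp
      also have "\<dots> \<le> e / (nrm f + 1) * nrm f"
        using M[OF that] by (intro mult_right_mono) auto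
      also have "\<dots> < e / (nrm f + 1) * (nrm f + 1)"
        using e by (intro mult_strict_left_mono) (auto simp: add_nonneg_pos)
      finally show ?thesis by (simp add: add_nonneg_eq_0_iff)
    qed
    then show "\<exists>M. \<forall>m\<ge>M. \<forall>n\<ge>M. norm (dual_apply (X m) f - dual_apply (X n) f) < e" by blast
  qed
  then have lim: "(\<lambda>n. dual_apply (X n) f) \<longlonglongrightarrow> lim (\<lambda>n. dual_apply (X n) f)" for f
    by (simp add: Cauchy_convergent convergent_LIMSEQ_iff[symmetric])
  define l where "l f = lim (\<lambda>n. dual_apply (X n) f)" for f
  note lim = lim[folded l_def]
  have lin: "linear l"
  proof (rule linearI)
    fix f g
    have "(\<lambda>n. dual_apply (X n) (f + g)) \<longlonglongrightarrow> l f + l g"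
      unfolding dual_apply_simps by (intro tendsto_intros lim)
    with lim[of "f + g"] show "l (f + g) = l f + l g" by (rule LIMSEQ_unique)
  next
    fix c f
    have "(\<lambda>n. dual_apply (X n) (c *\<^sub>R f)) \<longlonglongrightarrow> c * l f"
      unfolding dual_apply_simps by (intro tendsto_intros lim)
    with lim[of "c *\<^sub>R f"] show "l (c *\<^sub>R f) = c *\<^sub>R l f" by (auto intro: LIMSEQ_unique)
  qed
  have uniform: "\<exists>M. \<forall>n\<ge>M. \<forall>f. \<bar>dual_apply (X n) f - l f\<bar> \<le> e * nrm f" if "e > 0" for e
  proof -
    from D.cauchyD[OF X that] obtain M
      where M: "\<And>m n. m \<ge> M \<Longrightarrow> n \<ge> M \<Longrightarrow> D.nrm (X m - X n) < e" by blast
    have "\<bar>dual_apply (X n) f - l f\<bar> \<le> e * nrm f" if n: "n \<ge> M" for n f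
    proof (rule tendsto_upperbound)
      show "(\<lambda>m. \<bar>dual_apply (X n) f - dual_apply (X m) f\<bar>) \<longlonglongrightarrow> \<bar>dual_apply (X n) f - l f\<bar>"
        by (intro tendsto_intros lim)
      have "\<bar>dual_apply (X n) f - dual_apply (X m) f\<bar> \<le> e * nrm f" if "m \<ge> M" for m
        using pointwise[of n f m] M[OF n that] mult_right_mono[of "D.nrm (X n - X m)" e "nrm f"] by simp
      then show "\<forall>\<^sub>F m in sequentially. \<bar>dual_apply (X n) f - dual_apply (X m) f\<bar> \<le> e * nrm f"
        by (auto simp: eventually_sequentially)
    qed simp
    then show ?thesis by blast
  qed
  obtain M where M: "\<And>f. \<bar>dual_apply (X M) f - l f\<bar> \<le> 1 * nrm f"
    using uniform[of 1] by (metis order_refl zero_less_one)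
  have l_bound: "\<bar>l f\<bar> \<le> (1 + D.nrm (X M)) * nrm f" for f
    using M[of f] dual_apply_le[OF in_D, of M f] by (simp add: distrib_right)
  define u where "u = Dual l"
  have u: "dual_apply u = l"
    unfolding u_def using lin l_bound by (rule norm_bounded_functional_is_dual)
  have u_in: "u \<in> bounded_dual"
    using l_bound by (auto simp: bounded_dual_def u intro!: exI[of _ "1 + D.nrm (X M)"])
  have "(\<lambda>n. D.nrm (X n - u)) \<longlonglongrightarrow> 0"
  proof (rule LIMSEQ_I)
    fix e :: real assume e: "e > 0"
    then obtain M where M: "\<And>n f. n \<ge> M \<Longrightarrow> \<bar>dual_apply (X n) f - l f\<bar> \<le> e / 2 * nrm f"
      using uniform[of "e / 2"] by auto
    have "norm (D.nrm (X n - u) - 0) < e" if "n \<ge> M" for n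
    proof -
      have "D.nrm (X n - u) \<le> e / 2"
        using M[OF that] in_D u_in e by (intro dual_norm_le) (auto simp: dual_apply_rep u)
      then show ?thesis using e in_D u_in by simp
    qed
    then show "\<exists>M. \<forall>n\<ge>M. norm (D.nrm (X n - u) - 0) < e" by blast
  qed
  then show "\<exists>u. D.converges X u sequentially"
    using in_D u_in by (auto simp: D.converges_def)
qed

lemma dual_ip_to_dual:
  assumes "v \<in> bounded_dual"
  shows "dual_ip (to_dual f) v = dual_apply v f"
proof -
  have "(\<lambda>n. b f (approximant v n)) \<longlonglongrightarrow> dual_ip v (to_dual f)"
    using dual_ip_limit[OF assms to_dual_in[of f]] by simp
  moreover have "(\<lambda>n. b f (approximant v n)) \<longlonglongrightarrow> dual_apply v f"
    using approximant(2)[OF assms, of f] by (simp add: ip_commute[of f])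
  ultimately show ?thesis
    using assms by (simp add: LIMSEQ_unique dual_ip_commute[of _ v])
qed

lemma completion_in_dual: "hilbert_completion UNIV b to_dual bounded_dual dual_ip"
  unfolding hilbert_completion_def
proof (intro conjI ballI)
  show "linear_on UNIV to_dual"
    by (auto simp: linear_on_def dual_apply_rep ip_linear_left intro!: dual_eqI)
  show "dual_ip (to_dual f) (to_dual g) = b f g" for f g
    by (simp add: dual_ip_to_dual ip_commute)
  have "\<exists>f. D.nrm (to_dual f - u) < e" if u: "u \<in> bounded_dual" and e: "e > 0" for u e
  proof -
    obtain M where M: "\<And>f. \<bar>b (approximant u M) f - dual_apply u f\<bar> \<le> e / 2 * nrm f"
      using approximant_uniform[OF u, of "e / 2"] e by auto
    have "D.nrm (to_dual (approximant u M) - u) \<le> e / 2"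
      using M e u by (intro dual_norm_le) (auto simp: dual_apply_rep)
    with e show ?thesis by (intro exI[of _ "approximant u M"]) simp
  qed
  then show "ip_closure bounded_dual dual_ip (range to_dual) = bounded_dual"
    by (subst D.ip_closure_eq) auto
qed (auto simp: hilbert_bounded_dual)

end

section \<open>The corrected form\<close>

lemma continuous_on_sum_lcs:
  fixes f :: "'i \<Rightarrow> 'a::topological_space \<Rightarrow> 'b::locally_convex_space"
  assumes "\<And>i. i \<in> I \<Longrightarrow> continuous_on S (f i)"
  shows "continuous_on S (\<lambda>x. \<Sum>i\<in>I. f i x)"
  using assms
proof (induction I rule: infinite_finite_induct)
  case (insert i I)
  then have "continuous_on S (f i)" "continuous_on S (\<lambda>x. \<Sum>i\<in>I. f i x)" by auto
  then have "continuous_on S (\<lambda>x. f i x + (\<Sum>i\<in>I. f i x))"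
    unfolding continuous_on_def by (intro ballI tendsto_add) auto
  with insert show ?case by simp
qed auto

text \<open>The functionals represented by the unit ball are bounded in the strong dual, because the norm is
  bounded on bounded sets, and hence equicontinuous.  As they recover the norm as a supremum, the norm is
  bounded on a neighbourhood of \<open>0\<close>.\<close>

lemma form_continuous_if_bounded_on_bounded:
  fixes b :: "'s::locally_convex_space \<Rightarrow> 's \<Rightarrow> real" and L :: "'s \<Rightarrow> 's dual"
  assumes refl: "reflexive_space TYPE('s)"
    and ip: "inner_product_on UNIV b"
    and L: "\<And>f. dual_apply (L f) = b f"
    and bounded: "\<And>B. vn_bounded B \<Longrightarrow> \<exists>M. \<forall>x\<in>B. b x x \<le> M"
  shows "\<exists>U. open U \<and> 0 \<in> U \<and> (\<forall>f\<in>U. b f f \<le> 1)"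
proof -
  interpret ip_space UNIV b by standard (rule ip)
  define K where "K = L ` {g. nrm g \<le> 1}"
  have "vn_bounded K"
    unfolding vn_bounded_def
  proof (intro allI impI)
    fix U :: "'s dual set" assume "open U" "0 \<in> U"
    then have "\<forall>\<^sub>F v in nhds 0. v \<in> U" by (rule eventually_nhds_in_open)
    then obtain B e where B: "vn_bounded B" "0 < e"
      and U: "\<And>v. (\<forall>x\<in>B. \<bar>dual_apply v x\<bar> < e) \<Longrightarrow> v \<in> U"
      unfolding eventually_nhds_uniformity eventually_uniformity_dual
      by (auto simp: dual_apply_rep)
    obtain M where M: "\<And>x. x \<in> B \<Longrightarrow> b x x \<le> M" using bounded[OF B(1)] by blast
    define D where "D = sqrt \<bar>M\<bar> + 1"
    have D: "D > 0" by (simp add: D_def add_nonneg_pos)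
    have nrm_B: "nrm x < D" if "x \<in> B" for x
    proof -
      have "nrm x \<le> sqrt \<bar>M\<bar>" using M[OF that] by (auto simp: ip_norm_def)
      then show ?thesis by (simp add: D_def)
    qed
    have "t *\<^sub>R L g \<in> U" if t: "\<bar>t\<bar> \<le> e / D" and g: "nrm g \<le> 1" for t g
    proof (rule U, intro ballI)
      fix x assume x: "x \<in> B"
      have "\<bar>b g x\<bar> \<le> nrm g * nrm x" by (simp add: cauchy_schwarz)
      also have "\<dots> \<le> 1 * nrm x" using g by (intro mult_right_mono) auto
      also have "\<dots> < D" using nrm_B[OF x] by simp
      finally have "\<bar>b g x\<bar> < D" .
      have "\<bar>t\<bar> * \<bar>b g x\<bar> \<le> e / D * \<bar>b g x\<bar>" using t by (intro mult_right_mono) auto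
      also have "\<dots> < e / D * D" using B(2) D \<open>\<bar>b g x\<bar> < D\<close> by (intro mult_strict_left_mono) auto
      finally show "\<bar>dual_apply (t *\<^sub>R L g) x\<bar> < e" using D by (simp add: dual_apply_rep L abs_mult)
    qed
    then show "\<exists>r>0. \<forall>t. \<bar>t\<bar> \<le> r \<longrightarrow> (\<forall>u\<in>K. t *\<^sub>R u \<in> U)"
      using B(2) D by (intro exI[of _ "e / D"]) (auto simp: K_def)
  qed
  from bounded_set_of_functionals_equicontinuous[OF refl this]
  obtain U where U: "open U" "0 \<in> U" "\<And>f u. f \<in> U \<Longrightarrow> u \<in> K \<Longrightarrow> \<bar>dual_apply u f\<bar> < 1" by blast
  have "b f f \<le> 1" if f: "f \<in> U" for f
  proof (cases "f = 0")
    case False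
    then have pos: "nrm f > 0" using nrm_nonneg[of f] nrm_eq_0[of f] by (simp add: less_le)
    define g where "g = (1 / nrm f) *\<^sub>R f"
    have "L g \<in> K" using pos by (simp add: K_def g_def nrm_scaleR)
    from U(3)[OF f this] have "\<bar>b f f / nrm f\<bar> < 1" by (simp add: L g_def ip_linear_left)
    moreover have "b f f = nrm f * nrm f" using nrm_power2[of f] by (simp add: power2_eq_square)
    ultimately have "nrm f < 1" using pos False by simp
    then have "nrm f * nrm f \<le> 1 * 1" using pos by (intro mult_mono) auto
    then show ?thesis by (simp add: \<open>b f f = nrm f * nrm f\<close>)
  qed simp
  with U show ?thesis by blast
qed

text \<open>This is \<open>Id - R\<^sub>\<phi> R\<^sub>p\<close> for a biorthogonal system; see the proof of \<open>dual_apply_corrected\<close>.\<close>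

definition test_proj :: "nat \<Rightarrow> (nat \<Rightarrow> 's::locally_convex_space dual) \<Rightarrow> (nat \<Rightarrow> 's) \<Rightarrow> 's \<Rightarrow> 's" where
  "test_proj N p \<eta> f = f - (\<Sum>n\<in>{1..N}. dual_apply (p n) f *\<^sub>R \<eta> n)"

lemma linear_test_proj: "linear (test_proj N p \<eta>)"
  by (rule linearI)
    (simp_all add: test_proj_def dual_apply_simps algebra_simps sum.distrib scaleR_sum_right)

lemma continuous_test_proj: "continuous_on UNIV (test_proj N p \<eta>)"
proof -
  have "continuous_on UNIV (\<lambda>f. dual_apply (p n) f *\<^sub>R \<eta> n)" for n
    by (rule continuous_on_compose2[OF continuous_on_scaleR_right continuous_dual_apply]) auto
  then have "continuous_on UNIV (\<lambda>f. \<Sum>n\<in>{1..N}. dual_apply (p n) f *\<^sub>R \<eta> n)"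
    by (intro continuous_on_sum_lcs)
  then show ?thesis
    unfolding test_proj_def continuous_on_def by (intro ballI tendsto_diff tendsto_ident_at) auto
qed

lemma sum_biorthogonal:
  assumes "biorthogonal pr N p \<eta>" "n \<in> {1..N}"
  shows "(\<Sum>m\<in>{1..N}. r m * pr (p n) (\<eta> m)) = r n" "(\<Sum>m\<in>{1..N}. r m * pr (p m) (\<eta> n)) = (r n :: real)"
proof -
  have "(\<Sum>m\<in>{1..N}. r m * pr (p n) (\<eta> m)) = (\<Sum>m\<in>{1..N}. if m = n then r m else 0)"
    using assms by (intro sum.cong) (auto simp: biorthogonal_def)
  then show "(\<Sum>m\<in>{1..N}. r m * pr (p n) (\<eta> m)) = r n" using assms(2) by simp
  have "(\<Sum>m\<in>{1..N}. r m * pr (p m) (\<eta> n)) = (\<Sum>m\<in>{1..N}. if m = n then r m else 0)"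
    using assms by (intro sum.cong) (auto simp: biorthogonal_def)
  then show "(\<Sum>m\<in>{1..N}. r m * pr (p m) (\<eta> n)) = r n" using assms(2) by simp
qed

lemma p_test_proj:
  assumes "biorthogonal dual_apply N p \<eta>" "n \<in> {1..N}"
  shows "dual_apply (p n) (test_proj N p \<eta> f) = 0"
  using sum_biorthogonal(1)[OF assms]
  by (simp add: test_proj_def dual_apply_diff dual_apply_sum dual_apply_simps)

lemma test_proj_annihilated:
  "biorthogonal dual_apply N p \<eta> \<Longrightarrow> test_proj N p \<eta> f \<in> annihilated p N"
  by (simp add: annihilated_def p_test_proj)

lemma test_proj_fixes: "f \<in> annihilated p N \<Longrightarrow> test_proj N p \<eta> f = f"
  by (simp add: test_proj_def annihilated_def)

text \<open>The left factor of the corrected operator is the transpose of the right one.\<close>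

lemma dual_apply_corrected:
  assumes "biorthogonal dual_apply N p \<eta>"
  shows "dual_apply (corrected A N p \<eta> f) g = dual_apply (A (test_proj N p \<eta> f)) (test_proj N p \<eta> g)"
proof -
  have "dual_apply (R_p dual_apply N p f) (\<eta> n) = dual_apply (p n) f" if "n \<in> {1..N}" for n
    using sum_biorthogonal(2)[OF assms that] by (simp add: R_p_def dual_apply_sum_left dual_apply_rep)
  then have R_phi_R_p: "f - R_phi dual_apply N \<eta> (R_p dual_apply N p f) = test_proj N p \<eta> f"
    unfolding R_phi_def test_proj_def by (intro arg_cong2[where f = minus] refl sum.cong) auto
  have R_p_R_phi: "dual_apply (u - R_p dual_apply N p (R_phi dual_apply N \<eta> u)) g
    = dual_apply u (test_proj N p \<eta> g)" for u
  proof -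
    have "dual_apply (p n) (R_phi dual_apply N \<eta> u) = dual_apply u (\<eta> n)" if "n \<in> {1..N}" for n
      using sum_biorthogonal(1)[OF assms that] by (simp add: R_phi_def dual_apply_sum dual_apply_simps)
    then have "dual_apply (R_p dual_apply N p (R_phi dual_apply N \<eta> u)) g
        = (\<Sum>n\<in>{1..N}. dual_apply (p n) g * dual_apply u (\<eta> n))"
      unfolding R_p_def dual_apply_sum_left by (intro sum.cong) (auto simp: dual_apply_rep)
    then show ?thesis
      by (simp add: dual_apply_rep test_proj_def dual_apply_diff dual_apply_sum dual_apply_simps)
  qed
  show ?thesis by (simp add: corrected_def R_phi_R_p R_p_R_phi)
qed

lemma corrected_form_eq:
  assumes "biorthogonal dual_apply N p \<eta>"
  shows "corrected_form A N p \<eta> f g = dual_apply (A (test_proj N p \<eta> f)) (test_proj N p \<eta> g)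
    + (\<Sum>n\<in>{1..N}. dual_apply (p n) f * dual_apply (p n) g)"
  by (simp add: corrected_form_def dual_apply_rep dual_apply_corrected[OF assms] R_p_def dual_apply_sum_left)

text \<open>The rank part vanishes on annihilated functions and the projection of \<open>\<psi>\<close> fixes them, so there the
  form of \<open>\<psi>\<close> is just the form of \<open>A\<close>, whatever \<open>\<psi>\<close> is.  This makes the form of one fixed system sufficient
  for the description of all corrected operators.\<close>

lemma dual_apply_corrected_eq_form:
  assumes "biorthogonal dual_apply N p \<eta>" "biorthogonal dual_apply N p \<psi>"
  shows "dual_apply (corrected A N p \<eta> f) g
    = corrected_form A N p \<psi> (test_proj N p \<eta> f) (test_proj N p \<eta> g)"
  using test_proj_annihilated[OF assms(1)] p_test_proj[OF assms(1)]
  by (simp add: dual_apply_corrected[OF assms(1)] corrected_form_eq[OF assms(2)] test_proj_fixes)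

context
  fixes A :: "'s::locally_convex_space \<Rightarrow> 's dual" and N p \<psi>
  assumes A: "linear A" "symmetric_operator A" "conditionally_pos_def p N A"
    and biorth: "biorthogonal dual_apply N p \<psi>"
begin

lemma inner_product_corrected_form: "inner_product_on UNIV (corrected_form A N p \<psi>)"
  unfolding inner_product_on_def
proof (intro conjI ballI impI)
  show "corrected_form A N p \<psi> f g = corrected_form A N p \<psi> g f" for f g
    using A(2) unfolding corrected_form_eq[OF biorth] symmetric_operator_def by (simp add: mult.commute)
  show "linear_on UNIV (\<lambda>f. corrected_form A N p \<psi> f g)" for g
    unfolding corrected_form_eq[OF biorth] linear_on_def
    using A(1) linear_test_proj[of N p \<psi>]
    by (simp add: linear_add linear_scale dual_apply_rep dual_apply_simps distrib_right sum.distrib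
        distrib_left sum_distrib_left mult.assoc)
  fix f :: 's assume f: "f \<noteq> 0"
  let ?g = "test_proj N p \<psi> f"
  have sq: "(\<Sum>n\<in>{1..N}. dual_apply (p n) f * dual_apply (p n) f) \<ge> 0" by (intro sum_nonneg) auto
  show "0 < corrected_form A N p \<psi> f f"
  proof (cases "?g = 0")
    case False
    then have "dual_apply (A ?g) ?g > 0"
      using A(3) test_proj_annihilated[OF biorth] by (simp add: conditionally_pos_def_def)
    with sq show ?thesis by (simp add: corrected_form_eq[OF biorth])
  next
    case True
    then have "(\<Sum>n\<in>{1..N}. dual_apply (p n) f *\<^sub>R \<psi> n) = f" by (simp add: test_proj_def)
    with f have "\<exists>n\<in>{1..N}. dual_apply (p n) f \<noteq> 0" by (metis (no_types, lifting) scaleR_zero_left sum.neutral)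
    then have "(\<Sum>n\<in>{1..N}. dual_apply (p n) f * dual_apply (p n) f) \<noteq> 0"
      by (subst sum_nonneg_eq_0_iff) auto
    with sq True A(1) show ?thesis by (simp add: corrected_form_eq[OF biorth] dual_apply_simps)
  qed
qed simp

lemma continuous_corrected_form:
  assumes "reflexive_space TYPE('s)" "continuous_on UNIV A"
  shows "continuous_form (corrected_form A N p \<psi>)"
proof unfold_locales
  let ?L = "\<lambda>f. corrected A N p \<psi> f + R_p dual_apply N p f"
  show "\<exists>U. open U \<and> 0 \<in> U \<and> (\<forall>f\<in>U. corrected_form A N p \<psi> f f \<le> 1)"
  proof (rule form_continuous_if_bounded_on_bounded[OF assms(1) inner_product_corrected_form, of ?L])
    show "dual_apply (?L f) = corrected_form A N p \<psi> f" for f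
      by (simp add: fun_eq_iff corrected_form_def)
    fix B :: "'s set" assume B: "vn_bounded B"
    have "vn_bounded (test_proj N p \<psi> ` B)"
      by (rule vn_bounded_linear_image[OF linear_test_proj continuous_test_proj B])
    then obtain M where M: "\<And>x. x \<in> B \<Longrightarrow> dual_apply (A (test_proj N p \<psi> x)) (test_proj N p \<psi> x) \<le> M"
      using operator_bounded_on_bounded[OF A(1) assms(2)] by (fastforce simp: abs_le_iff)
    have "\<exists>C. \<forall>x\<in>B. \<bar>dual_apply (p n) x\<bar> < C" for n
      using dual_apply_bounded[OF B] by metis
    then obtain C where C: "\<And>n x. x \<in> B \<Longrightarrow> \<bar>dual_apply (p n) x\<bar> < C n" by metis
    have "corrected_form A N p \<psi> x x \<le> M + (\<Sum>n\<in>{1..N}. C n * C n)" if x: "x \<in> B" for x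
    proof -
      have "dual_apply (p n) x * dual_apply (p n) x \<le> C n * C n" for n
        using mult_mono[of "\<bar>dual_apply (p n) x\<bar>" "C n" "\<bar>dual_apply (p n) x\<bar>" "C n"] C[OF x, of n]
        by (simp flip: abs_mult)
      with M[OF x] show ?thesis
        unfolding corrected_form_eq[OF biorth] by (intro add_mono sum_mono)
    qed
    then show "\<exists>M. \<forall>x\<in>B. corrected_form A N p \<psi> x x \<le> M" by blast
  qed
qed (rule inner_product_corrected_form)

end

section \<open>Extending functionals to a completion\<close>

locale form_completion = continuous_form b
  for b :: "'s::locally_convex_space \<Rightarrow> 's \<Rightarrow> real" +
  fixes \<iota> :: "'s \<Rightarrow> 'h::real_vector" and V ip
  assumes completion: "hilbert_completion UNIV b \<iota> V ip"
begin

lemma hilbert_V: "hilbert_space_on V ip"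
  using completion by (simp add: hilbert_completion_def)

sublocale C: ip_space V ip
  by standard (use hilbert_V in \<open>simp add: hilbert_space_on_def\<close>)

lemma \<iota>_in [simp]: "\<iota> f \<in> V"
  using completion by (auto simp: hilbert_completion_def)

lemma \<iota>_linear: "\<iota> (f + g) = \<iota> f + \<iota> g" "\<iota> (c *\<^sub>R f) = c *\<^sub>R \<iota> f"
  using completion by (auto simp: hilbert_completion_def linear_on_def)

lemma linear_\<iota>: "linear \<iota>"
  by (rule linearI) (simp_all add: \<iota>_linear)

lemma ip_\<iota> [simp]: "ip (\<iota> f) (\<iota> g) = b f g"
  using completion by (simp add: hilbert_completion_def)

lemma nrm_\<iota> [simp]: "C.nrm (\<iota> f) = nrm f"
  by (simp add: ip_norm_def)

lemma \<iota>_dense: "x \<in> V \<Longrightarrow> e > 0 \<Longrightarrow> \<exists>f. C.nrm (\<iota> f - x) < e"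
  using completion C.ip_closure_eq[of "range \<iota>"] by (auto simp: hilbert_completion_def)

abbreviation approx :: "'h \<Rightarrow> 's filter" where
  "approx \<equiv> approximating \<iota> ip"

lemma approx_neq_bot [simp]:
  assumes "x \<in> V"
  shows "approx x \<noteq> bot"
  unfolding approximating_def
proof (rule filtercomap_neq_bot)
  fix P assume "\<forall>\<^sub>F r in nhds (0::real). P r"
  then obtain d where "d > 0" and d: "\<And>r. dist r 0 < d \<Longrightarrow> P r"
    unfolding eventually_nhds_metric by blast
  then obtain f where "C.nrm (\<iota> f - x) < d" using \<iota>_dense[OF assms] by blast
  then show "\<exists>f. P (C.nrm (\<iota> f - x))" using assms by (intro exI[of _ f] d) simp
qed

lemma approx_converges: "x \<in> V \<Longrightarrow> C.converges \<iota> x (approx x)"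
  by (simp add: C.converges_def approximating_def filterlim_filtercomap)

abbreviation H :: "'s dual set" where
  "H \<equiv> norm_continuous_dual \<iota> ip"

abbreviation pairing :: "'s dual \<Rightarrow> 'h \<Rightarrow> real" where
  "pairing \<equiv> ext_pairing \<iota> ip"

lemma H_eq_bounded_dual: "H = bounded_dual"
  by (simp add: norm_continuous_dual_def bounded_dual_def)

text \<open>The pairing is a limit along a filter; any bounded functional on the completion that extends \<open>u\<close>
  evaluates it.\<close>

lemma pairing_of_extension:
  assumes l: "bounded_functional_on V ip l" and u: "\<And>f. dual_apply u f = l (\<iota> f)"
  shows "u \<in> H" and "x \<in> V \<Longrightarrow> pairing u x = l x"
    and "x \<in> V \<Longrightarrow> C.converges (\<lambda>i. \<iota> (F i)) x G \<Longrightarrow> ((\<lambda>i. dual_apply u (F i)) \<longlongrightarrow> l x) G"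
proof -
  obtain C where "\<And>x. x \<in> V \<Longrightarrow> \<bar>l x\<bar> \<le> C * C.nrm x"
    using l by (auto simp: bounded_functional_on_def)
  then have "\<bar>dual_apply u f\<bar> \<le> C * C.nrm (\<iota> f)" for f by (simp only: u \<iota>_in)
  then show "u \<in> H" unfolding norm_continuous_dual_def by blast
  obtain w where w: "w \<in> V" "\<And>x. x \<in> V \<Longrightarrow> ip w x = l x"
    using C.riesz_representation[OF hilbert_V l] by blast
  show lim: "((\<lambda>i. dual_apply u (F i)) \<longlongrightarrow> l x) G"
    if "x \<in> V" "C.converges (\<lambda>i. \<iota> (F i)) x G" for x and F :: "'b \<Rightarrow> 's" and G
    using C.tendsto_ip[OF C.converges_const[OF w(1)] that(2)] w that(1) by (simp add: u)
  show "pairing u x = l x" if "x \<in> V" for x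
  proof -
    have u_eq: "dual_apply u = (\<lambda>f. ip w (\<iota> f))" using u w(2) by (simp add: fun_eq_iff)
    have "(dual_apply u \<longlongrightarrow> l x) (approx x)"
      using C.tendsto_ip[OF C.converges_const[OF w(1)] approx_converges[OF that]] w that
      by (simp add: u_eq)
    then show ?thesis unfolding ext_pairing_def using that by (intro tendsto_Lim) auto
  qed
qed

text \<open>The Cauchy sequence representing \<open>u\<close> in the space of test functions converges in the completion, to
  a vector whose inner products extend \<open>u\<close>.\<close>

lemma extension_exists:
  assumes "u \<in> H"
  shows "\<exists>l. bounded_functional_on V ip l \<and> (\<forall>f. dual_apply u f = l (\<iota> f))"
proof -
  have u: "u \<in> bounded_dual" using assms by (simp add: H_eq_bounded_dual)
  let ?g = "approximant u"
  have "C.cauchy (\<lambda>n. \<iota> (?g n))"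
    using approximant(1)[OF u]
    by (auto simp: cauchy_def C.cauchy_def linear_diff[OF linear_\<iota>, symmetric])
  then obtain w where w: "C.converges (\<lambda>n. \<iota> (?g n)) w sequentially"
    using hilbert_V C.hilbert_iff by blast
  then have wV: "w \<in> V" by (simp add: C.converges_def)
  have "dual_apply u f = ip w (\<iota> f)" for f
    using C.tendsto_ip[OF w C.converges_const[OF \<iota>_in[of f]]] approximant(2)[OF u, of f]
    by (auto intro: LIMSEQ_unique)
  moreover have "bounded_functional_on V ip (ip w)"
    using wV C.cauchy_schwarz[of w]
    by (auto simp: bounded_functional_on_def linear_on_def C.ip_linear_right)
  ultimately show ?thesis by blast
qed

lemma pairing_bounded: "u \<in> H \<Longrightarrow> bounded_functional_on V ip (pairing u)"
proof -
  assume "u \<in> H"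
  then obtain l where l: "bounded_functional_on V ip l" "\<And>f. dual_apply u f = l (\<iota> f)"
    using extension_exists by blast
  from l(1) show "bounded_functional_on V ip (pairing u)"
    using pairing_of_extension(2)[OF l] C.subspace
    by (auto simp: bounded_functional_on_def linear_on_def)
qed

lemma pairing_\<iota> [simp]: "u \<in> H \<Longrightarrow> pairing u (\<iota> f) = dual_apply u f"
  using extension_exists pairing_of_extension(2) by (metis \<iota>_in)

lemma pairing_limit:
  assumes "u \<in> H" "C.converges (\<lambda>i. \<iota> (F i)) x G"
  shows "((\<lambda>i. dual_apply u (F i)) \<longlongrightarrow> pairing u x) G"
  using assms by (intro pairing_of_extension(3) pairing_bounded) (auto simp: C.converges_def)

text \<open>Conversely every bounded functional on the completion restricts to an element of the dual, by the
  continuity of the norm.  Hence \<open>H\<close> is the whole dual of the completion.\<close>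

lemma functional_in_H:
  assumes l: "bounded_functional_on V ip l"
  shows "dual_apply (Dual (\<lambda>f. l (\<iota> f))) = (\<lambda>f. l (\<iota> f))" (is ?A)
    and "Dual (\<lambda>f. l (\<iota> f)) \<in> H" (is ?B)
    and "x \<in> V \<Longrightarrow> pairing (Dual (\<lambda>f. l (\<iota> f))) x = l x" (is "_ \<Longrightarrow> ?C")
proof -
  from l obtain C where C: "\<And>x. x \<in> V \<Longrightarrow> \<bar>l x\<bar> \<le> C * C.nrm x" and lin: "linear_on V l"
    by (auto simp: bounded_functional_on_def)
  have bound: "\<bar>l (\<iota> f)\<bar> \<le> C * nrm f" for f using C[of "\<iota> f"] by simp
  have "linear (\<lambda>f. l (\<iota> f))"
    using lin by (intro linearI) (auto simp: linear_on_def \<iota>_linear)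
  then show ?A using bound by (rule norm_bounded_functional_is_dual)
  then have ext: "\<And>f. dual_apply (Dual (\<lambda>f. l (\<iota> f))) f = l (\<iota> f)" by simp
  show ?B by (rule pairing_of_extension(1)[OF l ext])
  show "x \<in> V \<Longrightarrow> ?C" by (rule pairing_of_extension(2)[OF l ext])
qed

lemma subspace_H: "subspace H"
  unfolding H_eq_bounded_dual by (rule subspace_bounded_dual)

lemma pairing_linear:
  "u \<in> H \<Longrightarrow> v \<in> H \<Longrightarrow> x \<in> V \<Longrightarrow> pairing (u + v) x = pairing u x + pairing v x"
  "u \<in> H \<Longrightarrow> x \<in> V \<Longrightarrow> pairing (c *\<^sub>R u) x = c * pairing u x"
proof -
  have eq: "pairing w x = r" if "w \<in> H" "x \<in> V" "(dual_apply w \<longlongrightarrow> r) (approx x)" for w x r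
    using that pairing_limit[OF that(1) approx_converges[OF that(2)]] approx_neq_bot
    by (blast intro: tendsto_unique)
  have lim: "(dual_apply w \<longlongrightarrow> pairing w x) (approx x)" if "w \<in> H" "x \<in> V" for w x
    using pairing_limit[OF that(1) approx_converges[OF that(2)]] .
  show "pairing (u + v) x = pairing u x + pairing v x" if "u \<in> H" "v \<in> H" "x \<in> V"
  proof (rule eq)
    have "dual_apply (u + v) = (\<lambda>f. dual_apply u f + dual_apply v f)" by (simp add: plus_dual.rep_eq)
    then show "(dual_apply (u + v) \<longlongrightarrow> pairing u x + pairing v x) (approx x)"
      using that by (simp add: tendsto_add lim)
  qed (use that subspace_H in \<open>auto simp: subspace_add\<close>)
  show "pairing (c *\<^sub>R u) x = c * pairing u x" if "u \<in> H" "x \<in> V"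
  proof (rule eq)
    have "dual_apply (c *\<^sub>R u) = (\<lambda>f. c * dual_apply u f)" by (simp add: scaleR_dual.rep_eq)
    then show "(dual_apply (c *\<^sub>R u) \<longlongrightarrow> c * pairing u x) (approx x)"
      using that by (simp add: tendsto_mult_left lim)
  qed (use that subspace_H in \<open>auto simp: subspace_scale\<close>)
qed

lemma H_eqI:
  assumes "u \<in> H" "v \<in> H" "\<And>x. x \<in> V \<Longrightarrow> pairing u x = pairing v x"
  shows "u = v"
  using assms by (intro dual_eqI) (metis \<iota>_in pairing_\<iota>)

lemma in_H_sum: "(\<And>i. i \<in> I \<Longrightarrow> u i \<in> H) \<Longrightarrow> (\<Sum>i\<in>I. u i) \<in> H"
  using subspace_H by (rule subspace_sum)

lemma pairing_sum:
  assumes "\<And>i. i \<in> I \<Longrightarrow> u i \<in> H" "x \<in> V"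
  shows "pairing (\<Sum>i\<in>I. u i) x = (\<Sum>i\<in>I. pairing (u i) x)"
  using assms(1)
proof (induction I rule: infinite_finite_induct)
  have "pairing 0 x = 0"
    using pairing_linear(2)[of 0 x 0] assms(2) subspace_0[OF subspace_H] by simp
  then show "pairing (sum u I) x = (\<Sum>i\<in>I. pairing (u i) x)" if "infinite I" for I using that by simp
  show "pairing (sum u {}) x = (\<Sum>i\<in>{}. pairing (u i) x)" using \<open>pairing 0 x = 0\<close> by simp
qed (simp add: assms(2) pairing_linear in_H_sum)

end

section \<open>The corrected operator on the completion\<close>

locale native_space = form_completion "corrected_form A N p \<psi>" \<iota> V ip
  for A :: "'s::locally_convex_space \<Rightarrow> 's dual" and N p \<psi>
    and \<iota> :: "'s \<Rightarrow> 'h::real_vector" and V ip +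
  fixes \<phi> :: "nat \<Rightarrow> 'h"
  assumes biorth_\<psi>: "biorthogonal dual_apply N p \<psi>"
    and \<phi>_in: "\<And>n. n \<in> {1..N} \<Longrightarrow> \<phi> n \<in> V"
    and biorth_\<phi>: "biorthogonal (ext_pairing \<iota> ip) N p \<phi>"
begin

text \<open>Keeps the index set in the form \<open>{1..N}\<close>, as it occurs in the parameters of an interpretation.\<close>

declare One_nat_def [simp del]

text \<open>The form dominates the square of \<open>\<langle>p n, f\<rangle>\<close>, since its other part is the form at the projection of
  \<open>f\<close> and so is nonnegative.\<close>

lemma p_in_H:
  assumes "n \<in> {1..N}"
  shows "p n \<in> H"
proof -
  have "\<bar>dual_apply (p n) f\<bar> \<le> 1 * C.nrm (\<iota> f)" for f
  proof -
    have "(dual_apply (p n) f)\<^sup>2 \<le> (\<Sum>n\<in>{1..N}. dual_apply (p n) f * dual_apply (p n) f)"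
      using assms member_le_sum[of n "{1..N}" "\<lambda>n. dual_apply (p n) f * dual_apply (p n) f"]
      by (simp add: power2_eq_square)
    also have "\<dots> \<le> corrected_form A N p \<psi> f f"
      using ip_self_nonneg[of "test_proj N p \<psi> f"]
      unfolding dual_apply_corrected_eq_form[OF biorth_\<psi> biorth_\<psi>, symmetric]
      by (simp add: corrected_form_eq[OF biorth_\<psi>] dual_apply_corrected[OF biorth_\<psi>]
          test_proj_fixes test_proj_annihilated[OF biorth_\<psi>])
    also have "\<dots> = (nrm f)\<^sup>2" by (simp add: nrm_power2)
    finally show ?thesis
      using abs_le_square_iff[of "dual_apply (p n) f" "nrm f"] by simp
  qed
  then show ?thesis unfolding norm_continuous_dual_def by blast
qed

sublocale S: biorthogonal_splitting V ip "{1..N}" "\<lambda>n. pairing (p n)" \<phi>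
proof
  show "pairing (p n) (\<phi> m) = (if m = n then 1 else 0)" if "n \<in> {1..N}" "m \<in> {1..N}" for n m
    using biorth_\<phi> that by (simp add: biorthogonal_def)
qed (use hilbert_V \<phi>_in p_in_H pairing_bounded in auto)

abbreviation A\<phi> :: "'h \<Rightarrow> 's dual" where
  "A\<phi> \<equiv> ext_corrected \<iota> ip A N p \<phi>"

abbreviation systems :: "(nat \<Rightarrow> 's) filter" where
  "systems \<equiv> approximating_systems \<iota> ip N p \<phi>"

lemma systems_biorthogonal: "\<forall>\<^sub>F \<eta> in systems. biorthogonal dual_apply N p \<eta>"
  unfolding approximating_systems_def by (rule filter_leD[OF inf_le1]) (simp add: eventually_principal)

lemma systems_converges:
  assumes "n \<in> {1..N}"
  shows "C.converges (\<lambda>\<eta>. \<iota> (\<eta> n)) (\<phi> n) systems"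
proof -
  have "systems \<le> filtercomap (\<lambda>\<eta>. \<eta> n) (approx (\<phi> n))"
    unfolding approximating_systems_def using assms by (intro le_infI2 INF_lower)
  moreover have "((\<lambda>\<eta>. C.nrm (\<iota> (\<eta> n) - \<phi> n)) \<longlongrightarrow> 0) (filtercomap (\<lambda>\<eta>. \<eta> n) (approx (\<phi> n)))"
    using approx_converges[OF \<phi>_in[OF assms]]
    by (intro filterlim_filtercomapI) (simp add: C.converges_def)
  ultimately have "((\<lambda>\<eta>. C.nrm (\<iota> (\<eta> n) - \<phi> n)) \<longlongrightarrow> 0) systems"
    by (rule filterlim_mono[OF _ order_refl, rotated])
  then show ?thesis using \<phi>_in[OF assms] by (simp add: C.converges_def)
qed

text \<open>Universal systems approximate any system in the completion.  Test functions close to \<open>\<phi> n\<close> are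
  nearly biorthogonal to \<open>p\<close>; subtracting the small defects times \<open>\<psi> m\<close> makes them biorthogonal and does
  not change the limit.\<close>

lemma systems_neq_bot: "systems \<noteq> bot"
proof -
  have "\<exists>f. C.nrm (\<iota> f - \<phi> n) < 1 / Suc k" if "n \<in> {1..N}" for n k
    using \<iota>_dense[OF \<phi>_in[OF that], of "1 / Suc k"] by simp
  then obtain e' where "\<And>n k. n \<in> {1..N} \<Longrightarrow> C.nrm (\<iota> (e' n k) - \<phi> n) < 1 / Suc k" by metis
  then obtain e where e: "\<And>n k. n \<in> {1..N} \<Longrightarrow> C.nrm (\<iota> (e k n) - \<phi> n) < 1 / Suc k"
    using that[of "\<lambda>k n. e' n k"] by simp
  have e_conv: "C.converges (\<lambda>k. \<iota> (e k n)) (\<phi> n) sequentially" if n: "n \<in> {1..N}" for n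
  proof -
    have "(\<lambda>k. 1 / real (Suc k)) \<longlonglongrightarrow> 0" by (intro LIMSEQ_Suc lim_1_over_n)
    then have "(\<lambda>k. C.nrm (\<iota> (e k n) - \<phi> n)) \<longlonglongrightarrow> 0"
      by (rule Lim_null_comparison[OF always_eventually, rotated])
        (use e[OF n] \<phi>_in[OF n] in \<open>simp add: less_imp_le\<close>)
    then show ?thesis using \<phi>_in[OF n] by (simp add: C.converges_def)
  qed
  define \<delta> where "\<delta> m n = (if n = m then 1 else (0::real))" for m n :: nat
  define \<eta> where "\<eta> k n = e k n - (\<Sum>m\<in>{1..N}. (dual_apply (p m) (e k n) - \<delta> m n) *\<^sub>R \<psi> m)" for k n
  have "biorthogonal dual_apply N p (\<eta> k)" for k
    unfolding biorthogonal_def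
    using sum_biorthogonal(1)[OF biorth_\<psi>]
    by (simp add: \<eta>_def \<delta>_def dual_apply_diff dual_apply_sum dual_apply_simps)
  moreover have "C.converges (\<lambda>k. \<iota> (\<eta> k n)) (\<phi> n) sequentially" if n: "n \<in> {1..N}" for n
  proof -
    have "C.converges (\<lambda>k. \<iota> (e k n) - (\<Sum>m\<in>{1..N}. (dual_apply (p m) (e k n) - \<delta> m n) *\<^sub>R \<iota> (\<psi> m)))
        (\<phi> n - (\<Sum>m\<in>{1..N}. (pairing (p m) (\<phi> n) - \<delta> m n) *\<^sub>R \<iota> (\<psi> m))) sequentially"
      using n by (intro C.converges_diff C.converges_sum C.converges_scaleR C.converges_const
          tendsto_intros pairing_limit p_in_H e_conv \<iota>_in)
    moreover have "(\<Sum>m\<in>{1..N}. (pairing (p m) (\<phi> n) - \<delta> m n) *\<^sub>R \<iota> (\<psi> m)) = 0"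
      using biorth_\<phi> n by (intro sum.neutral) (auto simp: biorthogonal_def \<delta>_def)
    ultimately show ?thesis
      by (simp add: \<eta>_def linear_diff[OF linear_\<iota>] linear_sum[OF linear_\<iota>] linear_scale[OF linear_\<iota>])
  qed
  ultimately have "filterlim \<eta> systems sequentially"
    unfolding approximating_systems_def
    by (auto simp: filterlim_inf filterlim_principal filterlim_INF filterlim_filtercomap_iff
        approximating_def C.converges_def o_def)
  then show ?thesis by (auto simp: filterlim_def bot_unique filtermap_bot_iff)
qed

lemma test_proj_converges:
  assumes "x \<in> V"
  shows "C.converges (\<lambda>(\<eta>, f). \<iota> (test_proj N p \<eta> f)) (S.proj x) (systems \<times>\<^sub>F approx x)"
proof -
  have snd_conv: "C.converges (\<lambda>z. \<iota> (snd z)) x (systems \<times>\<^sub>F approx x)"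
    using approx_converges[OF assms] unfolding C.converges_def
    by (auto intro: filterlim_compose[OF _ filterlim_snd])
  have fst_conv: "C.converges (\<lambda>z. \<iota> (fst z n)) (\<phi> n) (systems \<times>\<^sub>F approx x)"
    if "n \<in> {1..N}" for n
    using systems_converges[OF that] unfolding C.converges_def
    by (auto intro: filterlim_compose[OF _ filterlim_fst])
  have "C.converges (\<lambda>z. \<iota> (snd z) - (\<Sum>n\<in>{1..N}. dual_apply (p n) (snd z) *\<^sub>R \<iota> (fst z n)))
      (S.proj x) (systems \<times>\<^sub>F approx x)"
    unfolding S.proj_def
    by (intro C.converges_diff C.converges_sum C.converges_scaleR pairing_limit p_in_H snd_conv fst_conv)
  then show ?thesis
    by (simp add: test_proj_def case_prod_unfold linear_diff[OF linear_\<iota>] linear_sum[OF linear_\<iota>]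
        linear_scale[OF linear_\<iota>])
qed

text \<open>The corrected operators of universal systems are given by the form at the projections of the two
  arguments, which converge to their projections along \<open>\<phi>\<close>.\<close>

lemma corrected_limit:
  assumes x: "x \<in> V"
  shows "((\<lambda>(\<eta>, f). dual_apply (corrected A N p \<eta> f) g) \<longlongrightarrow> ip (S.proj x) (S.proj (\<iota> g)))
    (systems \<times>\<^sub>F approx x)"
proof -
  let ?F = "systems \<times>\<^sub>F approx x"
  have "C.converges (\<lambda>\<eta>. \<iota> g - (\<Sum>n\<in>{1..N}. dual_apply (p n) g *\<^sub>R \<iota> (\<eta> n))) (S.proj (\<iota> g)) systems"
    unfolding S.proj_def using p_in_H
    by (intro C.converges_diff C.converges_sum) 
      (auto intro!: C.converges_const C.converges_scaleR systems_converges)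
  then have "C.converges (\<lambda>\<eta>. \<iota> (test_proj N p \<eta> g)) (S.proj (\<iota> g)) systems"
    by (simp add: test_proj_def linear_diff[OF linear_\<iota>] linear_sum[OF linear_\<iota>] linear_scale[OF linear_\<iota>])
  then have g: "C.converges (\<lambda>z. \<iota> (test_proj N p (fst z) g)) (S.proj (\<iota> g)) ?F"
    unfolding C.converges_def by (auto intro: filterlim_compose[OF _ filterlim_fst])
  have "((\<lambda>z. ip (case z of (\<eta>, f) \<Rightarrow> \<iota> (test_proj N p \<eta> f)) (\<iota> (test_proj N p (fst z) g)))
      \<longlongrightarrow> ip (S.proj x) (S.proj (\<iota> g))) ?F"
    by (rule C.tendsto_ip[OF test_proj_converges[OF x] g])
  moreover have "\<forall>\<^sub>F z in ?F. biorthogonal dual_apply N p (fst z)"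
    using filterlim_fst systems_biorthogonal by (rule eventually_compose_filterlim[rotated])
  then have "\<forall>\<^sub>F z in ?F. ip (case z of (\<eta>, f) \<Rightarrow> \<iota> (test_proj N p \<eta> f)) (\<iota> (test_proj N p (fst z) g))
      = (case z of (\<eta>, f) \<Rightarrow> dual_apply (corrected A N p \<eta> f) g)"
    by eventually_elim (auto simp: dual_apply_corrected_eq_form[OF _ biorth_\<psi>])
  ultimately show ?thesis by (rule Lim_transform_eventually)
qed

lemma proj_functional_bounded:
  assumes "x \<in> V"
  shows "bounded_functional_on V ip (\<lambda>y. ip (S.proj x) (S.proj y))"
proof -
  obtain D where D: "\<And>y. y \<in> V \<Longrightarrow> C.nrm (S.proj y) \<le> D * C.nrm y" using S.proj_le_nrm by blast
  have "\<bar>ip (S.proj x) (S.proj y)\<bar> \<le> (C.nrm (S.proj x) * D) * C.nrm y" if y: "y \<in> V" for y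
  proof -
    have "\<bar>ip (S.proj x) (S.proj y)\<bar> \<le> C.nrm (S.proj x) * C.nrm (S.proj y)"
      using assms y by (simp add: C.cauchy_schwarz)
    also have "\<dots> \<le> C.nrm (S.proj x) * (D * C.nrm y)"
      using assms y D by (intro mult_left_mono) auto
    finally show ?thesis by (simp add: mult.assoc)
  qed
  then show ?thesis
    using assms unfolding bounded_functional_on_def linear_on_def
    by (auto simp: S.proj_linear C.ip_linear_right)
qed

lemma
  assumes x: "x \<in> V"
  shows A\<phi>_in_H: "A\<phi> x \<in> H"
    and dual_apply_A\<phi>: "dual_apply (A\<phi> x) g = ip (S.proj x) (S.proj (\<iota> g))"
    and pairing_A\<phi>: "y \<in> V \<Longrightarrow> pairing (A\<phi> x) y = ip (S.proj x) (S.proj y)"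
proof -
  have "Lim (systems \<times>\<^sub>F approx x) (\<lambda>(\<eta>, f). dual_apply (corrected A N p \<eta> f) g)
      = ip (S.proj x) (S.proj (\<iota> g))" for g
    using systems_neq_bot x by (intro tendsto_Lim corrected_limit) (auto simp: prod_filter_eq_bot)
  then have eq: "A\<phi> x = Dual (\<lambda>g. ip (S.proj x) (S.proj (\<iota> g)))"
    unfolding ext_corrected_def by simp
  note func = functional_in_H[OF proj_functional_bounded[OF x]]
  show "A\<phi> x \<in> H" unfolding eq by (rule func(2))
  show "dual_apply (A\<phi> x) g = ip (S.proj x) (S.proj (\<iota> g))" unfolding eq func(1) by (rule refl)
  show "pairing (A\<phi> x) y = ip (S.proj x) (S.proj y)" if "y \<in> V"
    unfolding eq by (rule func(3)[OF that])
qed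

abbreviation Rp :: "'h \<Rightarrow> 's dual" where
  "Rp \<equiv> R_p pairing N p"

abbreviation R\<phi> :: "'s dual \<Rightarrow> 'h" where
  "R\<phi> \<equiv> R_phi pairing N \<phi>"

abbreviation ip' :: "'h \<Rightarrow> 'h \<Rightarrow> real" where
  "ip' \<equiv> (\<lambda>x y. pairing (A\<phi> x + Rp x) y)"

lemma Rp_in_H: "Rp x \<in> H"
  unfolding R_p_def using subspace_H p_in_H by (intro in_H_sum subspace_scale)

lemma A_plus_R_in_H: "x \<in> V \<Longrightarrow> A\<phi> x + Rp x \<in> H"
  using subspace_H A\<phi>_in_H Rp_in_H by (simp add: subspace_add)

lemma pairing_Rp:
  assumes "y \<in> V"
  shows "pairing (Rp x) y = (\<Sum>n\<in>{1..N}. pairing (p n) x * pairing (p n) y)"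
proof -
  have "pairing (Rp x) y = (\<Sum>n\<in>{1..N}. pairing (pairing (p n) x *\<^sub>R p n) y)"
    unfolding R_p_def using assms p_in_H subspace_H by (intro pairing_sum subspace_scale)
  also have "\<dots> = (\<Sum>n\<in>{1..N}. pairing (p n) x * pairing (p n) y)"
    using assms p_in_H by (intro sum.cong refl pairing_linear(2))
  finally show ?thesis .
qed

text \<open>The inner product of the theorem is the adapted one of the splitting by \<open>p\<close> and \<open>\<phi>\<close>, so
  the results on such splittings apply.\<close>

lemma ip'_eq: "x \<in> V \<Longrightarrow> y \<in> V \<Longrightarrow> ip' x y = S.adapted x y"
  by (simp add: pairing_linear A\<phi>_in_H Rp_in_H pairing_A\<phi> pairing_Rp S.adapted_def)

lemma corrected_at_test_functions:
  assumes \<eta>: "biorthogonal dual_apply N p \<eta>" and eq: "\<And>n. n \<in> {1..N} \<Longrightarrow> \<phi> n = \<iota> (\<eta> n)"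
  shows "A\<phi> (\<iota> f) = corrected A N p \<eta> f"
    and "(\<lambda>f g. dual_apply (A\<phi> (\<iota> f) + Rp (\<iota> f)) g) = corrected_form A N p \<eta>"
proof -
  have proj: "S.proj (\<iota> f) = \<iota> (test_proj N p \<eta> f)" for f
    using p_in_H eq
    by (simp add: S.proj_def test_proj_def linear_diff[OF linear_\<iota>] linear_sum[OF linear_\<iota>]
        linear_scale[OF linear_\<iota>])
  show A: "A\<phi> (\<iota> f) = corrected A N p \<eta> f" for f
    by (rule dual_eqI) (simp add: dual_apply_A\<phi> proj dual_apply_corrected_eq_form[OF \<eta> biorth_\<psi>])
  have "Rp (\<iota> f) = R_p dual_apply N p f" for f
    unfolding R_p_def using p_in_H by (intro sum.cong) auto
  then show "(\<lambda>f g. dual_apply (A\<phi> (\<iota> f) + Rp (\<iota> f)) g) = corrected_form A N p \<eta>"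
    by (simp add: fun_eq_iff corrected_form_def A)
qed

abbreviation completed_form :: "'s \<Rightarrow> 's \<Rightarrow> real" where
  "completed_form \<equiv> (\<lambda>f g. dual_apply (A\<phi> (\<iota> f) + Rp (\<iota> f)) g)"

lemma completed_form_eq: "completed_form f g = ip' (\<iota> f) (\<iota> g)"
  by (simp add: A_plus_R_in_H)

lemma inner_product_completed_form: "inner_product_on UNIV completed_form"
proof -
  have eq: "completed_form = (\<lambda>f g. S.adapted (\<iota> f) (\<iota> g))"
    by (simp only: fun_eq_iff completed_form_eq ip'_eq \<iota>_in) simp
  have "\<iota> f \<noteq> 0" if "f \<noteq> 0" for f
    using that nrm_\<iota>[of f] by (metis C.nrm_zero UNIV_I nrm_eq_0)
  then show ?thesis
    unfolding eq inner_product_on_def linear_on_def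
    by (auto simp: \<iota>_linear S.adapted.ip_linear_left intro: S.adapted.ip_commute S.adapted.ip_self_pos)
qed

lemma hilbert_ip': "hilbert_space_on V ip'"
  using hilbert_space_on_cong[of V ip' S.adapted, OF ip'_eq] S.hilbert_adapted by simp

sublocale P: ip_space V ip'
  by standard (use hilbert_ip' in \<open>simp add: hilbert_space_on_def\<close>)

lemma converges_ip':
  assumes "C.converges X x F"
  shows "P.converges X x F"
proof -
  have "P.nrm y = S.adapted.nrm y" if "y \<in> V" for y using that ip'_eq by (simp add: ip_norm_def)
  with S.adapted_converges[OF assms] show ?thesis
    by (simp add: P.converges_def S.adapted.converges_def)
qed

lemma completion_ip': "hilbert_completion UNIV completed_form \<iota> V ip'"
  unfolding hilbert_completion_def
proof (intro conjI ballI)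
  have "\<exists>f. P.nrm (\<iota> f - x) < e" if "x \<in> V" "e > 0" for x e
  proof -
    have "((\<lambda>f. P.nrm (\<iota> f - x)) \<longlongrightarrow> 0) (approx x)"
      using converges_ip'[OF approx_converges[OF that(1)]] by (simp add: P.converges_def)
    then have "\<forall>\<^sub>F f in approx x. P.nrm (\<iota> f - x) < e" using that(2) by (rule order_tendstoD)
    then show ?thesis using that(1) by (intro eventually_happens') auto
  qed
  then show "ip_closure V ip' (range \<iota>) = V" by (subst P.ip_closure_eq) auto
qed (auto simp: hilbert_ip' linear_on_def \<iota>_linear completed_form_eq)

abbreviation HA :: "'h set" where
  "HA \<equiv> {x\<in>V. \<forall>n\<in>{1..N}. pairing (p n) x = 0}"

abbreviation N\<phi> :: "'h set" where
  "N\<phi> \<equiv> span (\<phi> ` {1..N})"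

lemma N\<phi>_in_V: "x \<in> N\<phi> \<Longrightarrow> x \<in> V"
  using S.span_subset by blast

lemma orthogonal_sum_V: "orthogonal_sum V ip' HA N\<phi>"
  using S.orthogonal_sum orthogonal_sum_cong[of HA N\<phi> ip' S.adapted V] ip'_eq N\<phi>_in_V by simp

lemma HA_complement: "HA = {x\<in>V. \<forall>y\<in>N\<phi>. ip' x y = 0}"
  using S.orthogonal_complement_span ip'_eq N\<phi>_in_V by auto

lemma hilbert_HA: "hilbert_space_on HA ip'"
  using S.hilbert_kernel hilbert_space_on_cong[of HA ip' S.adapted] ip'_eq by simp

lemma hilbert_N\<phi>: "hilbert_space_on N\<phi> ip'"
  using S.hilbert_span hilbert_space_on_cong[of N\<phi> ip' S.adapted] ip'_eq N\<phi>_in_V by simp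

text \<open>For density, the projection along the universal system \<open>\<psi>\<close> maps approximating test functions to
  annihilated ones, and the limit, being in the kernel, is not affected.\<close>

lemma completion_HA: "hilbert_completion (annihilated p N) completed_form \<iota> HA ip'"
proof -
  interpret HA: ip_space HA ip'
    by standard (use hilbert_HA in \<open>simp add: hilbert_space_on_def\<close>)
  have sub: "\<iota> ` annihilated p N \<subseteq> HA" using p_in_H by (auto simp: annihilated_def)
  have dense: "\<exists>f\<in>annihilated p N. HA.nrm (\<iota> f - x) < e" if x: "x \<in> HA" and e: "e > 0" for x e
  proof -
    have xV: "x \<in> V" using x by simp
    have "C.converges (\<lambda>f. \<iota> f - (\<Sum>n\<in>{1..N}. dual_apply (p n) f *\<^sub>R \<iota> (\<psi> n)))
        (x - (\<Sum>n\<in>{1..N}. pairing (p n) x *\<^sub>R \<iota> (\<psi> n))) (approx x)"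
      by (intro C.converges_diff C.converges_sum C.converges_scaleR C.converges_const pairing_limit
          p_in_H approx_converges[OF xV] \<iota>_in)
    moreover have "(\<Sum>n\<in>{1..N}. pairing (p n) x *\<^sub>R \<iota> (\<psi> n)) = 0"
      using x by (intro sum.neutral) auto
    ultimately have "C.converges (\<lambda>f. \<iota> (test_proj N p \<psi> f)) x (approx x)"
      by (simp add: test_proj_def linear_diff[OF linear_\<iota>] linear_sum[OF linear_\<iota>] linear_scale[OF linear_\<iota>])
    then have "((\<lambda>f. P.nrm (\<iota> (test_proj N p \<psi> f) - x)) \<longlongrightarrow> 0) (approx x)"
      by (intro conjunct2[OF conjunct2[OF converges_ip'[unfolded P.converges_def]]])
    then have "\<forall>\<^sub>F f in approx x. P.nrm (\<iota> (test_proj N p \<psi> f) - x) < e"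
      using e by (rule order_tendstoD)
    then obtain f where "P.nrm (\<iota> (test_proj N p \<psi> f) - x) < e"
      using eventually_happens'[OF approx_neq_bot[OF xV]] by blast
    then show ?thesis using test_proj_annihilated[OF biorth_\<psi>] by blast
  qed
  show ?thesis
    unfolding hilbert_completion_def
  proof (intro conjI ballI)
    show "ip_closure HA ip' (\<iota> ` annihilated p N) = HA"
      unfolding HA.ip_closure_eq[OF sub] using dense by blast
  qed (use sub in \<open>auto simp: hilbert_HA linear_on_def \<iota>_linear completed_form_eq\<close>)
qed

end

section \<open>The predual\<close>

context native_space begin

text \<open>The isometry from the predual onto the completion, called \<open>K\<close> at the beginning.  It is
  specified by the Riesz theorem; that it is inverse to \<open>A\<^sub>\<phi> + R\<^sub>p\<close> is then a matter of uniqueness.\<close>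

definition riesz_rep :: "'s dual \<Rightarrow> 'h" where
  "riesz_rep u = (SOME w. w \<in> V \<and> (\<forall>x\<in>V. ip' w x = pairing u x))"

lemma riesz_rep:
  assumes "u \<in> H"
  shows "riesz_rep u \<in> V" "x \<in> V \<Longrightarrow> ip' (riesz_rep u) x = pairing u x"
proof -
  have "bounded_functional_on V S.adapted (pairing u)"
    using S.bounded_functional_adapted[OF pairing_bounded[OF assms]] .
  from S.adapted.riesz_representation[OF S.hilbert_adapted this]
  have "\<exists>w. w \<in> V \<and> (\<forall>x\<in>V. ip' w x = pairing u x)" by (auto simp: ip'_eq)
  from someI_ex[OF this] show "riesz_rep u \<in> V" "x \<in> V \<Longrightarrow> ip' (riesz_rep u) x = pairing u x"
    by (auto simp: riesz_rep_def)
qed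

lemma riesz_rep_unique:
  assumes "u \<in> H" "w \<in> V" "\<And>x. x \<in> V \<Longrightarrow> ip' w x = pairing u x"
  shows "riesz_rep u = w"
  using assms riesz_rep by (intro P.eq_if_ip_eq) auto

lemma riesz_rep_A_plus_R: "x \<in> V \<Longrightarrow> riesz_rep (A\<phi> x + Rp x) = x"
  by (rule riesz_rep_unique[OF A_plus_R_in_H]) simp_all

lemma A_plus_R_riesz_rep: "u \<in> H \<Longrightarrow> A\<phi> (riesz_rep u) + Rp (riesz_rep u) = u"
  using riesz_rep by (intro H_eqI A_plus_R_in_H) auto

lemma linear_riesz_rep: "linear_on H riesz_rep"
proof -
  have "riesz_rep (u + v) = riesz_rep u + riesz_rep v" if "u \<in> H" "v \<in> H" for u v
  proof (rule riesz_rep_unique)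
    show "ip' (riesz_rep u + riesz_rep v) x = pairing (u + v) x" if "x \<in> V" for x
      using P.ip_linear_left(1)[of "riesz_rep u" "riesz_rep v" x] that \<open>u \<in> H\<close> \<open>v \<in> H\<close>
      by (simp only: riesz_rep pairing_linear)
  qed (use that riesz_rep subspace_H in \<open>auto simp: subspace_add\<close>)
  moreover have "riesz_rep (c *\<^sub>R u) = c *\<^sub>R riesz_rep u" if "u \<in> H" for u c
  proof (rule riesz_rep_unique)
    show "ip' (c *\<^sub>R riesz_rep u) x = pairing (c *\<^sub>R u) x" if "x \<in> V" for x
      using P.ip_linear_left(2)[of "riesz_rep u" x c] that \<open>u \<in> H\<close>
      by (simp only: riesz_rep pairing_linear(2))
  qed (use that riesz_rep subspace_H in \<open>auto simp: subspace_scale\<close>)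
  ultimately show ?thesis by (simp add: linear_on_def)
qed

lemma bij_riesz_rep: "bij_betw riesz_rep H V"
  by (rule bij_betw_byWitness[of _ "\<lambda>x. A\<phi> x + Rp x"])
    (auto simp: A_plus_R_riesz_rep riesz_rep_A_plus_R riesz_rep A_plus_R_in_H)

text \<open>Both sides are the inner product with \<open>\<phi> n\<close>, which represents \<open>p n\<close>.  So \<open>K\<close> matches the splitting
  of the predual with that of the completion.\<close>

lemma pairing_\<phi>: "u \<in> H \<Longrightarrow> n \<in> {1..N} \<Longrightarrow> pairing u (\<phi> n) = pairing (p n) (riesz_rep u)"
  using riesz_rep[of u] S.adapted_\<phi>[of n "riesz_rep u"] \<phi>_in[of n] S.adapted.ip_commute[of "\<phi> n" "riesz_rep u"]
  by (simp flip: ip'_eq)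

lemma riesz_rep_p: "n \<in> {1..N} \<Longrightarrow> riesz_rep (p n) = \<phi> n"
  using p_in_H \<phi>_in S.adapted_\<phi> by (intro riesz_rep_unique) (auto simp: ip'_eq)

text \<open>Projecting after \<open>K\<close> kills the span of \<open>p\<close>, which \<open>K\<close> maps onto the span of \<open>\<phi>\<close>, and changes nothing
  where \<open>K\<close> inverts \<open>A\<^sub>\<phi>\<close>.\<close>

definition Ainv :: "'s dual \<Rightarrow> 'h" where
  "Ainv u = S.proj (riesz_rep u)"

text \<open>The finite-rank part restores exactly the component removed by the projection.\<close>

lemma Ainv_plus_R_phi: "u \<in> H \<Longrightarrow> Ainv u + R\<phi> u = riesz_rep u"
  unfolding Ainv_def R_phi_def S.proj_def by (simp add: pairing_\<phi>)

abbreviation ipH :: "'s dual \<Rightarrow> 's dual \<Rightarrow> real" where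
  "ipH \<equiv> (\<lambda>u v. pairing v (Ainv u + R\<phi> u))"

abbreviation HA' :: "'s dual set" where
  "HA' \<equiv> {u\<in>H. \<forall>n\<in>{1..N}. pairing u (\<phi> n) = 0}"

abbreviation Np :: "'s dual set" where
  "Np \<equiv> span (p ` {1..N})"

lemma ipH_eq: "u \<in> H \<Longrightarrow> v \<in> H \<Longrightarrow> ipH u v = ip' (riesz_rep u) (riesz_rep v)"
  using riesz_rep P.ip_commute by (simp add: Ainv_plus_R_phi)

lemma riesz_pair_H: "riesz_pair V ip' H ipH pairing riesz_rep"
  by unfold_locales
    (auto simp: hilbert_ip' subspace_H linear_riesz_rep bij_riesz_rep ipH_eq riesz_rep)

sublocale R: riesz_pair V ip' H ipH pairing riesz_rep
  by (rule riesz_pair_H)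

lemma HA'_eq: "HA' = {u\<in>H. riesz_rep u \<in> HA}"
  using riesz_rep pairing_\<phi> by auto

text \<open>For the converse inclusion, if \<open>K u\<close> lies in the span of \<open>\<phi>\<close> then \<open>A\<^sub>\<phi>\<close> vanishes at it, so
  \<open>u = (A\<^sub>\<phi> + R\<^sub>p) (K u)\<close> lies in the range of \<open>R\<^sub>p\<close>.\<close>

lemma Np_eq: "Np = {u\<in>H. riesz_rep u \<in> N\<phi>}"
proof (intro set_eqI iffI)
  fix u assume u: "u \<in> Np"
  have "subspace {u\<in>H. riesz_rep u \<in> N\<phi>}"
    using subspace_H by (auto simp: subspace_def R.K_linear span_add span_scale span_zero)
  moreover have "p ` {1..N} \<subseteq> {u\<in>H. riesz_rep u \<in> N\<phi>}"
    using p_in_H riesz_rep_p by (auto simp: span_base)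
  ultimately show "u \<in> {u\<in>H. riesz_rep u \<in> N\<phi>}" using span_minimal u by blast
next
  fix u assume u: "u \<in> {u\<in>H. riesz_rep u \<in> N\<phi>}"
  then have "S.proj (riesz_rep u) = 0" by (simp add: S.in_span_iff)
  then have "A\<phi> (riesz_rep u) = 0"
    using u riesz_rep by (intro dual_eqI) (simp add: dual_apply_A\<phi> zero_dual.rep_eq)
  then have "u = Rp (riesz_rep u)" using u A_plus_R_riesz_rep[of u] by simp
  moreover have "Rp (riesz_rep u) \<in> Np"
    unfolding R_p_def by (intro span_sum span_scale span_base) auto
  ultimately show "u \<in> Np" by simp
qed

lemma Rp_HA: "x \<in> HA \<Longrightarrow> Rp x = 0"
  by (simp add: R_p_def)

lemma A\<phi>_HA: "x \<in> HA \<Longrightarrow> A\<phi> x \<in> HA' \<and> riesz_rep (A\<phi> x) = x"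
  using riesz_rep_A_plus_R[of x] Rp_HA[of x] A\<phi>_in_H[of x] by (simp add: HA'_eq)

lemma Ainv_HA':
  assumes "u \<in> HA'"
  shows "Ainv u = riesz_rep u" "Ainv u \<in> HA" "A\<phi> (Ainv u) = u"
proof -
  have u: "u \<in> H" "riesz_rep u \<in> HA" using assms HA'_eq by auto
  then show eq: "Ainv u = riesz_rep u" unfolding Ainv_def by (intro S.proj_kernel) simp
  show "Ainv u \<in> HA" using u eq by simp
  show "A\<phi> (Ainv u) = u" using A_plus_R_riesz_rep[OF u(1)] Rp_HA[OF u(2)] by (simp add: eq)
qed

lemma Ainv_the_inv_into: "u \<in> HA' \<Longrightarrow> Ainv u = the_inv_into HA A\<phi> u"
proof -
  assume u: "u \<in> HA'"
  have "inj_on A\<phi> HA" using A\<phi>_HA by (intro inj_on_inverseI[of _ riesz_rep]) auto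
  then show "Ainv u = the_inv_into HA A\<phi> u"
    using the_inv_into_f_eq[of A\<phi> HA "Ainv u" u] Ainv_HA'[OF u] by simp
qed

lemma Ainv_eq_0_iff: "u \<in> H \<Longrightarrow> Ainv u = 0 \<longleftrightarrow> u \<in> Np"
  using riesz_rep by (simp add: Np_eq Ainv_def S.in_span_iff)

lemma linear_Ainv: "linear_on H Ainv"
  unfolding linear_on_def Ainv_def by (auto simp: R.K_linear S.proj_linear riesz_rep)

lemma orthogonal_sum_H: "orthogonal_sum H ipH HA' Np"
  using R.orthogonal_sum_preimage[OF orthogonal_sum_V] unfolding HA'_eq Np_eq .

lemma Np_in_H: "u \<in> Np \<Longrightarrow> u \<in> H"
  by (simp add: Np_eq)

text \<open>The two prescriptions determine an operator because the two summands span the predual.\<close>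

lemma Ainv_unique:
  assumes B: "linear_on H B" "\<forall>u\<in>HA'. B u = the_inv_into HA A\<phi> u" "\<forall>u\<in>Np. B u = 0"
    and u: "u \<in> H"
  shows "B u = Ainv u"
proof -
  have "u \<in> {v + w |v w. v \<in> HA' \<and> w \<in> Np}"
    using orthogonal_sum_H u by (simp only: orthogonal_sum_def)
  then obtain v w where vw: "u = v + w" "v \<in> HA'" "w \<in> Np" by blast
  then have H: "v \<in> H" "w \<in> H" using Np_in_H by auto
  have "B u = B v + B w" "Ainv u = Ainv v + Ainv w"
    using B(1) linear_Ainv H vw(1) by (auto simp: linear_on_def)
  moreover have "B v = Ainv v"
    using bspec[OF B(2) vw(2)] Ainv_the_inv_into[OF vw(2)] by (rule trans[OF _ sym])
  moreover have "B w = Ainv w"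
    using bspec[OF B(3) vw(3)] Ainv_eq_0_iff[OF H(2)] vw(3) by metis
  ultimately show ?thesis by simp
qed

lemma riesz_pair_HA: "riesz_pair HA ip' HA' ipH pairing riesz_rep"
  unfolding HA'_eq using hilbert_HA by (rule R.restrict) simp

lemma riesz_pair_Np: "riesz_pair N\<phi> ip' Np ipH pairing riesz_rep"
  unfolding Np_eq using hilbert_N\<phi> by (rule R.restrict) (use N\<phi>_in_V in blast)

lemma dual_V: "is_dual_of V ip' H ipH (\<lambda>x u. pairing u x)"
  by (rule riesz_pair.is_dual_of, rule R.reverse) (rule A_plus_R_in_H riesz_rep_A_plus_R; assumption)+

lemma riesz_map_HA: "is_riesz_map HA ip' HA' ipH pairing A\<phi>"
  using A\<phi>_HA by (intro riesz_pair.is_riesz_map_inverse[OF riesz_pair_HA]) auto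

lemma riesz_map_HA': "is_riesz_map HA' ipH HA ip' (\<lambda>x u. pairing u x) Ainv"
proof -
  have "riesz_pair HA' ipH HA ip' (\<lambda>x u. pairing u x) A\<phi>"
    using A\<phi>_HA by (intro riesz_pair.reverse[OF riesz_pair_HA]) auto
  then show ?thesis
    by (rule riesz_pair.is_riesz_map_inverse) (use Ainv_HA' in auto)
qed

end

section \<open>Inner product, completion and predual\<close>

theorem theorem3:
  fixes j A :: "'s::locally_convex_space \<Rightarrow> 's dual"
    and N :: nat and p :: "nat \<Rightarrow> 's dual"
  assumes "nuclear_dual_pair j"
    and "inj_on p {1..N}" and "independent (p ` {1..N})"
    and "linear A" and "continuous_on UNIV A"
    and "symmetric_operator A" and "conditionally_pos_def p N A"
  shows
    "(\<forall>\<psi>. biorthogonal dual_apply N p \<psi> \<longrightarrow>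
        inner_product_on UNIV (corrected_form A N p \<psi>) \<and>
        (\<exists>\<iota> (H' :: 's dual set) ip. hilbert_completion UNIV (corrected_form A N p \<psi>) \<iota> H' ip)) \<and>
     (\<forall>\<psi> \<iota> (H' :: 'h::real_vector set) ip\<^sub>0 \<phi>.
        biorthogonal dual_apply N p \<psi> \<longrightarrow>
        hilbert_completion UNIV (corrected_form A N p \<psi>) \<iota> H' ip\<^sub>0 \<longrightarrow>
        (\<forall>n\<in>{1..N}. \<phi> n \<in> H') \<longrightarrow>
        biorthogonal (ext_pairing \<iota> ip\<^sub>0) N p \<phi> \<longrightarrow>
        (let pr = ext_pairing \<iota> ip\<^sub>0;
             A\<phi> = ext_corrected \<iota> ip\<^sub>0 A N p \<phi>;
             Rp = R_p pr N p;
             R\<phi> = R_phi pr N \<phi>;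
             b = (\<lambda>f g. dual_apply (A\<phi> (\<iota> f) + Rp (\<iota> f)) g);
             ip' = (\<lambda>x y. pr (A\<phi> x + Rp x) y);
             HA = {x\<in>H'. \<forall>n\<in>{1..N}. pr (p n) x = 0};
             N\<phi> = span (\<phi> ` {1..N});
             Np = span (p ` {1..N});
             H = norm_continuous_dual \<iota> ip\<^sub>0;
             HA' = {u\<in>H. \<forall>n\<in>{1..N}. pr u (\<phi> n) = 0}
         in
           (\<forall>u\<in>H. \<forall>x\<in>H'. (dual_apply u \<longlongrightarrow> pr u x) (approximating \<iota> ip\<^sub>0 x)) \<and>
           (\<forall>u\<in>H. \<forall>f. pr u (\<iota> f) = dual_apply u f) \<and>
           (\<forall>x\<in>H'. \<forall>g. ((\<lambda>(\<eta>, f). dual_apply (corrected A N p \<eta> f) g) \<longlongrightarrow> dual_apply (A\<phi> x) g)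
              (approximating_systems \<iota> ip\<^sub>0 N p \<phi> \<times>\<^sub>F approximating \<iota> ip\<^sub>0 x)) \<and>
           (\<forall>\<eta>. biorthogonal dual_apply N p \<eta> \<longrightarrow> (\<forall>n\<in>{1..N}. \<phi> n = \<iota> (\<eta> n)) \<longrightarrow>
              (\<forall>f. A\<phi> (\<iota> f) = corrected A N p \<eta> f) \<and> b = corrected_form A N p \<eta>) \<and>

           inner_product_on UNIV b \<and>
           hilbert_completion UNIV b \<iota> H' ip' \<and>
           orthogonal_sum H' ip' HA N\<phi> \<and>
           hilbert_completion (annihilated p N) b \<iota> HA ip' \<and>
           HA = {x\<in>H'. \<forall>y\<in>N\<phi>. ip' x y = 0} \<and>

           (\<exists>Ainv.
              let is_Ainv = (\<lambda>B. linear_on H B \<and>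
                    (\<forall>u\<in>HA'. B u = the_inv_into HA A\<phi> u) \<and> (\<forall>u\<in>Np. B u = 0));
                  ip = (\<lambda>u v. pr v (Ainv u + R\<phi> u))
              in
                is_Ainv Ainv \<and> (\<forall>B. is_Ainv B \<longrightarrow> (\<forall>u\<in>H. B u = Ainv u)) \<and>
                {u\<in>H. Ainv u = 0} = Np \<and>
                hilbert_space_on H ip \<and>
                is_dual_of H' ip' H ip (\<lambda>x u. pr u x) \<and>
                is_dual_of H ip H' ip' pr \<and>
                orthogonal_sum H ip HA' Np \<and>
                is_dual_of HA' ip HA ip' pr \<and>
                is_dual_of Np ip N\<phi> ip' pr \<and>
                is_riesz_map HA ip' HA' ip pr A\<phi> \<and>
                is_riesz_map HA' ip HA ip' (\<lambda>x u. pr u x) Ainv)))"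
proof (rule conjI, goal_cases)
  case 1
  show ?case
  proof (intro allI impI conjI)
    fix \<psi> assume \<psi>: "biorthogonal dual_apply N p \<psi>"
    show "inner_product_on UNIV (corrected_form A N p \<psi>)"
      using assms(4,6,7) \<psi> by (rule inner_product_corrected_form)
    interpret continuous_form "corrected_form A N p \<psi>"
      using assms \<psi> by (intro continuous_corrected_form) (auto simp: nuclear_dual_pair_def)
    show "\<exists>\<iota> (H' :: 's dual set) ip. hilbert_completion UNIV (corrected_form A N p \<psi>) \<iota> H' ip"
      using completion_in_dual by blast
  qed
next
  case 2
  show ?case
  proof (intro allI impI, goal_cases)
    case (1 \<psi> \<iota> H' ip\<^sub>0 \<phi>)
    interpret continuous_form "corrected_form A N p \<psi>"
      using assms 1(1) by (intro continuous_corrected_form) (auto simp: nuclear_dual_pair_def)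
    interpret native_space A N p \<psi> \<iota> H' ip\<^sub>0 \<phi>
      by unfold_locales (use 1 in auto)
    have limits: "\<forall>u\<in>H. \<forall>x\<in>H'. (dual_apply u \<longlongrightarrow> pairing u x) (approx x)"
      "\<forall>u\<in>H. \<forall>f. pairing u (\<iota> f) = dual_apply u f"
      "\<forall>x\<in>H'. \<forall>g. ((\<lambda>(\<eta>, f). dual_apply (corrected A N p \<eta> f) g) \<longlongrightarrow> dual_apply (A\<phi> x) g)
        (systems \<times>\<^sub>F approx x)"
      using pairing_limit[OF _ approx_converges] corrected_limit by (simp_all add: dual_apply_A\<phi>)
    have universal: "\<forall>\<eta>. biorthogonal dual_apply N p \<eta> \<longrightarrow> (\<forall>n\<in>{1..N}. \<phi> n = \<iota> (\<eta> n)) \<longrightarrow>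
        (\<forall>f. A\<phi> (\<iota> f) = corrected A N p \<eta> f) \<and> completed_form = corrected_form A N p \<eta>"
      using corrected_at_test_functions by blast
    have Ainv: "\<forall>u\<in>HA'. Ainv u = the_inv_into HA A\<phi> u" "\<forall>u\<in>Np. Ainv u = 0"
      "\<forall>B. linear_on H B \<and> (\<forall>u\<in>HA'. B u = the_inv_into HA A\<phi> u) \<and> (\<forall>u\<in>Np. B u = 0) \<longrightarrow>
        (\<forall>u\<in>H. B u = Ainv u)"
      "{u\<in>H. Ainv u = 0} = Np"
      using Ainv_the_inv_into Ainv_unique Ainv_eq_0_iff Np_in_H by blast+
    show ?case
      unfolding Let_def
      by (intro conjI exI[of _ Ainv])
        (rule limits universal inner_product_completed_form completion_ip' orthogonal_sum_V completion_HA
          HA_complement linear_Ainv Ainv R.hilbert_U dual_V R.is_dual_of orthogonal_sum_H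
          riesz_pair.is_dual_of[OF riesz_pair_HA] riesz_pair.is_dual_of[OF riesz_pair_Np]
          riesz_map_HA riesz_map_HA')+
  qed
qed

end
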